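(* Let $h\ge0$ and $0<\beta<\beta_0:=\beta_c/\sqrt{4\alpha}$, where $\beta_c=\rho(\Delta^2\Lambda)^{-1/2}$ and $\alpha=1+\mathbf 1\{\Delta^2\text{ is indefinite}\}$. Let $\mathbf q\in[0,1]^m$ be the unique solution of $q_s=\mathbb E\tanh^2(\beta\eta\sqrt{(\Delta^2\Lambda\mathbf q)_s}+h)$, $s=1,\dots,m$, $\eta\sim N(0,1)$, and put $$\mathrm{RS}(\beta,h)=\log2+\sum_{s=1}^m\lambda_s\,\mathbb E\log\cosh\big(\beta\eta\sqrt{(\Delta^2\Lambda\mathbf q)_s}+h\big)+\frac{\beta^2}{4}\mathcal Q(\mathbf 1-\mathbf q),$$ $$b(\beta,h)=\sum_{s=1}^m\lambda_s\,\mathrm{Var}\big(\log\cosh(\beta\eta\sqrt{(\Delta^2\Lambda\mathbf q)_s}+h)\big)-\frac{\beta^2}{2}\mathcal Q(\mathbf q),$$ where $\mathcal Q(\mathbf x)=\mathbf x^{\top}\Lambda\Delta^2\Lambda\mathbf x$ and $\mathbf 1$ is the all-ones vector. Then there is a constant $K$ not depending on $N$ such that $$|\mathbb E F_N-\mathrm{RS}(\beta,h)|\le\frac KN .$$ Moreover, if $h>0$, then $N^{1/2}\big(F_N-\mathrm{RS}(\beta,h)\big)$ converges in distribution to $N(0,b(\beta,h))$ as $N\to\infty$.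
   Context: Multi-species SK model. $m\ge2$; $\Delta^2=(\Delta^2_{s,t})_{s,t=1}^m$ is a symmetric invertible nonzero real matrix with non-negative entries (not necessarily positive-definite). For each $N$, $\{1,\dots,N\}$ is partitioned into disjoint species $I_1,\dots,I_m$ with $|I_s|=\lambda_sN$, where the ratios $\lambda_s\in(0,1)$ are fixed; $\Lambda=\mathrm{diag}(\lambda_1,\dots,\lambda_m)$. The disorder $(g_{ij})_{1\le i<j\le N}$ consists of independent centered Gaussians with $\mathbb E g_{ij}^2=\Delta^2_{s,t}$ when $i\in I_s$, $j\in I_t$. For $\sigma\in\{-1,1\}^N$, $H_N(\sigma)=\frac{\beta}{\sqrt N}\sum_{i<j}g_{ij}\sigma_i\sigma_j+h\sum_i\sigma_i$, $Z_N=\sum_\sigma e^{H_N(\sigma)}$, and the free energy is $F_N=\frac1N\log Z_N$ (a random variable). $\rho$ is the spectral radius. Uniqueness of $\mathbf q$ holds because $\beta<\beta_c$. *)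

theory Defs
  imports "HOL-Probability.Probability" "Jordan_Normal_Form.Spectral_Radius"
begin

unbundle no vec_syntax

text \<open>Species are numbered \<open>0, \<dots>, m - 1\<close>, vertices \<open>1, \<dots>, N\<close>. \<open>D\<close> stands for
  \<open>\<Delta>\<^sup>2\<close>; it is a single matrix of variances, not the square of some given matrix.\<close>

definition ratio_mat :: "nat \<Rightarrow> (nat \<Rightarrow> real) \<Rightarrow> real mat" where
  "ratio_mat m lam = mat_diag m lam"

definition indefinite_mat :: "nat \<Rightarrow> real mat \<Rightarrow> bool" where
  "indefinite_mat m A \<longleftrightarrow>
     (\<exists>x\<in>carrier_vec m. scalar_prod x (A *\<^sub>v x) > 0) \<and>
     (\<exists>x\<in>carrier_vec m. scalar_prod x (A *\<^sub>v x) < 0)"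

definition beta_c :: "nat \<Rightarrow> real mat \<Rightarrow> (nat \<Rightarrow> real) \<Rightarrow> real" where
  "beta_c m D lam =
     spectral_radius (map_mat complex_of_real (D * ratio_mat m lam)) powr (- 1 / 2)"

definition beta_0 :: "nat \<Rightarrow> real mat \<Rightarrow> (nat \<Rightarrow> real) \<Rightarrow> real" where
  "beta_0 m D lam = beta_c m D lam / sqrt (4 * (1 + of_bool (indefinite_mat m D)))"

text \<open>The normal law with mean \<open>\<mu>\<close> and variance \<open>v \<ge> 0\<close>; for \<open>v = 0\<close> it is the point mass
  at \<open>\<mu>\<close>, which is needed because entries of \<open>D\<close> may vanish.\<close>

definition normal_law :: "real \<Rightarrow> real \<Rightarrow> real measure" where
  "normal_law \<mu> v = distr std_normal_distribution borel (\<lambda>x. \<mu> + sqrt v * x)"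

text \<open>The requirement \<open>|I\<^sub>s| = \<lambda>\<^sub>s N\<close> can be met only for these \<open>N\<close>; the model is considered
  for these system sizes, and \<open>N \<rightarrow> \<infinity>\<close> is understood along them.\<close>

definition msk_sizes :: "nat \<Rightarrow> (nat \<Rightarrow> real) \<Rightarrow> nat set" where
  "msk_sizes m lam = {N. N > 0 \<and> (\<forall>s<m. lam s * real N \<in> \<nat>)}"

definition msk_species :: "nat \<Rightarrow> nat \<Rightarrow> (nat \<Rightarrow> real) \<Rightarrow> (nat \<Rightarrow> nat set) \<Rightarrow> bool" where
  "msk_species N m lam I \<longleftrightarrow>
     (\<Union>s<m. I s) = {1..N} \<and> disjoint_family_on I {..<m} \<and>
     (\<forall>s<m. real (card (I s)) = lam s * real N)"

definition msk_disorder ::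
  "nat \<Rightarrow> nat \<Rightarrow> real mat \<Rightarrow> (nat \<Rightarrow> nat set) \<Rightarrow> 'a measure \<Rightarrow> (nat \<Rightarrow> nat \<Rightarrow> 'a \<Rightarrow> real) \<Rightarrow> bool" where
  "msk_disorder N m D I M g \<longleftrightarrow>
     prob_space M \<and>
     prob_space.indep_vars M (\<lambda>_. borel) (\<lambda>(i, j). g i j) {(i, j). 1 \<le> i \<and> i < j \<and> j \<le> N} \<and>
     (\<forall>s<m. \<forall>t<m. \<forall>i\<in>I s. \<forall>j\<in>I t. i < j \<longrightarrow>
        distr M borel (g i j) = normal_law 0 (D $$ (s, t)))"

definition msk_H ::
  "nat \<Rightarrow> real \<Rightarrow> real \<Rightarrow> (nat \<Rightarrow> nat \<Rightarrow> real) \<Rightarrow> (nat \<Rightarrow> real) \<Rightarrow> real" where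
  "msk_H N \<beta> h G \<sigma> =
     \<beta> / sqrt (real N) * (\<Sum>(i, j) \<in> {(i, j). 1 \<le> i \<and> i < j \<and> j \<le> N}. G i j * \<sigma> i * \<sigma> j)
     + h * (\<Sum>i\<in>{1..N}. \<sigma> i)"

definition msk_Z :: "nat \<Rightarrow> real \<Rightarrow> real \<Rightarrow> (nat \<Rightarrow> nat \<Rightarrow> real) \<Rightarrow> real" where
  "msk_Z N \<beta> h G = (\<Sum>\<sigma> \<in> {1..N} \<rightarrow>\<^sub>E {-1, 1}. exp (msk_H N \<beta> h G \<sigma>))"

definition msk_F :: "nat \<Rightarrow> real \<Rightarrow> real \<Rightarrow> (nat \<Rightarrow> nat \<Rightarrow> real) \<Rightarrow> real" where
  "msk_F N \<beta> h G = ln (msk_Z N \<beta> h G) / real N"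

definition msk_field ::
  "nat \<Rightarrow> real mat \<Rightarrow> (nat \<Rightarrow> real) \<Rightarrow> real \<Rightarrow> real \<Rightarrow> real vec \<Rightarrow> nat \<Rightarrow> real \<Rightarrow> real" where
  "msk_field m D lam \<beta> h q s \<eta> =
     \<beta> * \<eta> * sqrt (vec_index (D * ratio_mat m lam *\<^sub>v q) s) + h"

definition msk_fixed_point ::
  "nat \<Rightarrow> real mat \<Rightarrow> (nat \<Rightarrow> real) \<Rightarrow> real \<Rightarrow> real \<Rightarrow> real vec \<Rightarrow> bool" where
  "msk_fixed_point m D lam \<beta> h q \<longleftrightarrow>
     q \<in> carrier_vec m \<and> (\<forall>s<m. vec_index q s \<in> {0..1}) \<and>
     (\<forall>s<m. vec_index q s =
        (\<integral>\<eta>. (tanh (msk_field m D lam \<beta> h q s \<eta>))\<^sup>2 \<partial>std_normal_distribution))"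

definition msk_Q :: "nat \<Rightarrow> real mat \<Rightarrow> (nat \<Rightarrow> real) \<Rightarrow> real vec \<Rightarrow> real" where
  "msk_Q m D lam x = scalar_prod x (ratio_mat m lam * D * ratio_mat m lam *\<^sub>v x)"

definition msk_RS ::
  "nat \<Rightarrow> real mat \<Rightarrow> (nat \<Rightarrow> real) \<Rightarrow> real \<Rightarrow> real \<Rightarrow> real vec \<Rightarrow> real" where
  "msk_RS m D lam \<beta> h q =
     ln 2
     + (\<Sum>s<m. lam s *
          (\<integral>\<eta>. ln (cosh (msk_field m D lam \<beta> h q s \<eta>)) \<partial>std_normal_distribution))
     + \<beta>\<^sup>2 / 4 * msk_Q m D lam (Matrix.vec m (\<lambda>_. 1) - q)"

definition msk_b ::
  "nat \<Rightarrow> real mat \<Rightarrow> (nat \<Rightarrow> real) \<Rightarrow> real \<Rightarrow> real \<Rightarrow> real vec \<Rightarrow> real" where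
  "msk_b m D lam \<beta> h q =
     (\<Sum>s<m. lam s *
        prob_space.variance std_normal_distribution
          (\<lambda>\<eta>. ln (cosh (msk_field m D lam \<beta> h q s \<eta>))))
     - \<beta>\<^sup>2 / 2 * msk_Q m D lam q"

end

theory Submission
  imports Defs
begin

text \<open>
  The spin system is joined to a system of independent spins in Gaussian fields. The couplings are
  multiplied by \<open>sin \<theta>\<close>; at every site of species \<open>s\<close> there is an additional independent Gaussian field
  of variance \<open>\<beta>\<^sup>2 (\<Delta>\<^sup>2 \<Lambda> q)\<^sub>s\<close>, multiplied by \<open>cos \<theta>\<close>. At \<open>\<theta> = \<pi>/2\<close> this is the model, and at \<open>\<theta> = 0\<close>
  the sites are independent and everything is explicit. Write \<open>R\<close> for the vector of species overlaps of
  two configurations and \<open>Q\<close> for the quadratic form of the theorem. Half the derivative in \<open>sin\<^sup>2 \<theta>\<close> of the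
  covariance of the Hamiltonian is, up to a constant, \<open>N \<beta>\<^sup>2 / 4\<close> times \<open>Q(R - q)\<close>: the variance of the
  fields is the one that completes the square. By Gaussian integration by parts
  (\<open>gaussian_interpolation\<close>) the \<open>\<theta>\<close>-derivative of the mean of a smooth function of \<open>log Z\<close> therefore only
  involves Gibbs averages of \<open>Q(R - q)\<close> (\<open>log_partition_interpolation\<close>), so that all conclusions follow
  from one estimate: the mean of \<open>|Q(R - q)|\<close> is \<open>O(1/N)\<close> along the whole path (\<open>overlap_bound\<close>).

  For this estimate let \<open>v\<close> dominate \<open>|Q(R - q)|\<close> and follow the mean of the two-replica average
  \<open>\<langle>exp (s v)\<rangle>\<close> while \<open>s\<close> decreases with \<open>\<theta>\<close>. The derivative produces averages of \<open>Q(R - q)\<close> over pairs of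
  replicas, some of them outside the pair that carries the exponential weight. Chebyshev's association
  inequality bounds them all by the average over the weighted pair (\<open>replica_combination_bound\<close>). If \<open>Q\<close> is nonnegative,
  the terms with a negative sign can be dropped and the total coefficient is \<open>4\<close>; otherwise it is \<open>8\<close>.
  This is the factor \<open>4\<alpha>\<close> of the hypothesis, which says exactly that \<open>s\<close> can start at a value for which
  \<open>\<langle>exp (s v)\<rangle>\<close> is bounded for independent sites and still be of order \<open>N\<close> at the end of the path. At \<open>\<theta> = 0\<close>
  the bound comes from linearising the square by an auxiliary Gaussian variable and from Hoeffding's
  inequality for a biased spin (\<open>initial_exponential_bound\<close>).

  Applied to \<open>log Z\<close> itself, the interpolation gives the mean up to \<open>O(1)\<close>
  (\<open>mean_log_partition_comparison\<close>). Applied to \<open>cos (w log Z + \<alpha>)\<close> with \<open>w = y / \<surd>N\<close>, it is a linear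
  differential equation up to an error \<open>O(1/\<surd>N)\<close>, and the characteristic functions at the two ends of the
  path differ by the factor \<open>exp (\<beta>\<^sup>2 y\<^sup>2 Q(q) / 4)\<close> (\<open>cos_log_partition_comparison\<close>). At \<open>\<theta> = 0\<close> the logarithm
  of the partition function is a sum of independent variables, so the limit is \<open>exp (- y\<^sup>2 b / 2)\<close> and Levy's
  theorem applies. A limit of characteristic functions has modulus at most one, which forces \<open>b \<ge> 0\<close>. The
  ratios \<open>\<lambda>\<^sub>s\<close> may be irrational, and then no system size fits them exactly; therefore the
  species model below allows \<open>|I\<^sub>s|\<close> to fall short of \<open>\<lambda>\<^sub>s N\<close> by at most one, and \<open>b \<ge> 0\<close> is read off from
  systems with \<open>\<lfloor>\<lambda>\<^sub>s N\<rfloor>\<close> sites of species \<open>s\<close> (\<open>limiting_variance_nonneg\<close>).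

  Two deterministic facts remain. The spectral radius of \<open>\<Delta>\<^sup>2 \<Lambda>\<close> bounds \<open>|Q(x)|\<close> relative to the weighted norm
  \<open>\<Sum> \<lambda>\<^sub>s x\<^sub>s\<^sup>2\<close>, because extremal vectors of the Rayleigh quotient are eigenvectors
  (\<open>form_le_spectral_radius\<close>); and in this norm the fixed point equation is a contraction
  (\<open>unique_species_fixed_point\<close>).
\<close>

section \<open>Gaussian integration by parts and interpolation\<close>

abbreviation gauss :: "'j set \<Rightarrow> ('j \<Rightarrow> real) measure" where
  "gauss J \<equiv> PiM J (\<lambda>_. std_normal_distribution)"

lemma prob_std_normal: "prob_space std_normal_distribution"
  using real_dist_normal_dist real_distribution_def by blast

interpretation std_normal: real_distribution std_normal_distribution
  by (rule real_dist_normal_dist)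

lemma prob_gauss: "prob_space (gauss J)"
  by (intro prob_space_PiM prob_std_normal)

interpretation std_normals: product_prob_space "\<lambda>_ :: 'j. std_normal_distribution" UNIV
  by (intro product_prob_spaceI prob_std_normal)

lemma integrable_std_normal_bounded:
  fixes f :: "real \<Rightarrow> real"
  assumes "f \<in> borel_measurable borel" "\<And>x. \<bar>f x\<bar> \<le> K"
  shows "integrable std_normal_distribution f"
  by (rule std_normal.integrable_const_bound[of _ K]) (use assms in auto)

lemma integrable_gauss_component:
  assumes "j \<in> J"
  shows "integrable (gauss J) (\<lambda>x. x j)"
proof -
  have "distr (gauss J) std_normal_distribution (\<lambda>x. x j) = std_normal_distribution"
    by (intro distr_PiM_component prob_std_normal assms)
  moreover have "integrable std_normal_distribution (\<lambda>x. x)"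
    using integrable_std_normal_distribution_moment[of 1] by simp
  ultimately have "integrable (distr (gauss J) std_normal_distribution (\<lambda>x. x j)) (\<lambda>x. x)" by simp
  then show ?thesis
    by (subst (asm) integrable_distr_eq) (use assms in auto)
qed

text \<open>The product of \<open>G\<close> with the Gaussian density vanishes at \<open>\<plusminus>\<infinity>\<close>, so the integral of its derivative is zero.\<close>

lemma gaussian_ibp:
  fixes G :: "real \<Rightarrow> real"
  assumes deriv: "\<And>x. (G has_real_derivative G' x) (at x)"
    and cont: "\<And>x. isCont G' x"
    and bound: "\<And>x. \<bar>G x\<bar> \<le> K" "\<And>x. \<bar>G' x\<bar> \<le> K"
  shows "(\<integral>x. x * G x \<partial>std_normal_distribution) = (\<integral>x. G' x \<partial>std_normal_distribution)"
proof -
  let ?p = std_normal_density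
  have contG: "isCont G x" for x using deriv DERIV_isCont by blast
  have [measurable]: "G \<in> borel_measurable borel" "G' \<in> borel_measurable borel"
    using contG cont by (auto intro!: borel_measurable_continuous_onI simp: continuous_on_eq_continuous_at)
  have dp: "(?p has_real_derivative (- x * ?p x)) (at x)" for x
    unfolding std_normal_density_def
    by (auto intro!: derivative_eq_intros simp: power2_eq_square field_simps)
  have i1: "integrable std_normal_distribution (\<lambda>x. x * G x)"
  proof (rule Bochner_Integration.integrable_bound)
    show "integrable std_normal_distribution (\<lambda>x. K * x)"
      using integrable_std_normal_distribution_moment[of 1] by simp
    show "AE x in std_normal_distribution. norm (x * G x) \<le> norm (K * x)"
      by (intro AE_I2) (use bound in \<open>auto simp: abs_mult mult.commute[of K] intro!: mult_left_mono intro: order_trans[OF _ abs_ge_self]\<close>)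
  qed auto
  have i2: "integrable std_normal_distribution G'"
    by (rule integrable_std_normal_bounded[of _ K]) (use bound in auto)
  let ?f = "\<lambda>x. ?p x * G' x - ?p x * (x * G x)"
  have if1: "integrable lborel (\<lambda>x. ?p x * (x * G x))"
    using i1 by (subst (asm) integrable_density) auto
  have if2: "integrable lborel (\<lambda>x. ?p x * G' x)"
    using i2 by (subst (asm) integrable_density) auto
  have iff: "integrable lborel ?f" using if1 if2 by simp
  have p0: "(?p \<longlongrightarrow> 0) at_top" "(?p \<longlongrightarrow> 0) at_bot"
    unfolding std_normal_density_def by real_asymp+
  have F0: "((\<lambda>x. ?p x * G x) \<longlongrightarrow> 0) F" if "(?p \<longlongrightarrow> 0) F" for F
  proof (rule Lim_null_comparison)
    show "\<forall>\<^sub>F x in F. norm (?p x * G x) \<le> ?p x * K"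
      by (intro always_eventually) (auto simp: abs_mult intro!: mult_left_mono bound)
    show "((\<lambda>x. ?p x * K) \<longlongrightarrow> 0) F" using tendsto_mult_left_zero[OF that] by simp
  qed
  have "(LBINT x=-\<infinity>..\<infinity>. ?f x) = 0 - 0"
  proof (rule interval_integral_FTC_integrable[where F = "\<lambda>x. ?p x * G x"])
    show "((\<lambda>x. ?p x * G x) has_vector_derivative ?f x) (at x)" for x
      unfolding has_real_derivative_iff_has_vector_derivative[symmetric]
      by (rule derivative_eq_intros dp deriv refl)+ (simp add: algebra_simps)
    show "isCont ?f x" for x
      unfolding std_normal_density_def by (intro continuous_intros contG cont) auto
    show "set_integrable lborel (einterval (-\<infinity>) \<infinity>) ?f"
      unfolding set_integrable_def using iff by simp
    show "(((\<lambda>x. ?p x * G x) \<circ> real_of_ereal) \<longlongrightarrow> 0) (at_right (-\<infinity>))"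
      using F0[OF p0(2)] by (simp add: at_right_MInf filterlim_filtermap)
    show "(((\<lambda>x. ?p x * G x) \<circ> real_of_ereal) \<longlongrightarrow> 0) (at_left \<infinity>)"
      using F0[OF p0(1)] by (simp add: at_left_PInf filterlim_filtermap)
  qed auto
  then have "(LINT x|lborel. ?f x) = 0"
    by (simp add: interval_lebesgue_integral_def set_lebesgue_integral_def)
  then have "(LINT x|lborel. ?p x * G' x) = (LINT x|lborel. ?p x * (x * G x))"
    using if1 if2 by simp
  then show ?thesis by (simp add: integral_density)
qed

text \<open>Fubini reduces this to one dimension.\<close>

lemma gauss_ibp:
  fixes G :: "('j \<Rightarrow> real) \<Rightarrow> real"
  assumes J: "finite J" "j \<in> J"
    and [measurable]: "G \<in> borel_measurable (gauss J)" "G' \<in> borel_measurable (gauss J)"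
    and deriv: "\<And>x u. ((\<lambda>u. G (x(j := u))) has_real_derivative G' (x(j := u))) (at u)"
    and cont: "\<And>x u. isCont (\<lambda>u. G' (x(j := u))) u"
    and bound: "\<And>x. \<bar>G x\<bar> \<le> K" "\<And>x. \<bar>G' x\<bar> \<le> K"
  shows "(\<integral>x. x j * G x \<partial>gauss J) = (\<integral>x. G' x \<partial>gauss J)"
proof -
  interpret G: prob_space "gauss J" by (rule prob_gauss)
  define I where "I = J - {j}"
  have I: "J = insert j I" "finite I" "j \<notin> I" using J by (auto simp: I_def)
  have i1: "integrable (gauss J) (\<lambda>x. x j * G x)"
  proof (rule Bochner_Integration.integrable_bound)
    show "integrable (gauss J) (\<lambda>x. K * x j)" using integrable_gauss_component[OF J(2)] by simp
    show "AE x in gauss J. norm (x j * G x) \<le> norm (K * x j)"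
      by (intro AE_I2) (use bound in \<open>auto simp: abs_mult mult.commute[of K] intro!: mult_left_mono intro: order_trans[OF _ abs_ge_self]\<close>)
  qed (use J in measurable)
  have i2: "integrable (gauss J) G'"
    by (rule G.integrable_const_bound[of _ K]) (use bound in auto)
  have "(\<integral>x. x j * G x \<partial>gauss J)
      = (\<integral>x. (\<integral>y. (x(j:=y)) j * G (x(j:=y)) \<partial>std_normal_distribution) \<partial>gauss I)"
    using i1 I unfolding I(1) by (intro std_normals.product_integral_insert) auto
  also have "\<dots> = (\<integral>x. (\<integral>y. G' (x(j:=y)) \<partial>std_normal_distribution) \<partial>gauss I)"
    by (simp, intro Bochner_Integration.integral_cong refl gaussian_ibp[where K=K] deriv cont bound)
  also have "\<dots> = (\<integral>x. G' x \<partial>gauss J)"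
    using i2 I unfolding I(1) by (intro std_normals.product_integral_insert[symmetric]) auto
  finally show ?thesis .
qed

text \<open>A bound on the derivative that is uniform in the parameter dominates all difference quotients.\<close>

lemma has_real_derivative_integral:
  fixes f f' :: "real \<Rightarrow> 'a \<Rightarrow> real"
  assumes int: "\<And>t. integrable M (f t)"
    and meas: "\<And>t. f' t \<in> borel_measurable M"
    and deriv: "\<And>t x. x \<in> space M \<Longrightarrow> ((\<lambda>t. f t x) has_real_derivative f' t x) (at t)"
    and bound: "\<And>t x. x \<in> space M \<Longrightarrow> \<bar>f' t x\<bar> \<le> B x" and B: "integrable M B"
  shows "((\<lambda>t. \<integral>x. f t x \<partial>M) has_real_derivative (\<integral>x. f' t x \<partial>M)) (at t)"
  unfolding has_field_derivative_iff tendsto_at_iff_sequentially comp_def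
proof (intro allI impI)
  fix X :: "nat \<Rightarrow> real" assume X: "\<forall>i. X i \<in> UNIV - {t}" "X \<longlonglongrightarrow> t"
  have [measurable]: "f s \<in> borel_measurable M" for s using int by auto
  have "(\<lambda>i. \<integral>x. (f (X i) x - f t x) / (X i - t) \<partial>M) \<longlonglongrightarrow> (\<integral>x. f' t x \<partial>M)"
  proof (rule integral_dominated_convergence[where w = B])
    show "AE x in M. (\<lambda>i. (f (X i) x - f t x) / (X i - t)) \<longlonglongrightarrow> f' t x"
      using deriv[of _ t] X unfolding has_field_derivative_iff tendsto_at_iff_sequentially comp_def
      by (intro AE_I2) blast
    show "AE x in M. norm ((f (X i) x - f t x) / (X i - t)) \<le> B x" for i
    proof (intro AE_I2)
      fix x assume x: "x \<in> space M"
      have ne: "X i \<noteq> t" using X by auto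
      have "\<bar>f (X i) x - f t x\<bar> \<le> B x * \<bar>X i - t\<bar>"
        using field_differentiable_bound[of UNIV "\<lambda>t. f t x" "\<lambda>t. f' t x" "B x" "X i" t]
          deriv[OF x] bound[OF x] by (auto simp: has_field_derivative_at_within)
      then show "norm ((f (X i) x - f t x) / (X i - t)) \<le> B x"
        using ne by (simp add: divide_simps abs_mult)
    qed
  qed (use B meas in auto)
  then show "(\<lambda>i. ((\<integral>x. f (X i) x \<partial>M) - (\<integral>x. f t x \<partial>M)) / (X i - t)) \<longlonglongrightarrow> (\<integral>x. f' t x \<partial>M)"
    using int by simp
qed

text \<open>Each coordinate \<open>x j\<close> is rescaled by \<open>r j t\<close>. The chain rule produces the terms \<open>r' j t * x j * Fj\<close>, and
  integration by parts in the coordinate \<open>j\<close> exchanges the factor \<open>x j\<close> for \<open>r j t\<close> times a second derivative. Only the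
  diagonal second derivatives \<open>Fjj\<close> occur. \<open>Ft\<close> is the derivative in an explicit dependence on \<open>t\<close>. The functions
  live on all of \<open>'j \<Rightarrow> real\<close> but depend only on the coordinates in \<open>J\<close>; \<open>restr\<close> says so.\<close>

lemma gaussian_interpolation:
  fixes F Ft :: "real \<Rightarrow> ('j \<Rightarrow> real) \<Rightarrow> real" and Fj Fjj :: "'j \<Rightarrow> real \<Rightarrow> ('j \<Rightarrow> real) \<Rightarrow> real"
    and r r' :: "'j \<Rightarrow> real \<Rightarrow> real"
  assumes J: "finite J"
    and [measurable]: "\<And>t. F t \<in> borel_measurable (PiM J (\<lambda>_. borel))"
      "\<And>t. Ft t \<in> borel_measurable (PiM J (\<lambda>_. borel))"
      "\<And>j t. j \<in> J \<Longrightarrow> Fj j t \<in> borel_measurable (PiM J (\<lambda>_. borel))"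
      "\<And>j t. j \<in> J \<Longrightarrow> Fjj j t \<in> borel_measurable (PiM J (\<lambda>_. borel))"
    and restr: "\<And>t x. F t x = F t (restrict x J)" "\<And>t x. Ft t x = Ft t (restrict x J)"
      "\<And>j t x. j \<in> J \<Longrightarrow> Fj j t x = Fj j t (restrict x J)"
      "\<And>j t x. j \<in> J \<Longrightarrow> Fjj j t x = Fjj j t (restrict x J)"
    and deriv: "\<And>t x. ((\<lambda>t. F t (\<lambda>j. r j t * x j)) has_real_derivative
        Ft t (\<lambda>j. r j t * x j) + (\<Sum>j\<in>J. r' j t * x j * Fj j t (\<lambda>j. r j t * x j))) (at t)"
    and deriv2: "\<And>j t x u. j \<in> J \<Longrightarrow>
        ((\<lambda>u. Fj j t (x(j := u))) has_real_derivative Fjj j t (x(j := u))) (at u)"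
    and cont: "\<And>j t x u. j \<in> J \<Longrightarrow> isCont (\<lambda>u. Fjj j t (x(j := u))) u"
    and bF: "\<And>t x. \<bar>F t x\<bar> \<le> K * (1 + (\<Sum>j\<in>J. \<bar>x j\<bar>))"
    and bFt: "\<And>t x. \<bar>Ft t x\<bar> \<le> K"
    and bFj: "\<And>j t x. j \<in> J \<Longrightarrow> \<bar>Fj j t x\<bar> \<le> K" "\<And>j t x. j \<in> J \<Longrightarrow> \<bar>Fjj j t x\<bar> \<le> K"
    and br: "\<And>j t. \<bar>r j t\<bar> \<le> 1" "\<And>j t. \<bar>r' j t\<bar> \<le> 1"
  shows "((\<lambda>t. \<integral>x. F t (\<lambda>j. r j t * x j) \<partial>gauss J) has_real_derivative
      ((\<integral>x. Ft t (\<lambda>j. r j t * x j) \<partial>gauss J)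
        + (\<Sum>j\<in>J. r j t * r' j t * (\<integral>x. Fjj j t (\<lambda>j. r j t * x j) \<partial>gauss J)))) (at t)"
proof -
  interpret G: prob_space "gauss J" by (rule prob_gauss)
  let ?r = "\<lambda>t x. (\<lambda>j. r j t * x j)"
  have K0: "K \<ge> 0" using bFt[of undefined undefined] by linarith
  have meas_r: "(\<lambda>x. P (?r t x)) \<in> borel_measurable (gauss J)"
    if [measurable]: "P \<in> borel_measurable (PiM J (\<lambda>_. borel))" and re: "\<And>x. P x = P (restrict x J)" for P :: "('j \<Rightarrow> real) \<Rightarrow> real" and t
  proof -
    have "(\<lambda>x. P (restrict (?r t x) J)) \<in> borel_measurable (gauss J)"
      by measurable
    then show ?thesis by (subst (asm) re[symmetric])
  qed
  have meas [measurable]: "(\<lambda>x. F t (?r t x)) \<in> borel_measurable (gauss J)"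
    "(\<lambda>x. Ft t (?r t x)) \<in> borel_measurable (gauss J)"
    "j \<in> J \<Longrightarrow> (\<lambda>x. Fj j t (?r t x)) \<in> borel_measurable (gauss J)"
    "j \<in> J \<Longrightarrow> (\<lambda>x. Fjj j t (?r t x)) \<in> borel_measurable (gauss J)" for j t
    by (intro meas_r assms; blast)+
  have intx: "integrable (gauss J) (\<lambda>x. \<Sum>j\<in>J. \<bar>x j\<bar>)"
    by (intro Bochner_Integration.integrable_sum integrable_abs integrable_gauss_component)
  have intFt: "integrable (gauss J) (\<lambda>x. Ft t (?r t x))" for t
    by (rule G.integrable_const_bound[of _ K]) (use bFt meas in auto)
  have intFj: "integrable (gauss J) (\<lambda>x. r' j t * x j * Fj j t (?r t x))" if j: "j \<in> J" for j t
  proof (rule Bochner_Integration.integrable_bound)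
    show "integrable (gauss J) (\<lambda>x. K * x j)" using integrable_gauss_component[OF j] by simp
    show "(\<lambda>x. r' j t * x j * Fj j t (?r t x)) \<in> borel_measurable (gauss J)"
      using j by measurable
    show "AE x in gauss J. norm (r' j t * x j * Fj j t (?r t x)) \<le> norm (K * x j)"
    proof (intro AE_I2)
      fix x
      have "\<bar>r' j t\<bar> * \<bar>x j\<bar> * \<bar>Fj j t (?r t x)\<bar> \<le> 1 * \<bar>x j\<bar> * K"
        by (intro mult_mono br bFj j order_refl) auto
      then show "norm (r' j t * x j * Fj j t (?r t x)) \<le> norm (K * x j)"
        using K0 by (simp add: abs_mult mult.commute)
    qed
  qed
  have main: "((\<lambda>t. \<integral>x. F t (?r t x) \<partial>gauss J) has_real_derivative
      (\<integral>x. Ft t (?r t x) + (\<Sum>j\<in>J. r' j t * x j * Fj j t (?r t x)) \<partial>gauss J)) (at t)"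
  proof (rule has_real_derivative_integral[where B = "\<lambda>x. K * (1 + (\<Sum>j\<in>J. \<bar>x j\<bar>))"])
    show "integrable (gauss J) (\<lambda>x. K * (1 + (\<Sum>j\<in>J. \<bar>x j\<bar>)))" using intx by simp
    show "integrable (gauss J) (\<lambda>x. F t (?r t x))" for t
    proof (rule Bochner_Integration.integrable_bound)
      show "integrable (gauss J) (\<lambda>x. K * (1 + (\<Sum>j\<in>J. \<bar>x j\<bar>)))" using intx by simp
      show "AE x in gauss J. norm (F t (?r t x)) \<le> norm (K * (1 + (\<Sum>j\<in>J. \<bar>x j\<bar>)))"
      proof (intro AE_I2)
        fix x
        have "\<bar>F t (?r t x)\<bar> \<le> K * (1 + (\<Sum>j\<in>J. \<bar>r j t * x j\<bar>))" by (rule bF)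
        also have "\<dots> \<le> K * (1 + (\<Sum>j\<in>J. \<bar>x j\<bar>))"
          by (intro mult_left_mono add_left_mono sum_mono K0)
            (use br in \<open>auto simp: abs_mult intro!: mult_left_le_one_le\<close>)
        finally show "norm (F t (?r t x)) \<le> norm (K * (1 + (\<Sum>j\<in>J. \<bar>x j\<bar>)))" by simp
      qed
    qed (use meas in auto)
    show "(\<lambda>x. Ft t (?r t x) + (\<Sum>j\<in>J. r' j t * x j * Fj j t (?r t x))) \<in> borel_measurable (gauss J)" for t
      using intFt intFj by (intro borel_measurable_add borel_measurable_sum borel_measurable_integrable) auto
    show "\<bar>Ft t (?r t x) + (\<Sum>j\<in>J. r' j t * x j * Fj j t (?r t x))\<bar> \<le> K * (1 + (\<Sum>j\<in>J. \<bar>x j\<bar>))" for t x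
    proof -
      have "\<bar>r' j t * x j * Fj j t (?r t x)\<bar> \<le> K * \<bar>x j\<bar>" if j: "j \<in> J" for j
      proof -
        have "\<bar>r' j t\<bar> * \<bar>x j\<bar> * \<bar>Fj j t (?r t x)\<bar> \<le> 1 * \<bar>x j\<bar> * K"
          by (intro mult_mono br bFj j order_refl) auto
        then show ?thesis by (simp add: abs_mult mult.commute)
      qed
      then have "\<bar>\<Sum>j\<in>J. r' j t * x j * Fj j t (?r t x)\<bar> \<le> K * (\<Sum>j\<in>J. \<bar>x j\<bar>)"
        unfolding sum_distrib_left by (intro order_trans[OF sum_abs] sum_mono)
      then show ?thesis using bFt[of t "?r t x"] by (simp add: algebra_simps)
    qed
    show "((\<lambda>t. F t (?r t x)) has_real_derivative
        Ft t (?r t x) + (\<Sum>j\<in>J. r' j t * x j * Fj j t (?r t x))) (at t)" for t x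
      by (rule deriv)
  qed
  have ibp: "(\<integral>x. r' j t * x j * Fj j t (?r t x) \<partial>gauss J)
      = r j t * r' j t * (\<integral>x. Fjj j t (?r t x) \<partial>gauss J)" if j: "j \<in> J" for j
  proof -
    have upd: "?r t (x(j := u)) = (?r t x)(j := r j t * u)" for x u by auto
    have "(\<integral>x. x j * Fj j t (?r t x) \<partial>gauss J) = (\<integral>x. r j t * Fjj j t (?r t x) \<partial>gauss J)"
    proof (rule gauss_ibp[OF J j, where K = K])
      show "(\<lambda>x. Fj j t (?r t x)) \<in> borel_measurable (gauss J)" using j by measurable
      show "(\<lambda>x. r j t * Fjj j t (?r t x)) \<in> borel_measurable (gauss J)" using j by measurable
      show "((\<lambda>u. Fj j t (?r t (x(j := u)))) has_real_derivative
          r j t * Fjj j t (?r t (x(j := u)))) (at u)" for x u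
        unfolding upd
        by (rule DERIV_cong[OF DERIV_chain2[OF deriv2[OF j], of "\<lambda>u. r j t * u" "r j t"]])
          (auto intro!: derivative_eq_intros)
      show "isCont (\<lambda>u. r j t * Fjj j t (?r t (x(j := u)))) u" for x u
        unfolding upd
        by (intro continuous_intros isCont_o2[OF _ cont[OF j], of _ "\<lambda>u. r j t * u"])
      show "\<bar>r j t * Fjj j t (?r t x)\<bar> \<le> K" for x
        using mult_mono[OF br(1)[of j t] bFj(2)[OF j, of t "?r t x"]] K0 by (auto simp: abs_mult)
    qed (use bFj j in auto)
    then show ?thesis by (simp add: mult.assoc)
  qed
  have "(\<integral>x. Ft t (?r t x) + (\<Sum>j\<in>J. r' j t * x j * Fj j t (?r t x)) \<partial>gauss J)
      = (\<integral>x. Ft t (?r t x) \<partial>gauss J) + (\<Sum>j\<in>J. \<integral>x. r' j t * x j * Fj j t (?r t x) \<partial>gauss J)"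
    using intFt intFj by (simp add: integral_add integrable_sum)
  also have "\<dots> = (\<integral>x. Ft t (?r t x) \<partial>gauss J) + (\<Sum>j\<in>J. r j t * r' j t * (\<integral>x. Fjj j t (?r t x) \<partial>gauss J))"
    using ibp by simp
  finally show ?thesis using main by simp
qed

lemma abs_diff_le_of_deriv:
  fixes f f' :: "real \<Rightarrow> real"
  assumes "\<And>t. (f has_real_derivative f' t) (at t)"
    and "\<And>t. a \<le> t \<Longrightarrow> t \<le> b \<Longrightarrow> \<bar>f' t\<bar> \<le> k" and "a \<le> b"
  shows "\<bar>f b - f a\<bar> \<le> k * (b - a)"
  using field_differentiable_bound[of "{a..b}" f f' k b a] assms
  by (auto simp: has_field_derivative_at_within)

lemma abs_sin_mult_cos_le_1: "\<bar>sin t * cos t :: real\<bar> \<le> 1"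
  using mult_mono[OF abs_sin_le_one[of t] abs_cos_le_one[of t]] by (simp add: abs_mult)

section \<open>Gibbs averages on finite sets and replica inequalities\<close>

definition gibbs_avg :: "'c set \<Rightarrow> ('c \<Rightarrow> real) \<Rightarrow> ('c \<Rightarrow> real) \<Rightarrow> real" where
  "gibbs_avg T e f = (\<Sum>\<tau>\<in>T. exp (e \<tau>) * f \<tau>) / (\<Sum>\<tau>\<in>T. exp (e \<tau>))"

lemma partition_pos: "finite T \<Longrightarrow> T \<noteq> {} \<Longrightarrow> (\<Sum>\<tau>\<in>T. exp (e \<tau> :: real)) > 0"
  by (intro sum_pos) auto

lemma gibbs_avg_eq_weights:
  "gibbs_avg T e f = (\<Sum>\<tau>\<in>T. (exp (e \<tau>) / (\<Sum>\<tau>\<in>T. exp (e \<tau>))) * f \<tau>)"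
  by (simp add: gibbs_avg_def sum_divide_distrib)

lemma gibbs_avg_const: "finite T \<Longrightarrow> T \<noteq> {} \<Longrightarrow> gibbs_avg T e (\<lambda>_. k) = k"
  using partition_pos[of T e] by (simp add: gibbs_avg_def flip: sum_distrib_right)

lemma gibbs_avg_add: "gibbs_avg T e (\<lambda>\<tau>. f \<tau> + g \<tau>) = gibbs_avg T e f + gibbs_avg T e g"
  by (simp add: gibbs_avg_def distrib_left sum.distrib add_divide_distrib)

lemma gibbs_avg_cmult: "gibbs_avg T e (\<lambda>\<tau>. k * f \<tau>) = k * gibbs_avg T e f"
  by (simp add: gibbs_avg_def sum_distrib_left mult.left_commute)

lemma gibbs_avg_sum: "gibbs_avg T e (\<lambda>\<tau>. \<Sum>j\<in>J. f j \<tau>) = (\<Sum>j\<in>J. gibbs_avg T e (f j))"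
  by (simp add: gibbs_avg_def sum_distrib_left sum_divide_distrib[symmetric] sum.swap[of _ J T])

lemma gibbs_avg_mono: "(\<And>\<tau>. \<tau> \<in> T \<Longrightarrow> f \<tau> \<le> g \<tau>) \<Longrightarrow> gibbs_avg T e f \<le> gibbs_avg T e g"
  unfolding gibbs_avg_def by (intro divide_right_mono sum_mono mult_left_mono) (auto intro: sum_nonneg)

lemma gibbs_avg_bound:
  assumes "finite T" "T \<noteq> {}" "\<And>\<tau>. \<tau> \<in> T \<Longrightarrow> \<bar>f \<tau>\<bar> \<le> k"
  shows "\<bar>gibbs_avg T e f\<bar> \<le> k"
proof -
  have "gibbs_avg T e f \<le> gibbs_avg T e (\<lambda>_. k)" "gibbs_avg T e (\<lambda>_. - k) \<le> gibbs_avg T e f"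
    using assms(3) by (intro gibbs_avg_mono; fastforce)+
  then show ?thesis using assms by (simp add: gibbs_avg_const abs_le_iff)
qed

lemma ln_partition_deriv:
  assumes T: "finite T" "T \<noteq> {}"
    and e: "\<And>\<tau>. \<tau> \<in> T \<Longrightarrow> ((\<lambda>t. e t \<tau>) has_real_derivative e' \<tau>) (at t)"
  shows "((\<lambda>t. ln (\<Sum>\<tau>\<in>T. exp (e t \<tau>))) has_real_derivative gibbs_avg T (e t) e') (at t)"
proof -
  have "((\<lambda>t. \<Sum>\<tau>\<in>T. exp (e t \<tau>)) has_real_derivative (\<Sum>\<tau>\<in>T. exp (e t \<tau>) * e' \<tau>)) (at t)"
    by (intro DERIV_sum DERIV_fun_exp e)
  from DERIV_chain2[OF DERIV_ln_divide[OF partition_pos[OF T]] this]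
  show ?thesis by (simp add: gibbs_avg_def)
qed

text \<open>The derivative of a Gibbs average in a parameter of the energy is a covariance.\<close>

lemma gibbs_avg_deriv:
  assumes T: "finite T" "T \<noteq> {}"
    and e: "\<And>\<tau>. \<tau> \<in> T \<Longrightarrow> ((\<lambda>t. e t \<tau>) has_real_derivative e' \<tau>) (at t)"
  shows "((\<lambda>t. gibbs_avg T (e t) f) has_real_derivative
    gibbs_avg T (e t) (\<lambda>\<tau>. f \<tau> * e' \<tau>) - gibbs_avg T (e t) f * gibbs_avg T (e t) e') (at t)"
proof -
  let ?Z = "\<lambda>t. \<Sum>\<tau>\<in>T. exp (e t \<tau>)" and ?W = "\<lambda>t. \<Sum>\<tau>\<in>T. exp (e t \<tau>) * f \<tau>"
  have Z: "(?Z has_real_derivative (\<Sum>\<tau>\<in>T. exp (e t \<tau>) * e' \<tau>)) (at t)"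
    by (intro DERIV_sum DERIV_fun_exp e)
  have W: "(?W has_real_derivative (\<Sum>\<tau>\<in>T. exp (e t \<tau>) * e' \<tau> * f \<tau>)) (at t)"
    by (intro DERIV_sum DERIV_cmult_right DERIV_fun_exp e)
  have pos: "?Z t > 0" by (rule partition_pos[OF T])
  show ?thesis
    unfolding gibbs_avg_def
    by (rule DERIV_cong[OF DERIV_divide[OF W Z]]) (use pos in \<open>auto simp: field_simps\<close>)
qed

text \<open>Double the difference of the two sides is the average of \<open>(f x - f y) * (v x - v y)\<close> over two independent samples.\<close>

lemma chebyshev_weights:
  fixes p f v :: "'a \<Rightarrow> real"
  assumes p: "\<And>x. x \<in> X \<Longrightarrow> 0 \<le> p x"
    and ord: "\<And>x y. x \<in> X \<Longrightarrow> y \<in> X \<Longrightarrow> 0 \<le> (f x - f y) * (v x - v y)"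
  shows "(\<Sum>x\<in>X. p x * f x) * (\<Sum>x\<in>X. p x * v x) \<le> (\<Sum>x\<in>X. p x) * (\<Sum>x\<in>X. p x * f x * v x)"
proof -
  have "0 \<le> (\<Sum>x\<in>X. \<Sum>y\<in>X. p x * p y * ((f x - f y) * (v x - v y)))"
    by (intro sum_nonneg mult_nonneg_nonneg p ord)
  also have "\<dots> = (\<Sum>x\<in>X. \<Sum>y\<in>X. p x * f x * v x * p y) + (\<Sum>x\<in>X. \<Sum>y\<in>X. p x * (p y * f y * v y))
      - (\<Sum>x\<in>X. \<Sum>y\<in>X. (p x * f x) * (p y * v y)) - (\<Sum>x\<in>X. \<Sum>y\<in>X. (p x * v x) * (p y * f y))"
    unfolding sum.distrib[symmetric] sum_subtractf[symmetric]
    by (intro sum.cong refl) (simp add: algebra_simps)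
  also have "\<dots> = 2 * ((\<Sum>x\<in>X. p x) * (\<Sum>x\<in>X. p x * f x * v x)
      - (\<Sum>x\<in>X. p x * f x) * (\<Sum>x\<in>X. p x * v x))"
    by (simp only: sum_product[symmetric]) (simp add: sum_distrib_right[symmetric] sum_distrib_left[symmetric] mult_ac)
  finally show ?thesis by simp
qed

text \<open>This is the combination of overlaps of up to four replicas that appears when \<open>\<langle>exp (s v)\<rangle>\<close> is differentiated
  along the interpolation: the weighted pair \<open>(1,2)\<close>, the pairs \<open>(1,3)\<close> and \<open>(2,3)\<close>, which agree by symmetry, and the
  disjoint pair \<open>(3,4)\<close>. By Chebyshev's association inequality the weight \<open>exp (s v)\<close> of the pair \<open>(1,2)\<close> correlates best with
  \<open>v\<close> of this same pair, so each of the \<open>1 + 4 + 3\<close> averages is at most the one on the right. For \<open>U \<ge> 0\<close> the four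
  terms with a minus sign are dropped.\<close>

lemma replica_combination_bound:
  fixes p :: "'a \<Rightarrow> real" and U v :: "'a \<Rightarrow> 'a \<Rightarrow> real"
  assumes p: "\<And>a. a \<in> S \<Longrightarrow> 0 \<le> p a" "(\<Sum>a\<in>S. p a) = 1" and s: "s \<ge> 0"
    and bnd: "\<And>a b. a \<in> S \<Longrightarrow> b \<in> S \<Longrightarrow> \<bar>U a b\<bar> \<le> v a b"
    and K: "K = 8 \<or> (K = 4 \<and> (\<forall>a\<in>S. \<forall>b\<in>S. 0 \<le> U a b))"
  defines "f \<equiv> \<lambda>a b. exp (s * v a b)"
  shows "(\<Sum>a\<in>S. \<Sum>b\<in>S. p a * p b * (f a b * U a b))
      - 4 * (\<Sum>a\<in>S. \<Sum>b\<in>S. p a * p b * (f a b * (\<Sum>c\<in>S. p c * U a c)))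
      + 3 * (\<Sum>a\<in>S. \<Sum>b\<in>S. p a * p b * f a b) * (\<Sum>a\<in>S. \<Sum>b\<in>S. p a * p b * U a b)
      \<le> K * (\<Sum>a\<in>S. \<Sum>b\<in>S. p a * p b * (f a b * v a b))"
proof -
  define m where "m = (\<Sum>a\<in>S. \<Sum>b\<in>S. p a * p b * (f a b * v a b))"
  have f0: "f a b \<ge> 0" for a b by (simp add: f_def)
  have ord: "0 \<le> (exp (s * x) - exp (s * y)) * (x - y)" for x y :: real
    using s by (cases "x \<le> y") (auto intro!: mult_nonneg_nonneg mult_nonpos_nonpos simp: mult_left_mono)
  have t12: "(\<Sum>a\<in>S. \<Sum>b\<in>S. p a * p b * (f a b * U a b)) \<le> m"
    unfolding m_def
    by (intro sum_mono mult_left_mono mult_nonneg_nonneg p f0 order_trans[OF abs_ge_self bnd])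
  have "(\<Sum>a\<in>S. \<Sum>b\<in>S. p a * p b * f a b) * (\<Sum>a\<in>S. \<Sum>b\<in>S. p a * p b * v a b)
      \<le> (\<Sum>a\<in>S. \<Sum>b\<in>S. p a * p b) * m"
    unfolding m_def
    using chebyshev_weights[of "S \<times> S" "\<lambda>(a,b). p a * p b" "\<lambda>(a,b). f a b" "\<lambda>(a,b). v a b"] ord p
    by (auto simp: sum.cartesian_product case_prod_unfold f_def mult.assoc)
  then have "(\<Sum>a\<in>S. \<Sum>b\<in>S. p a * p b * f a b) * (\<Sum>a\<in>S. \<Sum>b\<in>S. p a * p b * v a b) \<le> m"
    by (simp add: p(2) flip: sum_distrib_left)
  moreover have "(\<Sum>a\<in>S. \<Sum>b\<in>S. p a * p b * f a b) * (\<Sum>a\<in>S. \<Sum>b\<in>S. p a * p b * U a b)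
     \<le> (\<Sum>a\<in>S. \<Sum>b\<in>S. p a * p b * f a b) * (\<Sum>a\<in>S. \<Sum>b\<in>S. p a * p b * v a b)"
    by (intro mult_left_mono sum_mono sum_nonneg mult_nonneg_nonneg p f0 order_trans[OF abs_ge_self bnd])
  ultimately have t34: "(\<Sum>a\<in>S. \<Sum>b\<in>S. p a * p b * f a b) * (\<Sum>a\<in>S. \<Sum>b\<in>S. p a * p b * U a b) \<le> m"
    by linarith
  have abc': "(\<Sum>a\<in>S. \<Sum>b\<in>S. p a * p b * (f a b * G a)) = (\<Sum>a\<in>S. p a * ((\<Sum>b\<in>S. p b * f a b) * G a))" for G
    by (simp add: sum_distrib_left sum_distrib_right mult_ac)
  have abc: "(\<Sum>a\<in>S. \<Sum>b\<in>S. p a * p b * (f a b * (\<Sum>c\<in>S. p c * g a c)))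
      = (\<Sum>a\<in>S. p a * ((\<Sum>b\<in>S. p b * f a b) * (\<Sum>c\<in>S. p c * g a c)))" for g :: "'a \<Rightarrow> 'a \<Rightarrow> real"
    by (rule abc')
  show ?thesis
  proof (cases "K = 8")
    case True
    have "(\<Sum>a\<in>S. p a * ((\<Sum>b\<in>S. p b * f a b) * (\<Sum>c\<in>S. p c * v a c)))
        \<le> (\<Sum>a\<in>S. p a * (\<Sum>b\<in>S. p b * f a b * v a b))"
    proof (intro sum_mono mult_left_mono p)
      fix a assume "a \<in> S"
      show "(\<Sum>b\<in>S. p b * f a b) * (\<Sum>c\<in>S. p c * v a c) \<le> (\<Sum>b\<in>S. p b * f a b * v a b)"
        using chebyshev_weights[of S p "f a" "v a"] p ord by (auto simp: f_def)
    qed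
    then have v13: "(\<Sum>a\<in>S. \<Sum>b\<in>S. p a * p b * (f a b * (\<Sum>c\<in>S. p c * v a c))) \<le> m"
      unfolding abc m_def by (simp add: sum_distrib_left mult_ac)
    have "- (\<Sum>a\<in>S. \<Sum>b\<in>S. p a * p b * (f a b * (\<Sum>c\<in>S. p c * U a c)))
        \<le> (\<Sum>a\<in>S. \<Sum>b\<in>S. p a * p b * (f a b * (\<Sum>c\<in>S. p c * v a c)))"
      unfolding sum_negf[symmetric] mult_minus_right[symmetric]
      by (intro sum_mono mult_left_mono mult_nonneg_nonneg p f0 order_trans[OF abs_ge_minus_self bnd])
    with t12 t34 v13 show ?thesis unfolding True m_def[symmetric] by linarith
  next
    case False
    then have K4: "K = 4" and U0: "\<And>a b. a \<in> S \<Longrightarrow> b \<in> S \<Longrightarrow> 0 \<le> U a b" using K by auto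
    have "0 \<le> (\<Sum>a\<in>S. \<Sum>b\<in>S. p a * p b * (f a b * (\<Sum>c\<in>S. p c * U a c)))"
      by (intro sum_nonneg mult_nonneg_nonneg p f0 U0)
    with t12 t34 show ?thesis unfolding K4 m_def[symmetric] by linarith
  qed
qed

section \<open>Rotating one Gaussian Hamiltonian into another\<close>

text \<open>The Hamiltonian \<open>h0 a + \<Sum> x j * c j a\<close> has one Gaussian variable for each \<open>j\<close>. Along the path the coordinates
  in \<open>E\<close> are switched on by a factor \<open>sin t\<close> and the others off by a factor \<open>cos t\<close>, so that \<open>t = 0\<close> and
  \<open>t = \<pi>/2\<close> are the two end points and the path is smooth at both. The hypothesis \<open>cov\<close> states what the derivative of
  the covariance looks like; in the application \<open>U\<close> is a quadratic form in the centred overlaps.\<close>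

locale gibbs_interpolation =
  fixes J E :: "'j set" and S :: "'s set" and c :: "'j \<Rightarrow> 's \<Rightarrow> real" and h0 :: "'s \<Rightarrow> real"
    and U :: "'s \<Rightarrow> 's \<Rightarrow> real" and \<kappa> k0 U1 :: real
  assumes fin_J: "finite J" and fin_S: "finite S" and ne_S: "S \<noteq> {}"
    and cov: "\<And>a b. a \<in> S \<Longrightarrow> b \<in> S \<Longrightarrow>
      (\<Sum>j\<in>J. (if j \<in> E then 1 else -1) * (c j a * c j b)) = \<kappa> * (U a b - k0)"
    and diag: "\<And>a. a \<in> S \<Longrightarrow> U a a = U1"
    and kappa_nonneg: "\<kappa> \<ge> 0"
begin

definition en :: "('j \<Rightarrow> real) \<Rightarrow> 's \<Rightarrow> real" where
  "en x a = h0 a + (\<Sum>j\<in>J. x j * c j a)"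

definition Z :: "('j \<Rightarrow> real) \<Rightarrow> real" where
  "Z x = (\<Sum>a\<in>S. exp (en x a))"

definition wt :: "('j \<Rightarrow> real) \<Rightarrow> 's \<Rightarrow> real" where
  "wt x a = exp (en x a) / Z x"

definition rate :: "'j \<Rightarrow> real \<Rightarrow> real" where
  "rate j t = (if j \<in> E then sin t else cos t)"

definition rate' :: "'j \<Rightarrow> real \<Rightarrow> real" where
  "rate' j t = (if j \<in> E then cos t else - sin t)"

abbreviation rot :: "real \<Rightarrow> ('j \<Rightarrow> real) \<Rightarrow> 'j \<Rightarrow> real" where
  "rot t x \<equiv> (\<lambda>j. rate j t * x j)"

definition en2 :: "('s \<Rightarrow> 's \<Rightarrow> real) \<Rightarrow> real \<Rightarrow> ('j \<Rightarrow> real) \<Rightarrow> 's \<times> 's \<Rightarrow> real" where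
  "en2 v s x ab = en x (fst ab) + en x (snd ab) + s * v (fst ab) (snd ab)"

definition pair_exp :: "('s \<Rightarrow> 's \<Rightarrow> real) \<Rightarrow> real \<Rightarrow> ('j \<Rightarrow> real) \<Rightarrow> real" where
  "pair_exp v s x = (\<Sum>a\<in>S. \<Sum>b\<in>S. wt x a * wt x b * exp (s * v a b))"

definition pair_avg :: "('s \<Rightarrow> 's \<Rightarrow> real) \<Rightarrow> ('j \<Rightarrow> real) \<Rightarrow> real" where
  "pair_avg f x = (\<Sum>a\<in>S. \<Sum>b\<in>S. wt x a * wt x b * f a b)"

definition cmax :: real where "cmax = (\<Sum>j\<in>J. \<Sum>a\<in>S. \<bar>c j a\<bar>)"

definition sgn_E :: "'j \<Rightarrow> real" where "sgn_E j = (if j \<in> E then 1 else -1)"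

lemma cov_sgn: "a \<in> S \<Longrightarrow> b \<in> S \<Longrightarrow> (\<Sum>j\<in>J. sgn_E j * (c j a * c j b)) = \<kappa> * (U a b - k0)"
  using cov[of a b] by (simp add: sgn_E_def)

lemma Z_pos: "Z x > 0"
  unfolding Z_def by (rule partition_pos[OF fin_S ne_S])

lemma wt_nonneg: "0 \<le> wt x a" using Z_pos[of x] by (simp add: wt_def less_imp_le)

lemma wt_sum: "(\<Sum>a\<in>S. wt x a) = 1"
  using Z_pos[of x] by (simp add: wt_def Z_def flip: sum_divide_distrib)

lemma c_le_cmax: "j \<in> J \<Longrightarrow> a \<in> S \<Longrightarrow> \<bar>c j a\<bar> \<le> cmax"
  unfolding cmax_def
  by (rule order_trans[OF member_le_sum[of a S] member_le_sum[of j J "\<lambda>j. \<Sum>a\<in>S. \<bar>c j a\<bar>"]])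
    (auto simp: fin_S fin_J intro: sum_nonneg)

lemma cmax_nonneg: "0 \<le> cmax" unfolding cmax_def by (intro sum_nonneg) auto

lemma en_restrict: "en x a = en (restrict x J) a"
  by (simp add: en_def)

lemma en_measurable [measurable]: "(\<lambda>x. en x a) \<in> borel_measurable (PiM J (\<lambda>_. borel))"
  unfolding en_def by (intro borel_measurable_add borel_measurable_sum borel_measurable_times) auto

lemma Z_measurable [measurable]: "Z \<in> borel_measurable (PiM J (\<lambda>_. borel))"
  unfolding Z_def[abs_def] by measurable

lemma en_deriv_coord:
  assumes "j \<in> J" shows "((\<lambda>u. en (x(j := u)) a) has_real_derivative c j a) (at u)"
proof -
  have "en (x(j := u)) a = h0 a + u * c j a + (\<Sum>i\<in>J - {j}. x i * c i a)" for u
    unfolding en_def using fin_J assms by (subst sum.remove[of J j]) auto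
  then show ?thesis by (auto intro!: derivative_eq_intros)
qed

lemma rate_deriv: "(rate j has_real_derivative rate' j t) (at t)"
  by (cases "j \<in> E") (auto simp: rate_def[abs_def] rate'_def intro!: derivative_eq_intros)

lemma rate_le: "\<bar>rate j t\<bar> \<le> 1" "\<bar>rate' j t\<bar> \<le> 1"
  by (auto simp: rate_def rate'_def)

lemma rate_mult: "rate j t * rate' j t = sin t * cos t * sgn_E j"
  by (auto simp: rate_def rate'_def sgn_E_def)

lemma en_deriv_path:
  "((\<lambda>t. en (rot t x) a) has_real_derivative (\<Sum>j\<in>J. rate' j t * x j * c j a)) (at t)"
  unfolding en_def by (auto intro!: derivative_eq_intros rate_deriv)

lemma en2_deriv_coord:
  "j \<in> J \<Longrightarrow> ((\<lambda>u. en2 v s (x(j := u)) ab) has_real_derivative (c j (fst ab) + c j (snd ab))) (at u)"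
  unfolding en2_def by (auto intro!: derivative_eq_intros en_deriv_coord)

lemma en2_deriv_path:
  assumes "(s has_real_derivative s') (at t)"
  shows "((\<lambda>t. en2 v (s t) (rot t x) ab) has_real_derivative
     ((\<Sum>j\<in>J. rate' j t * x j * (c j (fst ab) + c j (snd ab))) + s' * v (fst ab) (snd ab))) (at t)"
  unfolding en2_def
  by (auto intro!: derivative_eq_intros en_deriv_path assms simp: distrib_left sum.distrib)

text \<open>As a quotient of two partition functions, \<open>\<langle>exp (s v)\<rangle>\<close> can be differentiated through logarithms.\<close>

lemma pair_exp_eq:
  "pair_exp v s x = exp (ln (\<Sum>ab\<in>S \<times> S. exp (en2 v s x ab)) - 2 * ln (Z x))"
proof -
  have "(\<Sum>ab\<in>S \<times> S. exp (en2 v s x ab)) > 0"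
    using fin_S ne_S by (intro partition_pos) auto
  then have "exp (ln (\<Sum>ab\<in>S \<times> S. exp (en2 v s x ab)) - 2 * ln (Z x))
      = (\<Sum>ab\<in>S \<times> S. exp (en2 v s x ab)) / (Z x)\<^sup>2"
    using Z_pos[of x] by (simp add: exp_diff exp_double power2_eq_square)
  also have "\<dots> = pair_exp v s x"
    unfolding pair_exp_def sum_divide_distrib sum.cartesian_product case_prod_unfold
    by (intro sum.cong refl) (simp add: wt_def en2_def exp_add power2_eq_square)
  finally show ?thesis by simp
qed

lemma pair_exp_times_avg:
  "pair_exp v s x * gibbs_avg (S \<times> S) (en2 v s x) g
    = (\<Sum>a\<in>S. \<Sum>b\<in>S. wt x a * wt x b * (exp (s * v a b) * g (a, b)))"
proof -
  have pos: "(\<Sum>ab\<in>S \<times> S. exp (en2 v s x ab)) > 0"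
    using fin_S ne_S by (intro partition_pos) auto
  have "pair_exp v s x = (\<Sum>ab\<in>S \<times> S. exp (en2 v s x ab)) / (Z x)\<^sup>2"
    using Z_pos[of x] pos by (simp add: pair_exp_eq exp_diff exp_double power2_eq_square)
  then have "pair_exp v s x * gibbs_avg (S \<times> S) (en2 v s x) g = (\<Sum>ab\<in>S \<times> S. exp (en2 v s x ab) * g ab) / (Z x)\<^sup>2"
    using pos by (simp add: gibbs_avg_def)
  also have "\<dots> = (\<Sum>a\<in>S. \<Sum>b\<in>S. wt x a * wt x b * (exp (s * v a b) * g (a, b)))"
    unfolding sum_divide_distrib sum.cartesian_product case_prod_unfold
    by (intro sum.cong refl) (simp add: wt_def en2_def exp_add power2_eq_square)
  finally show ?thesis .
qed

lemma avg_wt: "gibbs_avg S (en x) f = (\<Sum>a\<in>S. wt x a * f a)"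
  by (simp add: gibbs_avg_eq_weights wt_def Z_def)

lemma pair_avg_const: "pair_avg (\<lambda>_ _. k) x = k"
proof -
  have "pair_avg (\<lambda>_ _. k) x = (\<Sum>a\<in>S. wt x a * (\<Sum>b\<in>S. wt x b)) * k"
    unfolding pair_avg_def sum_distrib_left sum_distrib_right by (intro sum.cong refl)
  then show ?thesis by (simp add: wt_sum)
qed

lemma pair_avg_cmult: "pair_avg (\<lambda>a b. k * f a b) x = k * pair_avg f x"
  unfolding pair_avg_def sum_distrib_left by (intro sum.cong refl) simp

lemma pair_avg_diff: "pair_avg (\<lambda>a b. f a b - g a b) x = pair_avg f x - pair_avg g x"
  unfolding pair_avg_def sum_subtractf[symmetric] by (intro sum.cong refl) (simp add: algebra_simps)

lemma pair_avg_mono: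
  "(\<And>a b. a \<in> S \<Longrightarrow> b \<in> S \<Longrightarrow> f a b \<le> g a b) \<Longrightarrow> pair_avg f x \<le> pair_avg g x"
  unfolding pair_avg_def by (intro sum_mono mult_left_mono mult_nonneg_nonneg wt_nonneg)

lemma pair_avg_nonneg: "(\<And>a b. a \<in> S \<Longrightarrow> b \<in> S \<Longrightarrow> 0 \<le> f a b) \<Longrightarrow> 0 \<le> pair_avg f x"
  unfolding pair_avg_def by (intro sum_nonneg mult_nonneg_nonneg wt_nonneg)

lemma pair_le_total:
  fixes f :: "'s \<Rightarrow> 's \<Rightarrow> real"
  assumes "a \<in> S" "b \<in> S"
  shows "\<bar>f a b\<bar> \<le> (\<Sum>a\<in>S. \<Sum>b\<in>S. \<bar>f a b\<bar>)"
proof -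
  have "\<bar>f a b\<bar> \<le> (\<Sum>b\<in>S. \<bar>f a b\<bar>)" using assms fin_S by (intro member_le_sum) auto
  also have "\<dots> \<le> (\<Sum>a\<in>S. \<Sum>b\<in>S. \<bar>f a b\<bar>)" using assms fin_S
    by (intro member_le_sum[of a S "\<lambda>a. \<Sum>b\<in>S. \<bar>f a b\<bar>"]) (auto intro: sum_nonneg)
  finally show ?thesis .
qed

lemma pair_avg_measurable [measurable]: "pair_avg f \<in> borel_measurable (PiM J (\<lambda>_. borel))"
  unfolding pair_avg_def[abs_def] wt_def by measurable

lemma pair_exp_pair_avg: "pair_exp v s x = pair_avg (\<lambda>a b. exp (s * v a b)) x"
  by (simp add: pair_exp_def pair_avg_def)

lemma cov_wt:
  "(\<Sum>j\<in>J. sgn_E j * ((\<Sum>a\<in>S. wt x a * c j a) * (\<Sum>b\<in>S. wt x b * c j b)))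
    = \<kappa> * (pair_avg U x - k0)"
proof -
  have "(\<Sum>j\<in>J. sgn_E j * ((\<Sum>a\<in>S. wt x a * c j a) * (\<Sum>b\<in>S. wt x b * c j b)))
     = (\<Sum>j\<in>J. \<Sum>a\<in>S. \<Sum>b\<in>S. wt x a * wt x b * (sgn_E j * (c j a * c j b)))"
    by (intro sum.cong refl, subst sum_product, simp only: sum_distrib_left, intro sum.cong refl, simp)
  also have "\<dots> = (\<Sum>a\<in>S. \<Sum>b\<in>S. \<Sum>j\<in>J. wt x a * wt x b * (sgn_E j * (c j a * c j b)))"
    by (rule trans[OF sum.swap], rule sum.cong[OF refl], rule sum.swap)
  also have "\<dots> = (\<Sum>a\<in>S. \<Sum>b\<in>S. wt x a * wt x b * (\<kappa> * (U a b - k0)))"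
    by (intro sum.cong refl) (simp add: cov_sgn flip: sum_distrib_left)
  also have "\<dots> = \<kappa> * (pair_avg U x - pair_avg (\<lambda>_ _. k0) x)"
    unfolding pair_avg_def[symmetric] pair_avg_cmult pair_avg_diff ..
  finally show ?thesis by (simp add: pair_avg_const)
qed

lemma cov_wt1:
  assumes "a \<in> S"
  shows "(\<Sum>j\<in>J. sgn_E j * (c j a * (\<Sum>b\<in>S. wt x b * c j b))) = \<kappa> * ((\<Sum>b\<in>S. wt x b * U a b) - k0)"
proof -
  have "(\<Sum>j\<in>J. sgn_E j * (c j a * (\<Sum>b\<in>S. wt x b * c j b)))
      = (\<Sum>j\<in>J. \<Sum>b\<in>S. wt x b * (sgn_E j * (c j a * c j b)))"
    unfolding sum_distrib_left by (intro sum.cong refl) simp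
  also have "\<dots> = (\<Sum>b\<in>S. wt x b * (\<Sum>j\<in>J. sgn_E j * (c j a * c j b)))"
    unfolding sum_distrib_left by (rule sum.swap)
  also have "\<dots> = (\<Sum>b\<in>S. \<kappa> * (wt x b * U a b) - wt x b * (\<kappa> * k0))"
    by (intro sum.cong refl, subst cov_sgn[OF assms], assumption) (simp add: algebra_simps)
  also have "\<dots> = \<kappa> * (\<Sum>b\<in>S. wt x b * U a b) - (\<Sum>b\<in>S. wt x b) * (\<kappa> * k0)"
    by (simp add: sum_subtractf sum_distrib_left sum_distrib_right)
  finally show ?thesis by (simp add: wt_sum right_diff_distrib)
qed

abbreviation avg2 :: "('s \<Rightarrow> 's \<Rightarrow> real) \<Rightarrow> real \<Rightarrow> ('j \<Rightarrow> real) \<Rightarrow> ('s \<times> 's \<Rightarrow> real) \<Rightarrow> real" where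
  "avg2 v s x \<equiv> gibbs_avg (S \<times> S) (en2 v s x)"

abbreviation cc :: "'j \<Rightarrow> 's \<times> 's \<Rightarrow> real" where
  "cc j \<equiv> (\<lambda>ab. c j (fst ab) + c j (snd ab))"

definition pair_exp_D2 :: "('s \<Rightarrow> 's \<Rightarrow> real) \<Rightarrow> real \<Rightarrow> ('j \<Rightarrow> real) \<Rightarrow> 'j \<Rightarrow> real" where
  "pair_exp_D2 v s x j = pair_exp v s x *
     ((avg2 v s x (cc j) - 2 * gibbs_avg S (en x) (c j))\<^sup>2
      + (avg2 v s x (\<lambda>ab. (c j (fst ab) + c j (snd ab)) * (c j (fst ab) + c j (snd ab)))
         - (avg2 v s x (cc j))\<^sup>2)
      - 2 * (gibbs_avg S (en x) (\<lambda>a. c j a * c j a) - (gibbs_avg S (en x) (c j))\<^sup>2))"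

text \<open>Summed with the signs of the path, the second derivatives only see the covariance, hence only \<open>U\<close>; all
  contributions of \<open>k0\<close> and \<open>U1\<close> cancel.\<close>

lemma pair_exp_laplacian:
  assumes sym: "\<And>a b. a \<in> S \<Longrightarrow> b \<in> S \<Longrightarrow> U a b = U b a" "\<And>a b. a \<in> S \<Longrightarrow> b \<in> S \<Longrightarrow> v a b = v b a"
  shows "(\<Sum>j\<in>J. sgn_E j * pair_exp_D2 v s x j) = 2 * \<kappa> *
    (pair_avg (\<lambda>a b. exp (s * v a b) * U a b) x
      - 4 * pair_avg (\<lambda>a b. exp (s * v a b) * (\<Sum>c\<in>S. wt x c * U a c)) x
      + 3 * pair_exp v s x * pair_avg U x)"
proof -
  define P where "P g = pair_avg (\<lambda>a b. exp (s * v a b) * g a b) x" for g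
  define m where "m j = (\<Sum>a\<in>S. wt x a * c j a)" for j
  let ?F = "pair_exp v s x" and ?A = "avg2 v s x"
  have FA: "?F * ?A (\<lambda>ab. g (fst ab) (snd ab)) = P g" for g
    by (simp add: pair_exp_times_avg P_def pair_avg_def)
  have P_cong: "P g = P g'" if "\<And>a b. a \<in> S \<Longrightarrow> b \<in> S \<Longrightarrow> g a b = g' a b" for g g'
    unfolding P_def pair_avg_def using that by (intro sum.cong refl) simp
  have P_add: "P (\<lambda>a b. g a b + g' a b) = P g + P g'" for g g'
    unfolding P_def pair_avg_def sum.distrib[symmetric] by (intro sum.cong refl) (simp add: algebra_simps)
  have P_cmult: "P (\<lambda>a b. k * g a b) = k * P g" for k g
    unfolding P_def pair_avg_def sum_distrib_left by (intro sum.cong refl) simp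
  have P_sum: "P (\<lambda>a b. \<Sum>j\<in>J. g j a b) = (\<Sum>j\<in>J. P (g j))" for g
  proof -
    have "P (\<lambda>a b. \<Sum>j\<in>J. g j a b)
        = (\<Sum>a\<in>S. \<Sum>b\<in>S. \<Sum>j\<in>J. wt x a * wt x b * (exp (s * v a b) * g j a b))"
      by (simp add: P_def pair_avg_def sum_distrib_left)
    also have "\<dots> = (\<Sum>a\<in>S. \<Sum>j\<in>J. \<Sum>b\<in>S. wt x a * wt x b * (exp (s * v a b) * g j a b))"
      by (intro sum.cong refl sum.swap)
    also have "\<dots> = (\<Sum>j\<in>J. \<Sum>a\<in>S. \<Sum>b\<in>S. wt x a * wt x b * (exp (s * v a b) * g j a b))"
      by (rule sum.swap)
    finally show ?thesis by (simp add: P_def pair_avg_def)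
  qed
  have P_const: "P (\<lambda>_ _. k) = k * ?F" for k
    using P_cmult[of k "\<lambda>_ _. 1"] by (simp add: P_def pair_exp_pair_avg)
  \<comment> \<open>By symmetry of \<open>v\<close> the two replicas of the weighted pair may be exchanged.\<close>
  have P_flip: "P (\<lambda>a b. g b) = P (\<lambda>a b. g a)" for g :: "'s \<Rightarrow> real"
    unfolding P_def pair_avg_def
    by (subst sum.swap) (intro sum.cong refl, simp add: sym mult_ac)
  define Ub where "Ub a = (\<Sum>b\<in>S. wt x b * U a b)" for a
  have e1: "(\<Sum>j\<in>J. sgn_E j * (?F * ?A (\<lambda>ab. (c j (fst ab) + c j (snd ab)) * (c j (fst ab) + c j (snd ab)))))
      = 2 * \<kappa> * P U + 2 * \<kappa> * (U1 - 2 * k0) * ?F"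
  proof -
    have "(\<Sum>j\<in>J. sgn_E j * (?F * ?A (\<lambda>ab. (c j (fst ab) + c j (snd ab)) * (c j (fst ab) + c j (snd ab)))))
      = P (\<lambda>a b. \<Sum>j\<in>J. sgn_E j * ((c j a + c j b) * (c j a + c j b)))"
      unfolding P_sum P_cmult by (intro sum.cong refl arg_cong2[where f="(*)"] FA[of "\<lambda>a b. (c _ a + c _ b) * (c _ a + c _ b)"])
    also have "\<dots> = P (\<lambda>a b. 2 * \<kappa> * U a b + 2 * \<kappa> * (U1 - 2 * k0))"
    proof (rule P_cong)
      fix a b assume ab: "a \<in> S" "b \<in> S"
      have "(\<Sum>j\<in>J. sgn_E j * ((c j a + c j b) * (c j a + c j b)))
          = (\<Sum>j\<in>J. sgn_E j * (c j a * c j a)) + (\<Sum>j\<in>J. sgn_E j * (c j b * c j b)) + 2 * (\<Sum>j\<in>J. sgn_E j * (c j a * c j b))"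
        unfolding sum_distrib_left sum.distrib[symmetric] by (intro sum.cong refl) (simp add: algebra_simps)
      also have "\<dots> = 2 * \<kappa> * U a b + 2 * \<kappa> * (U1 - 2 * k0)"
        unfolding cov_sgn[OF ab] cov_sgn[OF ab(1) ab(1)] cov_sgn[OF ab(2) ab(2)] diag[OF ab(1)] diag[OF ab(2)]
        by (simp add: algebra_simps)
      finally show "(\<Sum>j\<in>J. sgn_E j * ((c j a + c j b) * (c j a + c j b))) = 2 * \<kappa> * U a b + 2 * \<kappa> * (U1 - 2 * k0)" .
    qed
    also have "\<dots> = 2 * \<kappa> * P U + 2 * \<kappa> * (U1 - 2 * k0) * ?F"
      unfolding P_add P_cmult P_const by simp
    finally show ?thesis .
  qed
  have e2: "(\<Sum>j\<in>J. sgn_E j * (?F * ?A (cc j) * m j))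
      = 2 * \<kappa> * (P (\<lambda>a b. Ub a) - k0 * ?F)"
  proof -
    have "(\<Sum>j\<in>J. sgn_E j * (?F * ?A (cc j) * m j))
        = (\<Sum>j\<in>J. sgn_E j * m j * P (\<lambda>a b. c j a + c j b))"
      by (intro sum.cong refl) (simp add: FA[of "\<lambda>a b. c _ a + c _ b"])
    also have "\<dots> = P (\<lambda>a b. \<Sum>j\<in>J. sgn_E j * m j * (c j a + c j b))"
      unfolding P_sum P_cmult ..
    also have "\<dots> = P (\<lambda>a b. \<kappa> * (Ub a - k0) + \<kappa> * (Ub b - k0))"
    proof (rule P_cong)
      fix a b assume ab: "a \<in> S" "b \<in> S"
      have "(\<Sum>j\<in>J. sgn_E j * m j * (c j a + c j b))
          = (\<Sum>j\<in>J. sgn_E j * (c j a * m j)) + (\<Sum>j\<in>J. sgn_E j * (c j b * m j))"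
        unfolding sum.distrib[symmetric] by (intro sum.cong refl) (simp add: algebra_simps)
      also have "\<dots> = \<kappa> * (Ub a - k0) + \<kappa> * (Ub b - k0)"
        using ab by (simp add: m_def Ub_def cov_wt1)
      finally show "(\<Sum>j\<in>J. sgn_E j * m j * (c j a + c j b)) = \<kappa> * (Ub a - k0) + \<kappa> * (Ub b - k0)" .
    qed
    also have "\<dots> = 2 * P (\<lambda>a b. \<kappa> * (Ub a - k0))"
      unfolding P_add P_flip[of "\<lambda>b. \<kappa> * (Ub b - k0)"] by simp
    also have "P (\<lambda>a b. \<kappa> * (Ub a - k0)) = P (\<lambda>a b. \<kappa> * Ub a + - (\<kappa> * k0))"
      by (simp add: algebra_simps)
    also have "\<dots> = \<kappa> * P (\<lambda>a b. Ub a) - \<kappa> * k0 * ?F"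
      unfolding P_add P_cmult P_const by simp
    finally show ?thesis by (simp add: algebra_simps)
  qed
  have e3: "(\<Sum>j\<in>J. sgn_E j * (\<Sum>a\<in>S. wt x a * (c j a * c j a))) = \<kappa> * (U1 - k0)"
  proof -
    have "(\<Sum>j\<in>J. sgn_E j * (\<Sum>a\<in>S. wt x a * (c j a * c j a)))
        = (\<Sum>a\<in>S. wt x a * (\<Sum>j\<in>J. sgn_E j * (c j a * c j a)))"
      unfolding sum_distrib_left by (subst sum.swap) (intro sum.cong refl, simp)
    also have "\<dots> = (\<Sum>a\<in>S. wt x a) * (\<kappa> * (U1 - k0))"
      unfolding sum_distrib_right by (intro sum.cong refl) (simp add: cov_sgn diag)
    finally show ?thesis by (simp add: wt_sum)
  qed
  have D2: "sgn_E j * pair_exp_D2 v s x j =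
      sgn_E j * (?F * ?A (\<lambda>ab. (c j (fst ab) + c j (snd ab)) * (c j (fst ab) + c j (snd ab))))
      - 4 * (sgn_E j * (?F * ?A (cc j) * m j))
      + 6 * ?F * (sgn_E j * (m j * m j)) - 2 * ?F * (sgn_E j * (\<Sum>a\<in>S. wt x a * (c j a * c j a)))" for j
    unfolding pair_exp_D2_def avg_wt m_def[symmetric] by (simp add: power2_eq_square algebra_simps)
  have "(\<Sum>j\<in>J. sgn_E j * pair_exp_D2 v s x j)
     = (2 * \<kappa> * P U + 2 * \<kappa> * (U1 - 2 * k0) * ?F) - 4 * (2 * \<kappa> * (P (\<lambda>a b. Ub a) - k0 * ?F))
      + 6 * ?F * (\<kappa> * (pair_avg U x - k0)) - 2 * ?F * (\<kappa> * (U1 - k0))"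
    unfolding D2 sum.distrib sum_subtractf sum_distrib_left[symmetric] e1 e2 e3
      cov_wt[of x, folded m_def] ..
  also have "\<dots> = 2 * \<kappa> * (P U - 4 * P (\<lambda>a b. Ub a) + 3 * ?F * pair_avg U x)"
    by (simp add: algebra_simps)
  finally show ?thesis by (simp add: P_def Ub_def)
qed

lemma en2_measurable [measurable]: "(\<lambda>x. en2 v s x ab) \<in> borel_measurable (PiM J (\<lambda>_. borel))"
  unfolding en2_def by measurable

lemma gibbs_avg_measurable [measurable]:
  "(\<lambda>x. gibbs_avg S (en x) f) \<in> borel_measurable (PiM J (\<lambda>_. borel))"
  "(\<lambda>x. avg2 v s x g) \<in> borel_measurable (PiM J (\<lambda>_. borel))"
  unfolding gibbs_avg_def by measurable

lemma pair_exp_measurable [measurable]: "pair_exp v s \<in> borel_measurable (PiM J (\<lambda>_. borel))"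
  unfolding pair_exp_pair_avg[abs_def] by measurable

lemma depends_on_J:
  "en x = en (restrict x J)" "en2 v s x = en2 v s (restrict x J)" "Z x = Z (restrict x J)"
  "wt x = wt (restrict x J)" "pair_exp v s x = pair_exp v s (restrict x J)"
  "pair_avg f x = pair_avg f (restrict x J)"
proof -
  show *: "en x = en (restrict x J)" using en_restrict by blast
  show "en2 v s x = en2 v s (restrict x J)" "Z x = Z (restrict x J)" "wt x = wt (restrict x J)"
    "pair_exp v s x = pair_exp v s (restrict x J)" "pair_avg f x = pair_avg f (restrict x J)"
    by (simp_all add: en2_def[abs_def] Z_def wt_def[abs_def] pair_exp_def pair_avg_def * )
qed

lemma ln_Z_deriv_coord:
  "j \<in> J \<Longrightarrow> ((\<lambda>u. ln (Z (x(j := u)))) has_real_derivative gibbs_avg S (en (x(j := u))) (c j)) (at u)"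
  unfolding Z_def by (rule ln_partition_deriv[OF fin_S ne_S]) (rule en_deriv_coord)

lemma ln_Z_deriv_path:
  "((\<lambda>t. ln (Z (rot t x))) has_real_derivative
    (\<Sum>j\<in>J. rate' j t * x j * gibbs_avg S (en (rot t x)) (c j))) (at t)"
  using ln_partition_deriv[OF fin_S ne_S en_deriv_path[of x]]
  by (simp add: Z_def gibbs_avg_sum gibbs_avg_cmult)

lemma fin_S2: "finite (S \<times> S)" "S \<times> S \<noteq> {}" using fin_S ne_S by auto

lemma pair_exp_deriv_coord:
  assumes "j \<in> J"
  shows "((\<lambda>u. pair_exp v s (x(j := u))) has_real_derivative pair_exp v s (x(j := u)) *
    (avg2 v s (x(j := u)) (cc j)
       - 2 * gibbs_avg S (en (x(j := u))) (c j))) (at u)"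
  unfolding pair_exp_eq
  by (rule DERIV_fun_exp[OF DERIV_diff[OF ln_partition_deriv[OF fin_S2 en2_deriv_coord[OF assms]]
      DERIV_cmult[OF ln_Z_deriv_coord[OF assms]]]])

lemma pair_exp_deriv_path:
  assumes "\<And>t. (s has_real_derivative s' t) (at t)"
  shows "((\<lambda>t. pair_exp v (s t) (rot t x)) has_real_derivative
     s' t * pair_avg (\<lambda>a b. exp (s t * v a b) * v a b) (rot t x)
     + (\<Sum>j\<in>J. rate' j t * x j * (pair_exp v (s t) (rot t x) *
         (avg2 v (s t) (rot t x) (cc j)
           - 2 * gibbs_avg S (en (rot t x)) (c j))))) (at t)"
proof -
  let ?F = "pair_exp v (s t) (rot t x)" and ?A = "avg2 v (s t) (rot t x)"
  have FA: "?F * ?A (\<lambda>ab. v (fst ab) (snd ab)) = pair_avg (\<lambda>a b. exp (s t * v a b) * v a b) (rot t x)"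
    by (simp add: pair_exp_times_avg pair_avg_def)
  have "((\<lambda>t. pair_exp v (s t) (rot t x)) has_real_derivative ?F *
      (?A (\<lambda>ab. (\<Sum>j\<in>J. rate' j t * x j * (c j (fst ab) + c j (snd ab))) + s' t * v (fst ab) (snd ab))
       - 2 * (\<Sum>j\<in>J. rate' j t * x j * gibbs_avg S (en (rot t x)) (c j)))) (at t)"
    unfolding pair_exp_eq
    by (rule DERIV_fun_exp[OF DERIV_diff[OF ln_partition_deriv[OF fin_S2 en2_deriv_path[OF assms]]
      DERIV_cmult[OF ln_Z_deriv_path]]])
  also have "?F * (?A (\<lambda>ab. (\<Sum>j\<in>J. rate' j t * x j * (c j (fst ab) + c j (snd ab))) + s' t * v (fst ab) (snd ab))
       - 2 * (\<Sum>j\<in>J. rate' j t * x j * gibbs_avg S (en (rot t x)) (c j)))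
     = s' t * (?F * ?A (\<lambda>ab. v (fst ab) (snd ab))) + (\<Sum>j\<in>J. rate' j t * x j * (?F *
         (?A (cc j) - 2 * gibbs_avg S (en (rot t x)) (c j))))"
  proof -
    define a where "a j = ?A (cc j)" for j
    define b where "b j = gibbs_avg S (en (rot t x)) (c j)" for j
    have "?A (\<lambda>ab. (\<Sum>j\<in>J. rate' j t * x j * (c j (fst ab) + c j (snd ab))) + s' t * v (fst ab) (snd ab))
        = (\<Sum>j\<in>J. rate' j t * x j * a j) + s' t * ?A (\<lambda>ab. v (fst ab) (snd ab))"
      unfolding gibbs_avg_add[of _ _ "\<lambda>ab. \<Sum>j\<in>J. rate' j t * x j * (c j (fst ab) + c j (snd ab))"]
        gibbs_avg_sum gibbs_avg_cmult a_def ..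
    moreover have "(\<Sum>j\<in>J. rate' j t * x j * (?F * (a j - 2 * b j)))
        = ?F * (\<Sum>j\<in>J. rate' j t * x j * a j) - 2 * ?F * (\<Sum>j\<in>J. rate' j t * x j * b j)"
      unfolding sum_distrib_left sum_subtractf[symmetric] by (intro sum.cong refl) (simp add: algebra_simps)
    ultimately show ?thesis unfolding a_def[symmetric] b_def[symmetric]
      by (simp only:) (simp only: distrib_left right_diff_distrib mult_ac)
  qed
  finally show ?thesis unfolding FA .
qed

lemma pair_exp_D2_deriv:
  assumes j: "j \<in> J"
  shows "((\<lambda>u. pair_exp v s (x(j := u)) *
     (avg2 v s (x(j := u)) (cc j)
       - 2 * gibbs_avg S (en (x(j := u))) (c j))) has_real_derivative pair_exp_D2 v s (x(j := u)) j) (at u)"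
  by (rule DERIV_cong[OF DERIV_mult[OF pair_exp_deriv_coord[OF j] DERIV_diff[OF
        gibbs_avg_deriv[OF fin_S2 en2_deriv_coord[OF j]]
        DERIV_cmult[OF gibbs_avg_deriv[OF fin_S ne_S en_deriv_coord[OF j]]]]]])
    (simp add: pair_exp_D2_def power2_eq_square algebra_simps)

lemma isCont_gibbs_avg_coord:
  assumes j: "j \<in> J"
  shows "isCont (\<lambda>u. gibbs_avg S (en (x(j := u))) f) u"
    "isCont (\<lambda>u. avg2 v s (x(j := u)) g) u"
    "isCont (\<lambda>u. pair_exp v s (x(j := u))) u"
  by (rule DERIV_isCont, rule gibbs_avg_deriv[OF fin_S ne_S en_deriv_coord[OF j]])
     (rule DERIV_isCont, rule gibbs_avg_deriv[OF fin_S2 en2_deriv_coord[OF j]],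
      rule DERIV_isCont, rule pair_exp_deriv_coord[OF j])

lemma pair_exp_pos: "0 < pair_exp v s x" by (simp add: pair_exp_eq)

lemma pair_exp_le:
  assumes "\<And>a b. a \<in> S \<Longrightarrow> b \<in> S \<Longrightarrow> s * v a b \<le> k"
  shows "pair_exp v s x \<le> exp k"
proof -
  have "pair_exp v s x \<le> pair_avg (\<lambda>_ _. exp k) x"
    unfolding pair_exp_pair_avg by (intro pair_avg_mono) (use assms in auto)
  then show ?thesis by (simp add: pair_avg_const)
qed

lemma abs_avg_c_le:
  assumes "j \<in> J"
  shows "\<bar>gibbs_avg S (en x) (c j)\<bar> \<le> cmax" "\<bar>gibbs_avg S (en x) (\<lambda>a. c j a * c j a)\<bar> \<le> cmax\<^sup>2"
    "\<bar>avg2 v s x (cc j)\<bar> \<le> 2 * cmax"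
    "\<bar>avg2 v s x (\<lambda>ab. (c j (fst ab) + c j (snd ab)) * (c j (fst ab) + c j (snd ab)))\<bar> \<le> (2 * cmax)\<^sup>2"
proof -
  note c = c_le_cmax[OF assms]
  have c2: "\<bar>c j (fst ab) + c j (snd ab)\<bar> \<le> 2 * cmax" if "ab \<in> S \<times> S" for ab
    using c[of "fst ab"] c[of "snd ab"] that by auto
  show "\<bar>gibbs_avg S (en x) (c j)\<bar> \<le> cmax" by (rule gibbs_avg_bound[OF fin_S ne_S c])
  show "\<bar>gibbs_avg S (en x) (\<lambda>a. c j a * c j a)\<bar> \<le> cmax\<^sup>2"
    by (rule gibbs_avg_bound[OF fin_S ne_S]) (simp only: power2_eq_square abs_mult, intro mult_mono c cmax_nonneg abs_ge_zero, auto)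
  show "\<bar>avg2 v s x (cc j)\<bar> \<le> 2 * cmax"
    by (rule gibbs_avg_bound[OF fin_S2 c2])
  have "\<bar>(c j (fst ab) + c j (snd ab)) * (c j (fst ab) + c j (snd ab))\<bar> \<le> (2 * cmax)\<^sup>2" if "ab \<in> S \<times> S" for ab
    unfolding power2_eq_square abs_mult using c2[OF that] cmax_nonneg by (intro mult_mono) auto
  then show "\<bar>avg2 v s x (\<lambda>ab. (c j (fst ab) + c j (snd ab)) * (c j (fst ab) + c j (snd ab)))\<bar> \<le> (2 * cmax)\<^sup>2"
    by (rule gibbs_avg_bound[OF fin_S2])
qed

lemma pair_exp_D2_le:
  assumes j: "j \<in> J" and F: "pair_exp v s x \<le> k"
  shows "\<bar>pair_exp v s x * (avg2 v s x (cc j)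
       - 2 * gibbs_avg S (en x) (c j))\<bar> \<le> k * (4 * cmax)" (is ?A)
    and "\<bar>pair_exp_D2 v s x j\<bar> \<le> k * (28 * cmax\<^sup>2)" (is ?B)
proof -
  note b = abs_avg_c_le[OF j]
  let ?m2 = "avg2 v s x (cc j)"
  let ?q2 = "avg2 v s x (\<lambda>ab. (c j (fst ab) + c j (snd ab)) * (c j (fst ab) + c j (snd ab)))"
  let ?m = "gibbs_avg S (en x) (c j)" and ?q = "gibbs_avg S (en x) (\<lambda>a. c j a * c j a)"
  have k0: "k \<ge> 0" using F pair_exp_pos[of v s x] by simp
  have d: "\<bar>?m2 - 2 * ?m\<bar> \<le> 4 * cmax" using b(1)[of x] b(3)[of v s x] by linarith
  then show ?A unfolding abs_mult using pair_exp_pos[of v s x] F k0 by (intro mult_mono) auto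
  have d2: "(?m2 - 2 * ?m)\<^sup>2 \<le> 16 * cmax\<^sup>2"
    using power_mono[OF d, of 2] by (simp add: power_mult_distrib)
  have m2: "?m\<^sup>2 \<le> cmax\<^sup>2" using power_mono[OF b(1)[of x], of 2] by simp
  have m22: "?m2\<^sup>2 \<le> 4 * cmax\<^sup>2" using power_mono[OF b(3)[of v s x], of 2] by (simp add: power_mult_distrib)
  have aux: "\<bar>P + (q2 - M2) - 2 * (q - M)\<bar> \<le> 28 * k"
    if "0 \<le> P" "P \<le> 16 * k" "0 \<le> M" "M \<le> k" "0 \<le> M2" "M2 \<le> 4 * k" "\<bar>q\<bar> \<le> k" "\<bar>q2\<bar> \<le> 4 * k"
    for P M M2 q q2 k :: real
    using that by (auto simp: abs_le_iff)
  have "\<bar>(?m2 - 2 * ?m)\<^sup>2 + (?q2 - ?m2\<^sup>2) - 2 * (?q - ?m\<^sup>2)\<bar> \<le> 28 * cmax\<^sup>2"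
    by (rule aux[OF zero_le_power2 d2 zero_le_power2 m2 zero_le_power2 m22 b(2)])
      (use b(4)[of v s x] in \<open>simp add: power_mult_distrib\<close>)
  then show ?B unfolding pair_exp_D2_def abs_mult using pair_exp_pos[of v s x] F k0 by (intro mult_mono) auto
qed

lemma measurable_gauss_path:
  assumes P: "P \<in> borel_measurable (PiM J (\<lambda>_. borel))" and "\<And>x. P x = P (restrict x J)"
  shows "(\<lambda>x. P (rot t x)) \<in> borel_measurable (gauss J)"
proof -
  have "(\<lambda>x. P (restrict (rot t x) J)) \<in> borel_measurable (gauss J)" using P by measurable
  then show ?thesis by (subst (asm) assms(2)[symmetric])
qed

lemma integrable_gauss_path:
  fixes P :: "('j \<Rightarrow> real) \<Rightarrow> real"
  assumes "P \<in> borel_measurable (PiM J (\<lambda>_. borel))" "\<And>x. P x = P (restrict x J)" "\<And>x. \<bar>P x\<bar> \<le> k"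
  shows "integrable (gauss J) (\<lambda>x. P (rot t x))"
proof -
  interpret G: prob_space "gauss J" by (rule prob_gauss)
  show ?thesis
    by (rule G.integrable_const_bound[of _ k]) (use assms measurable_gauss_path[of P] in auto)
qed

lemma pair_exp_D2_measurable: "(\<lambda>x. pair_exp_D2 v s x j) \<in> borel_measurable (PiM J (\<lambda>_. borel))"
  unfolding pair_exp_D2_def by measurable

lemma pair_avg_abs_le:
  assumes "\<And>a b. a \<in> S \<Longrightarrow> b \<in> S \<Longrightarrow> \<bar>f a b\<bar> \<le> k"
  shows "\<bar>pair_avg f x\<bar> \<le> k"
proof -
  have "pair_avg f x \<le> pair_avg (\<lambda>_ _. k) x" "pair_avg (\<lambda>_ _. - k) x \<le> pair_avg f x"
    using assms by (intro pair_avg_mono; fastforce simp: abs_le_iff)+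
  then show ?thesis by (simp add: pair_avg_const abs_le_iff)
qed

text \<open>The parameter of the exponential decreases at the rate at which, by the replica inequality, the Gaussian
  interpolation could make the expectation grow.\<close>

lemma pair_exp_expectation_decreasing:
  assumes U_sym: "\<And>a b. a \<in> S \<Longrightarrow> b \<in> S \<Longrightarrow> U a b = U b a"
    and v_sym: "\<And>a b. a \<in> S \<Longrightarrow> b \<in> S \<Longrightarrow> v a b = v b a"
    and bnd: "\<And>a b. a \<in> S \<Longrightarrow> b \<in> S \<Longrightarrow> \<bar>U a b\<bar> \<le> v a b"
    and K: "K = 8 \<or> (K = 4 \<and> (\<forall>a\<in>S. \<forall>b\<in>S. 0 \<le> U a b))"
    and s0: "K * \<kappa> \<le> s0" and \<theta>: "0 \<le> \<theta>" "\<theta> \<le> pi / 2"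
  shows "(\<integral>x. pair_exp v (s0 - K * \<kappa> * (sin \<theta>)\<^sup>2) (rot \<theta> x) \<partial>gauss J) \<le> (\<integral>x. pair_exp v s0 (rot 0 x) \<partial>gauss J)"
proof -
  define s where "s t = s0 - K * \<kappa> * (sin t)\<^sup>2" for t
  define s' where "s' t = - (2 * K * \<kappa> * (sin t * cos t))" for t
  define V where "V = (\<Sum>a\<in>S. \<Sum>b\<in>S. \<bar>v a b\<bar>)"
  define k where "k = exp (s0 * V)"
  have K0: "K > 0" using K by auto
  have Kk: "0 \<le> K * \<kappa>" using K0 kappa_nonneg by simp
  have v0: "0 \<le> v a b" if "a \<in> S" "b \<in> S" for a b using bnd[OF that] by linarith
  have vV: "v a b \<le> V" if "a \<in> S" "b \<in> S" for a b
    using pair_le_total[OF that, of v] by (simp add: V_def)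
  have V0: "0 \<le> V" unfolding V_def by (intro sum_nonneg) auto
  have sin2: "0 \<le> (sin t)\<^sup>2" "(sin t)\<^sup>2 \<le> 1" for t :: real by (auto simp: abs_square_le_1)
  have s_nn: "0 \<le> s t" and s_le: "s t \<le> s0" for t
    unfolding s_def using s0 Kk sin2[of t] mult_left_mono[OF sin2(2)[of t] Kk] by auto
  have sv: "s t * v a b \<le> s0 * V" if "a \<in> S" "b \<in> S" for t a b
    using that s_nn[of t] s_le[of t] v0 vV by (intro mult_mono) auto
  have F_le: "pair_exp v (s t) x \<le> k" for t x
    unfolding k_def by (rule pair_exp_le) (rule sv)
  have k1: "k \<ge> 0" by (simp add: k_def)
  have s_deriv: "(s has_real_derivative s' t) (at t)" for t
    unfolding s_def[abs_def] s'_def by (auto intro!: derivative_eq_intros)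
  have s'_le: "\<bar>s' t\<bar> \<le> 2 * K * \<kappa>" for t
    using mult_left_mono[OF abs_sin_mult_cos_le_1[of t], of "2 * (K * \<kappa>)"] Kk by (simp add: s'_def abs_mult K0 kappa_nonneg less_imp_le)
  define Pv where "Pv t x = pair_avg (\<lambda>a b. exp (s t * v a b) * v a b) x" for t x
  have Pv_le: "\<bar>Pv t x\<bar> \<le> k * V" for t x
    unfolding Pv_def
  proof (rule pair_avg_abs_le)
    fix a b assume ab: "a \<in> S" "b \<in> S"
    show "\<bar>exp (s t * v a b) * v a b\<bar> \<le> k * V"
      unfolding abs_mult k_def using ab v0 vV sv by (intro mult_mono) auto
  qed
  define k' where "k' = 2 * K * \<kappa> * (k * V) + k * (4 * cmax) + k * (28 * cmax\<^sup>2) + k"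
  have k': "2 * K * \<kappa> * (k * V) \<le> k'" "k * (4 * cmax) \<le> k'" "k * (28 * cmax\<^sup>2) \<le> k'" "k \<le> k'"
    using k1 V0 Kk K0 kappa_nonneg cmax_nonneg by (auto simp: k'_def intro!: add_nonneg_nonneg mult_nonneg_nonneg)
  let ?D = "\<lambda>t. (\<integral>x. s' t * Pv t (rot t x) \<partial>gauss J)
    + (\<Sum>j\<in>J. rate j t * rate' j t * (\<integral>x. pair_exp_D2 v (s t) (rot t x) j \<partial>gauss J))"
  have deriv: "((\<lambda>t. \<integral>x. pair_exp v (s t) (rot t x) \<partial>gauss J) has_real_derivative ?D t) (at t)" for t
  proof (rule gaussian_interpolation[where F = "\<lambda>t x. pair_exp v (s t) x" and Ft = "\<lambda>t x. s' t * Pv t x"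
        and Fjj = "\<lambda>j t x. pair_exp_D2 v (s t) x j" and r' = rate' and K = k'
        and Fj = "\<lambda>j t x. pair_exp v (s t) x * (avg2 v (s t) x (cc j)
           - 2 * gibbs_avg S (en x) (c j))"])
    show "\<bar>pair_exp v (s t) x\<bar> \<le> k' * (1 + (\<Sum>j\<in>J. \<bar>x j\<bar>))" for t x
    proof -
      have "\<bar>pair_exp v (s t) x\<bar> \<le> k' * 1" using F_le[of t x] pair_exp_pos[of v "s t" x] k'(4) by simp
      also have "\<dots> \<le> k' * (1 + (\<Sum>j\<in>J. \<bar>x j\<bar>))"
        using k1 k'(4) by (intro mult_left_mono) (auto intro: sum_nonneg)
      finally show ?thesis .
    qed
    show "\<bar>s' t * Pv t x\<bar> \<le> k'" for t x
    proof -
      have "\<bar>s' t\<bar> * \<bar>Pv t x\<bar> \<le> 2 * K * \<kappa> * (k * V)"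
        using K0 kappa_nonneg by (intro mult_mono s'_le Pv_le) auto
      then show ?thesis using k'(1) by (simp add: abs_mult)
    qed
    show "(\<lambda>x. s' t * Pv t x) \<in> borel_measurable (PiM J (\<lambda>_. borel))" for t
      unfolding Pv_def by measurable
    show "((\<lambda>t. pair_exp v (s t) (rot t x)) has_real_derivative
      s' t * Pv t (rot t x) + (\<Sum>j\<in>J. rate' j t * x j * (pair_exp v (s t) (rot t x) *
         (avg2 v (s t) (rot t x) (cc j)
           - 2 * gibbs_avg S (en (rot t x)) (c j))))) (at t)" for t x
      unfolding Pv_def by (rule pair_exp_deriv_path[OF s_deriv])
    show "isCont (\<lambda>u. pair_exp_D2 v (s t) (x(j := u)) j) u" if "j \<in> J" for j t x u
      unfolding pair_exp_D2_def by (intro continuous_intros isCont_gibbs_avg_coord that)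
    show "s' t * Pv t x = s' t * Pv t (restrict x J)" for t x
      unfolding Pv_def using depends_on_J(6)[where x = x] by simp
    show "pair_exp_D2 v (s t) x j = pair_exp_D2 v (s t) (restrict x J) j" for j t x
      unfolding pair_exp_D2_def using depends_on_J[where x = x] by simp
    show "pair_exp v (s t) x = pair_exp v (s t) (restrict x J)" for t x
      by (rule depends_on_J(5))
    show "pair_exp v (s t) x * (avg2 v (s t) x (cc j) - 2 * gibbs_avg S (en x) (c j))
      = pair_exp v (s t) (restrict x J) * (avg2 v (s t) (restrict x J) (cc j) - 2 * gibbs_avg S (en (restrict x J)) (c j))" for j t x
      using depends_on_J[where x = x] by simp
    show "\<bar>pair_exp v (s t) x * (avg2 v (s t) x (cc j) - 2 * gibbs_avg S (en x) (c j))\<bar> \<le> k'"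
      if "j \<in> J" for j t x
      using pair_exp_D2_le(1)[OF that F_le, of t x] k'(2) by linarith
    show "\<bar>pair_exp_D2 v (s t) x j\<bar> \<le> k'" if "j \<in> J" for j t x
      using pair_exp_D2_le(2)[OF that F_le, of t x] k'(3) by linarith
    show "(\<lambda>x. pair_exp v (s t) x * (avg2 v (s t) x (cc j) - 2 * gibbs_avg S (en x) (c j)))
      \<in> borel_measurable (PiM J (\<lambda>_. borel))" for j t
      by measurable
    show "((\<lambda>u. pair_exp v (s t) (x(j := u)) * (avg2 v (s t) (x(j := u)) (cc j)
       - 2 * gibbs_avg S (en (x(j := u))) (c j))) has_real_derivative pair_exp_D2 v (s t) (x(j := u)) j) (at u)"
      if "j \<in> J" for j t x u
      by (rule pair_exp_D2_deriv[OF that])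
  qed (rule fin_J pair_exp_D2_measurable rate_le pair_exp_measurable)+
  have iPv: "integrable (gauss J) (\<lambda>x. Pv t (rot t x))" for t
  proof (rule integrable_gauss_path)
    show "Pv t \<in> borel_measurable (PiM J (\<lambda>_. borel))" unfolding Pv_def[abs_def] by measurable
    show "Pv t x = Pv t (restrict x J)" for x unfolding Pv_def by (rule depends_on_J)
  qed (rule Pv_le)
  have iD2: "integrable (gauss J) (\<lambda>x. pair_exp_D2 v (s t) (rot t x) j)" if "j \<in> J" for j t
  proof (rule integrable_gauss_path)
    show "pair_exp_D2 v (s t) x j = pair_exp_D2 v (s t) (restrict x J) j" for x
      unfolding pair_exp_D2_def using depends_on_J[where x = x] by simp
    show "\<bar>pair_exp_D2 v (s t) x j\<bar> \<le> k'" for x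
      using pair_exp_D2_le(2)[OF that F_le, of t x] k'(3) by linarith
  qed (rule pair_exp_D2_measurable)
  have D_le: "?D t \<le> 0" if t: "0 \<le> t" "t \<le> pi / 2" for t
  proof -
    have sc: "0 \<le> sin t * cos t" using t by (intro mult_nonneg_nonneg sin_ge_zero cos_ge_zero) auto
    have "?D t = (\<integral>x. s' t * Pv t (rot t x) + sin t * cos t * (\<Sum>j\<in>J. sgn_E j * pair_exp_D2 v (s t) (rot t x) j) \<partial>gauss J)"
      using iPv iD2 by (simp add: sum_distrib_left rate_mult integral_add integral_sum mult.assoc)
    also have "\<dots> \<le> (\<integral>x. 0 \<partial>gauss J)"
    proof (intro integral_mono)
      fix x
      let ?y = "rot t x"
      have "(\<Sum>j\<in>J. sgn_E j * pair_exp_D2 v (s t) ?y j) = 2 * \<kappa> *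
        (pair_avg (\<lambda>a b. exp (s t * v a b) * U a b) ?y
        - 4 * pair_avg (\<lambda>a b. exp (s t * v a b) * (\<Sum>c\<in>S. wt ?y c * U a c)) ?y
        + 3 * pair_exp v (s t) ?y * pair_avg U ?y)"
        by (rule pair_exp_laplacian[OF U_sym v_sym])
      also have "\<dots> \<le> 2 * \<kappa> * (K * Pv t ?y)"
        unfolding Pv_def pair_avg_def pair_exp_def
        using kappa_nonneg
        by (intro mult_left_mono replica_combination_bound wt_nonneg wt_sum s_nn bnd K) auto
      finally have "sin t * cos t * (\<Sum>j\<in>J. sgn_E j * pair_exp_D2 v (s t) ?y j) \<le> sin t * cos t * (2 * \<kappa> * (K * Pv t ?y))"
        by (rule mult_left_mono[OF _ sc])
      then show "s' t * Pv t ?y + sin t * cos t * (\<Sum>j\<in>J. sgn_E j * pair_exp_D2 v (s t) ?y j) \<le> 0"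
        by (simp add: s'_def mult_ac)
    qed (use iPv iD2 in auto)
    finally show ?thesis by simp
  qed
  have "(\<integral>x. pair_exp v (s \<theta>) (rot \<theta> x) \<partial>gauss J) \<le> (\<integral>x. pair_exp v (s 0) (rot 0 x) \<partial>gauss J)"
    by (rule DERIV_nonpos_imp_nonincreasing[OF \<theta>(1)]) (use deriv D_le \<theta>(2) in force)
  then show ?thesis by (simp add: s_def)
qed

text \<open>At the end of the path there is still \<open>s0 - K * \<kappa>\<close> left in the exponent, and \<open>x \<le> exp x\<close> turns the exponential
  bound into one for the mean of \<open>v\<close>.\<close>

theorem overlap_second_moment:
  assumes U_sym: "\<And>a b. a \<in> S \<Longrightarrow> b \<in> S \<Longrightarrow> U a b = U b a"
    and v_sym: "\<And>a b. a \<in> S \<Longrightarrow> b \<in> S \<Longrightarrow> v a b = v b a"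
    and bnd: "\<And>a b. a \<in> S \<Longrightarrow> b \<in> S \<Longrightarrow> \<bar>U a b\<bar> \<le> v a b"
    and K: "K = 8 \<or> (K = 4 \<and> (\<forall>a\<in>S. \<forall>b\<in>S. 0 \<le> U a b))"
    and s0: "K * \<kappa> < s0" and \<theta>: "0 \<le> \<theta>" "\<theta> \<le> pi / 2"
  shows "(\<integral>x. pair_avg v (rot \<theta> x) \<partial>gauss J) \<le> (\<integral>x. pair_exp v s0 (rot 0 x) \<partial>gauss J) / (s0 - K * \<kappa>)"
proof -
  define s where "s = s0 - K * \<kappa> * (sin \<theta>)\<^sup>2"
  have K0: "0 \<le> K * \<kappa>" using K kappa_nonneg by auto
  have s1: "s0 - K * \<kappa> \<le> s"
    unfolding s_def using mult_left_mono[of "(sin \<theta>)\<^sup>2" 1 "K * \<kappa>"] K0 by (simp add: abs_square_le_1)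
  define V where "V = (\<Sum>a\<in>S. \<Sum>b\<in>S. \<bar>v a b\<bar>)"
  have v0: "0 \<le> v a b" if "a \<in> S" "b \<in> S" for a b using bnd[OF that] by linarith
  have vV: "\<bar>v a b\<bar> \<le> V" if "a \<in> S" "b \<in> S" for a b
    unfolding V_def by (rule pair_le_total[OF that])
  have i1: "integrable (gauss J) (\<lambda>x. pair_avg v (rot \<theta> x))"
    by (rule integrable_gauss_path[where P = "pair_avg v" and k = V],
        rule pair_avg_measurable, rule depends_on_J, rule pair_avg_abs_le, rule vV)
  have i2: "integrable (gauss J) (\<lambda>x. pair_exp v s (rot \<theta> x))"
  proof (rule integrable_gauss_path[where P = "pair_exp v s"])
    show "pair_exp v s \<in> borel_measurable (PiM J (\<lambda>_. borel))" by measurable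
    show "pair_exp v s x = pair_exp v s (restrict x J)" for x by (rule depends_on_J(5))
    fix x
    show "\<bar>pair_exp v s x\<bar> \<le> exp (s * V)"
      unfolding pair_exp_pair_avg
    proof (rule pair_avg_abs_le)
      fix a b assume "a \<in> S" "b \<in> S"
      then have "v a b \<le> V" using vV[of a b] by simp
      then have "s * v a b \<le> s * V" using s1 s0 by (intro mult_left_mono) auto
      then show "\<bar>exp (s * v a b)\<bar> \<le> exp (s * V)" by simp
    qed
  qed
  have "(s0 - K * \<kappa>) * (\<integral>x. pair_avg v (rot \<theta> x) \<partial>gauss J) = (\<integral>x. (s0 - K * \<kappa>) * pair_avg v (rot \<theta> x) \<partial>gauss J)"
    using i1 by simp
  also have "\<dots> \<le> (\<integral>x. pair_exp v s (rot \<theta> x) \<partial>gauss J)"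
  proof (intro integral_mono)
    fix x
    show "(s0 - K * \<kappa>) * pair_avg v (rot \<theta> x) \<le> pair_exp v s (rot \<theta> x)"
      unfolding pair_exp_pair_avg pair_avg_cmult[of "s0 - K * \<kappa>", symmetric]
    proof (rule pair_avg_mono)
      fix a b assume ab: "a \<in> S" "b \<in> S"
      have "(s0 - K * \<kappa>) * v a b \<le> s * v a b" using s1 v0[OF ab] by (rule mult_right_mono)
      also have "\<dots> \<le> exp (s * v a b)" using exp_ge_add_one_self[of "s * v a b"] by linarith
      finally show "(s0 - K * \<kappa>) * v a b \<le> exp (s * v a b)" .
    qed
  qed (use i1 i2 in auto)
  also have "\<dots> \<le> (\<integral>x. pair_exp v s0 (rot 0 x) \<partial>gauss J)"
    unfolding s_def by (rule pair_exp_expectation_decreasing[OF U_sym v_sym bnd K less_imp_le[OF s0] \<theta>])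
  finally show ?thesis using s0 by (simp add: field_simps)
qed

lemma ln_Z_bound:
  "\<bar>ln (Z x)\<bar> \<le> (ln (real (card S)) + (\<Sum>a\<in>S. \<bar>h0 a\<bar>) + cmax) * (1 + (\<Sum>j\<in>J. \<bar>x j\<bar>))"
proof -
  define X where "X = (\<Sum>j\<in>J. \<bar>x j\<bar>)"
  define H where "H = (\<Sum>a\<in>S. \<bar>h0 a\<bar>)"
  define B where "B = H + cmax * X"
  have X0: "0 \<le> X" and H0: "0 \<le> H" unfolding X_def H_def by (auto intro: sum_nonneg)
  have card: "real (card S) \<ge> 1"
    using fin_S ne_S by (simp add: card_gt_0_iff Suc_le_eq)
  have en: "\<bar>en x a\<bar> \<le> B" if a: "a \<in> S" for a
  proof -
    have "\<bar>\<Sum>j\<in>J. x j * c j a\<bar> \<le> (\<Sum>j\<in>J. \<bar>x j\<bar> * cmax)"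
      by (intro order_trans[OF sum_abs] sum_mono) (auto simp: abs_mult intro!: mult_left_mono c_le_cmax a)
    moreover have "\<bar>h0 a\<bar> \<le> H" unfolding H_def using a fin_S by (intro member_le_sum) auto
    ultimately show ?thesis
      unfolding en_def B_def X_def by (simp add: sum_distrib_right[symmetric] mult.commute)
  qed
  obtain a where a: "a \<in> S" using ne_S by auto
  have "exp (- B) \<le> exp (en x a)" using en[OF a] by simp
  also have "\<dots> \<le> Z x" unfolding Z_def using a fin_S by (intro member_le_sum) auto
  finally have lo: "- B \<le> ln (Z x)" using Z_pos[of x] by (simp add: ln_ge_iff)
  have "Z x \<le> (\<Sum>a\<in>S. exp B)" unfolding Z_def using en by (intro sum_mono) (auto simp: abs_le_iff)
  then have "ln (Z x) \<le> ln (real (card S) * exp B)" using Z_pos[of x] by (intro ln_mono) auto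
  also have "\<dots> = ln (real (card S)) + B" using card by (subst ln_mult) auto
  finally have hi: "ln (Z x) \<le> ln (real (card S)) + B" .
  have "0 \<le> ln (real (card S))" using card by simp
  then have "\<bar>ln (Z x)\<bar> \<le> ln (real (card S)) + B" using lo hi by linarith
  also have "\<dots> \<le> (ln (real (card S)) + H + cmax) * (1 + X)"
    unfolding B_def using \<open>0 \<le> ln (real (card S))\<close> X0 H0 cmax_nonneg by (simp add: algebra_simps)
  finally show ?thesis by (simp add: X_def H_def)
qed

text \<open>The term \<open>\<kappa> * U1 / 2 * (sin t)\<^sup>2\<close> is the growth of \<open>log Z\<close> that would result if \<open>U\<close> averaged to zero
  over two replicas; after it is subtracted, \<open>U\<close> enters only through its average over two replicas.\<close>

lemma log_partition_interpolation:
  fixes \<psi> \<psi>' \<psi>'' :: "real \<Rightarrow> real"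
  assumes d1: "\<And>u. (\<psi> has_real_derivative \<psi>' u) (at u)"
    and d2: "\<And>u. (\<psi>' has_real_derivative \<psi>'' u) (at u)"
    and cont: "\<And>u. isCont \<psi>'' u"
    and bound: "\<And>u. \<bar>\<psi> u\<bar> \<le> k * (1 + \<bar>u\<bar>)" "\<And>u. \<bar>\<psi>' u\<bar> \<le> k" "\<And>u. \<bar>\<psi>'' u\<bar> \<le> k"
  defines "L \<equiv> \<lambda>t x. ln (Z x) - \<kappa> * U1 / 2 * (sin t)\<^sup>2"
  shows "((\<lambda>t. \<integral>x. \<psi> (L t (rot t x)) \<partial>gauss J) has_real_derivative
     (\<integral>x. sin t * cos t * (\<kappa> * ((\<psi>'' (L t (rot t x)) - \<psi>' (L t (rot t x))) * pair_avg U (rot t x)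
        - k0 * \<psi>'' (L t (rot t x)))) \<partial>gauss J)) (at t)"
proof -
  define d' where "d' t = \<kappa> * U1 * (sin t * cos t)" for t
  define M where "M = ln (real (card S)) + (\<Sum>a\<in>S. \<bar>h0 a\<bar>) + cmax"
  define A where "A j x = gibbs_avg S (en x) (c j)" for j x
  define B where "B j x = gibbs_avg S (en x) (\<lambda>a. c j a * c j a)" for j x
  define G where "G j t x = \<psi>'' (L t x) * (A j x)\<^sup>2 + \<psi>' (L t x) * (B j x - (A j x)\<^sup>2)" for j t x
  have k0': "0 \<le> k" using bound(2)[of 0] by linarith
  have M0: "0 \<le> M"
  proof -
    have "real (card S) \<ge> 1" using fin_S ne_S by (simp add: card_gt_0_iff Suc_le_eq)
    then show ?thesis unfolding M_def by (intro add_nonneg_nonneg sum_nonneg cmax_nonneg) auto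
  qed
  have d'_le: "\<bar>d' t\<bar> \<le> \<bar>\<kappa> * U1\<bar>" for t
    unfolding d'_def abs_mult[of "\<kappa> * U1"] using mult_left_mono[OF abs_sin_mult_cos_le_1[of t], of "\<bar>\<kappa> * U1\<bar>"] by simp
  have sin2: "\<bar>(sin t)\<^sup>2\<bar> \<le> 1" for t :: real by (auto simp: abs_square_le_1)
  have L_le: "\<bar>L t x\<bar> \<le> (M + \<bar>\<kappa> * U1\<bar>) * (1 + (\<Sum>j\<in>J. \<bar>x j\<bar>))" for t x
  proof -
    have "\<bar>\<kappa> * U1 / 2 * (sin t)\<^sup>2\<bar> \<le> \<bar>\<kappa> * U1\<bar> / 2 * 1"
      unfolding abs_mult[of "_ / 2"] abs_divide by (intro mult_mono sin2) auto
    then have "\<bar>\<kappa> * U1 / 2 * (sin t)\<^sup>2\<bar> \<le> \<bar>\<kappa> * U1\<bar> * 1" by simp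
    also have "\<dots> \<le> \<bar>\<kappa> * U1\<bar> * (1 + (\<Sum>j\<in>J. \<bar>x j\<bar>))" by (intro mult_left_mono) (auto intro: sum_nonneg)
    finally show ?thesis using ln_Z_bound[of x] unfolding L_def M_def by (simp only: distrib_right)
  qed
  have cont1: "isCont \<psi> u" "isCont \<psi>' u" for u using d1 d2 DERIV_isCont by blast+
  have [measurable]: "\<psi> \<in> borel_measurable borel" "\<psi>' \<in> borel_measurable borel" "\<psi>'' \<in> borel_measurable borel"
    using cont1 cont by (auto intro!: borel_measurable_continuous_onI simp: continuous_on_eq_continuous_at)
  have L_meas [measurable]: "L t \<in> borel_measurable (PiM J (\<lambda>_. borel))" for t
    unfolding L_def by measurable
  have AB_meas [measurable]: "A j \<in> borel_measurable (PiM J (\<lambda>_. borel))" "B j \<in> borel_measurable (PiM J (\<lambda>_. borel))" for j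
    unfolding A_def[abs_def] B_def[abs_def] by measurable
  have L_dep: "L t x = L t (restrict x J)" for t x unfolding L_def using depends_on_J(3)[of x] by simp
  have AB_dep: "A j x = A j (restrict x J)" "B j x = B j (restrict x J)" for j x
    unfolding A_def B_def using depends_on_J(1)[of x] by simp_all
  have A_le: "\<bar>A j x\<bar> \<le> cmax" and B_le: "\<bar>B j x\<bar> \<le> cmax\<^sup>2" if "j \<in> J" for j x
    unfolding A_def B_def using abs_avg_c_le(1,2)[OF that] by auto
  have A2_le: "(A j x)\<^sup>2 \<le> cmax\<^sup>2" if "j \<in> J" for j x
    using power_mono[OF A_le[OF that, of x], of 2] by simp
  have G_le: "\<bar>G j t x\<bar> \<le> k * (3 * cmax\<^sup>2)" if "j \<in> J" for j t x
  proof -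
    have 1: "\<bar>\<psi>'' (L t x) * (A j x)\<^sup>2\<bar> \<le> k * cmax\<^sup>2"
      unfolding abs_mult using A2_le[OF that, of x] k0' by (intro mult_mono bound) auto
    have "\<bar>B j x - (A j x)\<^sup>2\<bar> \<le> 2 * cmax\<^sup>2"
      using A2_le[OF that, of x] B_le[OF that, of x] zero_le_power2[of "A j x"] by linarith
    then have "\<bar>\<psi>' (L t x) * (B j x - (A j x)\<^sup>2)\<bar> \<le> k * (2 * cmax\<^sup>2)"
      unfolding abs_mult using k0' by (intro mult_mono bound) auto
    with 1 show ?thesis unfolding G_def by (simp add: algebra_simps)
  qed
  have L_coord: "((\<lambda>u. L t (x(j := u))) has_real_derivative A j (x(j := u))) (at u)" if "j \<in> J" for j t x u
    unfolding L_def A_def by (rule DERIV_cong[OF DERIV_diff[OF ln_Z_deriv_coord[OF that] DERIV_const]]) simp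
  have L_path: "((\<lambda>t. L t (rot t x)) has_real_derivative
      (\<Sum>j\<in>J. rate' j t * x j * A j (rot t x)) - d' t) (at t)" for t x
    unfolding L_def A_def d'_def
    by (rule DERIV_diff[OF ln_Z_deriv_path]) (auto intro!: derivative_eq_intros)
  have A_coord: "((\<lambda>u. A j (x(j := u))) has_real_derivative B j (x(j := u)) - (A j (x(j := u)))\<^sup>2) (at u)" if "j \<in> J" for j x u
    unfolding A_def B_def power2_eq_square by (rule gibbs_avg_deriv[OF fin_S ne_S en_deriv_coord[OF that]])
  define k' where "k' = k * (1 + (M + \<bar>\<kappa> * U1\<bar>)) + \<bar>\<kappa> * U1\<bar> * k + k * cmax + k * (3 * cmax\<^sup>2)"
  have k': "k * (1 + (M + \<bar>\<kappa> * U1\<bar>)) \<le> k'" "\<bar>\<kappa> * U1\<bar> * k \<le> k'" "k * cmax \<le> k'" "k * (3 * cmax\<^sup>2) \<le> k'"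
  proof -
    have "0 \<le> k * (1 + (M + \<bar>\<kappa> * U1\<bar>))" "0 \<le> \<bar>\<kappa> * U1\<bar> * k" "0 \<le> k * cmax" "0 \<le> k * (3 * cmax\<^sup>2)"
      using k0' M0 cmax_nonneg by (auto intro!: mult_nonneg_nonneg add_nonneg_nonneg)
    then show "k * (1 + (M + \<bar>\<kappa> * U1\<bar>)) \<le> k'" "\<bar>\<kappa> * U1\<bar> * k \<le> k'" "k * cmax \<le> k'" "k * (3 * cmax\<^sup>2) \<le> k'"
      unfolding k'_def by linarith+
  qed
  have G_meas: "G j t \<in> borel_measurable (PiM J (\<lambda>_. borel))" for j t
    unfolding G_def[abs_def] by measurable
  have G_dep: "G j t x = G j t (restrict x J)" for j t x
    unfolding G_def using L_dep[of t x] AB_dep[of j x] by simp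
  have deriv: "((\<lambda>t. \<integral>x. \<psi> (L t (rot t x)) \<partial>gauss J) has_real_derivative
      ((\<integral>x. - d' t * \<psi>' (L t (rot t x)) \<partial>gauss J)
        + (\<Sum>j\<in>J. rate j t * rate' j t * (\<integral>x. G j t (rot t x) \<partial>gauss J)))) (at t)"
  proof (rule gaussian_interpolation[where F = "\<lambda>t x. \<psi> (L t x)" and Ft = "\<lambda>t x. - d' t * \<psi>' (L t x)"
        and Fj = "\<lambda>j t x. \<psi>' (L t x) * A j x" and Fjj = "\<lambda>j t x. G j t x" and r' = rate' and K = k'])
    show "(\<lambda>x. \<psi> (L t x)) \<in> borel_measurable (PiM J (\<lambda>_. borel))" for t by measurable
    show "(\<lambda>x. - d' t * \<psi>' (L t x)) \<in> borel_measurable (PiM J (\<lambda>_. borel))" for t by measurable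
    show "(\<lambda>x. \<psi>' (L t x) * A j x) \<in> borel_measurable (PiM J (\<lambda>_. borel))" for j t by measurable
    show "\<psi> (L t x) = \<psi> (L t (restrict x J))" for t x using L_dep[of t x] by simp
    show "- d' t * \<psi>' (L t x) = - d' t * \<psi>' (L t (restrict x J))" for t x using L_dep[of t x] by simp
    show "\<psi>' (L t x) * A j x = \<psi>' (L t (restrict x J)) * A j (restrict x J)" for j t x
      using L_dep[of t x] AB_dep[of j x] by simp
    show "((\<lambda>t. \<psi> (L t (rot t x))) has_real_derivative
        - d' t * \<psi>' (L t (rot t x)) + (\<Sum>j\<in>J. rate' j t * x j * (\<psi>' (L t (rot t x)) * A j (rot t x)))) (at t)" for t x
    proof -
      have "(\<Sum>j\<in>J. rate' j t * x j * (\<psi>' (L t (rot t x)) * A j (rot t x)))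
          = \<psi>' (L t (rot t x)) * (\<Sum>j\<in>J. rate' j t * x j * A j (rot t x))"
        unfolding sum_distrib_left by (intro sum.cong refl) simp
      then show ?thesis
        by (intro DERIV_cong[OF DERIV_chain2[OF d1 L_path]]) (simp add: algebra_simps)
    qed
    show "((\<lambda>u. \<psi>' (L t (x(j := u))) * A j (x(j := u))) has_real_derivative G j t (x(j := u))) (at u)"
      if "j \<in> J" for j t x u
      by (rule DERIV_cong[OF DERIV_mult[OF DERIV_chain2[OF d2 L_coord[OF that]] A_coord[OF that]]])
        (simp add: G_def power2_eq_square algebra_simps)
    show "isCont (\<lambda>u. G j t (x(j := u))) u" if j: "j \<in> J" for j t x u
    proof -
      have "isCont (\<lambda>u. L t (x(j := u))) u" using L_coord[OF j] DERIV_isCont by blast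
      then show ?thesis
        unfolding G_def A_def B_def
        by (intro continuous_intros isCont_gibbs_avg_coord j isCont_o2[OF _ cont] isCont_o2[OF _ cont1(2)])
    qed
    show "\<bar>\<psi> (L t x)\<bar> \<le> k' * (1 + (\<Sum>j\<in>J. \<bar>x j\<bar>))" for t x
    proof -
      let ?X = "1 + (\<Sum>j\<in>J. \<bar>x j\<bar>)"
      have X1: "1 \<le> ?X" by (simp add: sum_nonneg)
      have "\<bar>\<psi> (L t x)\<bar> \<le> k * (1 + \<bar>L t x\<bar>)" by (rule bound)
      also have "\<dots> \<le> k * (?X + (M + \<bar>\<kappa> * U1\<bar>) * ?X)"
        using L_le[of t x] X1 k0' by (intro mult_left_mono add_mono) auto
      also have "\<dots> = k * (1 + (M + \<bar>\<kappa> * U1\<bar>)) * ?X" by (simp add: algebra_simps)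
      also have "\<dots> \<le> k' * ?X" using X1 k'(1) by (intro mult_right_mono) auto
      finally show ?thesis .
    qed
    show "\<bar>- d' t * \<psi>' (L t x)\<bar> \<le> k'" for t x
    proof -
      have "\<bar>d' t\<bar> * \<bar>\<psi>' (L t x)\<bar> \<le> \<bar>\<kappa> * U1\<bar> * k" by (intro mult_mono d'_le bound) auto
      then show ?thesis using k'(2) by (simp add: abs_mult)
    qed
    show "\<bar>\<psi>' (L t x) * A j x\<bar> \<le> k'" if "j \<in> J" for j t x
    proof -
      have "\<bar>\<psi>' (L t x)\<bar> * \<bar>A j x\<bar> \<le> k * cmax" using k0' by (intro mult_mono A_le bound that) auto
      then show ?thesis using k'(3) by (simp add: abs_mult)
    qed
    show "\<bar>G j t x\<bar> \<le> k'" if "j \<in> J" for j t x using G_le[OF that, of t x] k'(4) by linarith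
  qed (rule fin_J G_meas G_dep rate_le)+
  have i1: "integrable (gauss J) (\<lambda>x. - d' t * \<psi>' (L t (rot t x)))"
  proof (rule integrable_gauss_path[where P = "\<lambda>x. - d' t * \<psi>' (L t x)" and k = "\<bar>d' t\<bar> * k"])
    show "- d' t * \<psi>' (L t x) = - d' t * \<psi>' (L t (restrict x J))" for x using L_dep[of t x] by simp
    show "\<bar>- d' t * \<psi>' (L t x)\<bar> \<le> \<bar>d' t\<bar> * k" for x using bound(2) by (simp add: abs_mult mult_left_mono)
  qed measurable
  have i2: "integrable (gauss J) (\<lambda>x. G j t (rot t x))" if "j \<in> J" for j
    by (rule integrable_gauss_path[where P = "G j t", OF G_meas G_dep G_le[OF that]])
  have lap: "- d' t * \<psi>' (L t y) + (\<Sum>j\<in>J. rate j t * rate' j t * G j t y)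
      = sin t * cos t * (\<kappa> * ((\<psi>'' (L t y) - \<psi>' (L t y)) * pair_avg U y - k0 * \<psi>'' (L t y)))" for y
  proof -
    have eA: "(\<Sum>j\<in>J. sgn_E j * (A j y)\<^sup>2) = \<kappa> * (pair_avg U y - k0)"
      using cov_wt[of y] by (simp add: A_def avg_wt power2_eq_square)
    have eB: "(\<Sum>j\<in>J. sgn_E j * B j y) = \<kappa> * (U1 - k0)"
    proof -
      have "(\<Sum>j\<in>J. sgn_E j * B j y) = (\<Sum>a\<in>S. wt y a * (\<Sum>j\<in>J. sgn_E j * (c j a * c j a)))"
        unfolding B_def avg_wt sum_distrib_left by (subst sum.swap) (intro sum.cong refl, simp)
      also have "\<dots> = (\<Sum>a\<in>S. wt y a) * (\<kappa> * (U1 - k0))"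
        unfolding sum_distrib_right by (intro sum.cong refl) (simp add: cov_sgn diag)
      finally show ?thesis by (simp add: wt_sum)
    qed
    have "(\<Sum>j\<in>J. rate j t * rate' j t * G j t y)
        = sin t * cos t * ((\<psi>'' (L t y) - \<psi>' (L t y)) * (\<Sum>j\<in>J. sgn_E j * (A j y)\<^sup>2) + \<psi>' (L t y) * (\<Sum>j\<in>J. sgn_E j * B j y))"
      unfolding sum_distrib_left sum.distrib[symmetric]
      by (intro sum.cong refl) (simp add: G_def rate_mult algebra_simps)
    then show ?thesis unfolding eA eB d'_def by (simp add: algebra_simps)
  qed
  have "(\<integral>x. - d' t * \<psi>' (L t (rot t x)) \<partial>gauss J) + (\<Sum>j\<in>J. rate j t * rate' j t * (\<integral>x. G j t (rot t x) \<partial>gauss J))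
      = (\<integral>x. - d' t * \<psi>' (L t (rot t x)) + (\<Sum>j\<in>J. rate j t * rate' j t * G j t (rot t x)) \<partial>gauss J)"
    using i1 i2 by (subst Bochner_Integration.integral_add) (auto simp: Bochner_Integration.integral_sum)
  then show ?thesis using deriv unfolding lap by simp
qed

lemma integrable_pair_avg_path: "integrable (gauss J) (\<lambda>x. pair_avg f (rot t x))"
proof (rule integrable_gauss_path[where P = "pair_avg f"])
  show "pair_avg f \<in> borel_measurable (PiM J (\<lambda>_. borel))" by measurable
  show "pair_avg f x = pair_avg f (restrict x J)" for x by (rule depends_on_J)
  show "\<bar>pair_avg f x\<bar> \<le> (\<Sum>a\<in>S. \<Sum>b\<in>S. \<bar>f a b\<bar>)" for x
    by (rule pair_avg_abs_le) (rule pair_le_total)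
qed

lemma ln_Z_path_measurable: "(\<lambda>x. ln (Z (rot t x))) \<in> borel_measurable (gauss J)"
  by (rule measurable_gauss_path[where P = "\<lambda>x. ln (Z x)"]) (use depends_on_J(3) in \<open>auto\<close>)

lemma integrable_ln_Z_path: "integrable (gauss J) (\<lambda>x. ln (Z (rot t x)))"
proof (rule Bochner_Integration.integrable_bound[OF _ ln_Z_path_measurable])
  interpret G: prob_space "gauss J" by (rule prob_gauss)
  define M where "M = ln (real (card S)) + (\<Sum>a\<in>S. \<bar>h0 a\<bar>) + cmax"
  have card: "real (card S) \<ge> 1" using fin_S ne_S by (simp add: card_gt_0_iff Suc_le_eq)
  have M0: "0 \<le> M" unfolding M_def using card by (intro add_nonneg_nonneg sum_nonneg cmax_nonneg) auto
  show "integrable (gauss J) (\<lambda>x. M * (1 + (\<Sum>j\<in>J. \<bar>x j\<bar>)))"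
    by (intro integrable_mult_right Bochner_Integration.integrable_add Bochner_Integration.integrable_sum
        integrable_abs integrable_gauss_component) auto
  show "AE x in gauss J. norm (ln (Z (rot t x))) \<le> norm (M * (1 + (\<Sum>j\<in>J. \<bar>x j\<bar>)))"
  proof (intro AE_I2)
    fix x
    have "\<bar>ln (Z (rot t x))\<bar> \<le> M * (1 + (\<Sum>j\<in>J. \<bar>rate j t * x j\<bar>))"
      unfolding M_def by (rule ln_Z_bound)
    also have "\<dots> \<le> M * (1 + (\<Sum>j\<in>J. \<bar>x j\<bar>))"
      by (intro mult_left_mono add_left_mono sum_mono M0)
        (use rate_le in \<open>auto simp: abs_mult intro!: mult_left_le_one_le\<close>)
    finally show "norm (ln (Z (rot t x))) \<le> norm (M * (1 + (\<Sum>j\<in>J. \<bar>x j\<bar>)))" by simp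
  qed
qed

lemma abs_integral_pair_avg_le:
  assumes bnd: "\<And>a b. a \<in> S \<Longrightarrow> b \<in> S \<Longrightarrow> \<bar>U a b\<bar> \<le> v a b"
    and g: "g \<in> borel_measurable (gauss J)" "\<And>x. \<bar>g x\<bar> \<le> k"
  shows "\<bar>\<integral>x. g x * pair_avg U (rot t x) \<partial>gauss J\<bar> \<le> k * (\<integral>x. pair_avg v (rot t x) \<partial>gauss J)"
    and "integrable (gauss J) (\<lambda>x. g x * pair_avg U (rot t x))"
proof -
  have k0: "0 \<le> k" using g(2)[of undefined] by linarith
  have Uv: "\<bar>pair_avg U x\<bar> \<le> pair_avg v x" for x
  proof -
    have "pair_avg U x \<le> pair_avg v x" using bnd by (intro pair_avg_mono) (auto simp: abs_le_iff)
    moreover have "pair_avg (\<lambda>a b. (- 1) * U a b) x \<le> pair_avg v x"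
      using bnd by (intro pair_avg_mono) (auto simp: abs_le_iff)
    ultimately show ?thesis unfolding pair_avg_cmult by (simp add: abs_le_iff)
  qed
  have le: "\<bar>g x * pair_avg U (rot t x)\<bar> \<le> k * pair_avg v (rot t x)" for x
    unfolding abs_mult by (intro mult_mono g Uv k0) auto
  show i: "integrable (gauss J) (\<lambda>x. g x * pair_avg U (rot t x))"
  proof (rule Bochner_Integration.integrable_bound)
    show "integrable (gauss J) (\<lambda>x. k * pair_avg v (rot t x))"
      using integrable_pair_avg_path by simp
    show "AE x in gauss J. norm (g x * pair_avg U (rot t x)) \<le> norm (k * pair_avg v (rot t x))"
      using le by (intro AE_I2) (auto intro: order_trans[OF _ abs_ge_self])
  qed (use g integrable_pair_avg_path[of U t] in auto)
  have "\<bar>\<integral>x. g x * pair_avg U (rot t x) \<partial>gauss J\<bar> \<le> (\<integral>x. \<bar>g x * pair_avg U (rot t x)\<bar> \<partial>gauss J)"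
    by (rule integral_abs_bound)
  also have "\<dots> \<le> (\<integral>x. k * pair_avg v (rot t x) \<partial>gauss J)"
    using i integrable_pair_avg_path le by (intro integral_mono) auto
  finally show "\<bar>\<integral>x. g x * pair_avg U (rot t x) \<partial>gauss J\<bar> \<le> k * (\<integral>x. pair_avg v (rot t x) \<partial>gauss J)"
    using integrable_pair_avg_path by simp
qed

theorem mean_log_partition_comparison:
  assumes bnd: "\<And>a b. a \<in> S \<Longrightarrow> b \<in> S \<Longrightarrow> \<bar>U a b\<bar> \<le> v a b"
    and B: "\<And>t. 0 \<le> t \<Longrightarrow> t \<le> pi / 2 \<Longrightarrow> (\<integral>x. pair_avg v (rot t x) \<partial>gauss J) \<le> B"
  shows "\<bar>(\<integral>x. ln (Z (rot (pi / 2) x)) \<partial>gauss J) - \<kappa> * U1 / 2 - (\<integral>x. ln (Z (rot 0 x)) \<partial>gauss J)\<bar> \<le> 2 * \<kappa> * B"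
proof -
  interpret G: prob_space "gauss J" by (rule prob_gauss)
  let ?f = "\<lambda>t. \<integral>x. ln (Z (rot t x)) - \<kappa> * U1 / 2 * (sin t)\<^sup>2 \<partial>gauss J"
  let ?f' = "\<lambda>t. \<integral>x. sin t * cos t * (\<kappa> * ((0 - 1) * pair_avg U (rot t x) - k0 * 0)) \<partial>gauss J"
  have d: "(?f has_real_derivative ?f' t) (at t)" for t
    by (rule log_partition_interpolation[where \<psi> = "\<lambda>u. u" and \<psi>' = "\<lambda>_. 1" and \<psi>'' = "\<lambda>_. 0" and k = 1])
      (auto intro!: derivative_eq_intros)
  have B0: "0 \<le> B"
  proof -
    have "0 \<le> pair_avg v x" for x using bnd by (intro pair_avg_nonneg) force
    then have "0 \<le> (\<integral>x. pair_avg v (rot 0 x) \<partial>gauss J)" by (intro integral_nonneg_AE) auto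
    also have "\<dots> \<le> B" by (rule B) auto
    finally show ?thesis .
  qed
  have "\<bar>?f (pi / 2) - ?f 0\<bar> \<le> (\<kappa> * B) * (pi / 2 - 0)"
  proof (rule abs_diff_le_of_deriv[OF d])
    fix t :: real assume t: "0 \<le> t" "t \<le> pi / 2"
    have "\<bar>?f' t\<bar> = \<bar>\<integral>x. (- (sin t * cos t * \<kappa>)) * pair_avg U (rot t x) \<partial>gauss J\<bar>"
      by (simp add: mult_ac)
    also have "\<dots> \<le> (1 * \<kappa>) * (\<integral>x. pair_avg v (rot t x) \<partial>gauss J)"
    proof (rule abs_integral_pair_avg_le(1)[OF bnd])
      show "\<bar>- (sin t * cos t * \<kappa>)\<bar> \<le> 1 * \<kappa>"
        unfolding abs_minus abs_mult[of _ \<kappa>] using kappa_nonneg by (intro mult_mono abs_sin_mult_cos_le_1) auto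
    qed auto
    also have "\<dots> \<le> \<kappa> * B" using B[OF t] kappa_nonneg by (simp add: mult_left_mono)
    finally show "\<bar>?f' t\<bar> \<le> \<kappa> * B" .
  qed auto
  also have "\<dots> \<le> (\<kappa> * B) * 2" using kappa_nonneg B0 pi_less_4 by (intro mult_left_mono) auto
  finally show ?thesis
    using integrable_ln_Z_path by (simp add: G.prob_space mult.commute)
qed

text \<open>For \<open>\<psi> u = cos (w * u + \<alpha>)\<close> the second derivative is \<open>- w\<^sup>2 \<psi>\<close>. Up to the error from the overlap, the expectation
  solves \<open>u' = sin t * cos t * \<kappa> * k0 * w\<^sup>2 * u\<close>; the factor \<open>e t\<close> in the proof integrates this equation. The phase
  \<open>\<alpha>\<close> gives the sine as well.\<close>

theorem cos_log_partition_comparison: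
  assumes bnd: "\<And>a b. a \<in> S \<Longrightarrow> b \<in> S \<Longrightarrow> \<bar>U a b\<bar> \<le> v a b"
    and B: "\<And>t. 0 \<le> t \<Longrightarrow> t \<le> pi / 2 \<Longrightarrow> (\<integral>x. pair_avg v (rot t x) \<partial>gauss J) \<le> B"
    and k0: "0 \<le> k0"
  shows "\<bar>exp (- (\<kappa> * k0 * w\<^sup>2 / 2)) * (\<integral>x. cos (w * (ln (Z (rot (pi / 2) x)) - \<kappa> * U1 / 2) + \<alpha>) \<partial>gauss J)
     - (\<integral>x. cos (w * ln (Z (rot 0 x)) + \<alpha>) \<partial>gauss J)\<bar> \<le> 2 * \<kappa> * (w\<^sup>2 + \<bar>w\<bar>) * B"
proof -
  interpret G: prob_space "gauss J" by (rule prob_gauss)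
  let ?L = "\<lambda>t x. ln (Z (rot t x)) - \<kappa> * U1 / 2 * (sin t)\<^sup>2"
  let ?g = "\<lambda>t x. - w * w * cos (w * ?L t x + \<alpha>) - (- w * sin (w * ?L t x + \<alpha>))"
  let ?u = "\<lambda>t. \<integral>x. cos (w * ?L t x + \<alpha>) \<partial>gauss J"
  let ?u' = "\<lambda>t. \<integral>x. sin t * cos t * (\<kappa> * (?g t x * pair_avg U (rot t x)
        - k0 * (- w * w * cos (w * ?L t x + \<alpha>)))) \<partial>gauss J"
  define e where "e t = exp (- (\<kappa> * k0 * w\<^sup>2 / 2) * (sin t)\<^sup>2)" for t
  have Lm: "(\<lambda>x. ?L t x) \<in> borel_measurable (gauss J)" for t
    using ln_Z_path_measurable by measurable
  have cosm: "(\<lambda>x. cos (w * ?L t x + \<alpha>)) \<in> borel_measurable (gauss J)" "?g t \<in> borel_measurable (gauss J)" for t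
    using Lm by measurable
  have icos: "integrable (gauss J) (\<lambda>x. cos (w * ?L t x + \<alpha>))" for t
    by (rule G.integrable_const_bound[of _ 1]) (use cosm in auto)
  have du: "(?u has_real_derivative ?u' t) (at t)" for t
  proof (rule log_partition_interpolation[where \<psi> = "\<lambda>u. cos (w * u + \<alpha>)" and \<psi>' = "\<lambda>u. - w * sin (w * u + \<alpha>)"
        and \<psi>'' = "\<lambda>u. - w * w * cos (w * u + \<alpha>)" and k = "1 + \<bar>w\<bar> + w\<^sup>2"])
    show "\<bar>cos (w * u + \<alpha>)\<bar> \<le> (1 + \<bar>w\<bar> + w\<^sup>2) * (1 + \<bar>u\<bar>)" for u
    proof -
      have "\<bar>cos (w * u + \<alpha>)\<bar> \<le> 1 * 1" by simp
      also have "1 * 1 \<le> (1 + \<bar>w\<bar> + w\<^sup>2) * (1 + \<bar>u\<bar>)" by (intro mult_mono) auto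
      finally show ?thesis .
    qed
    show "\<bar>- w * sin (w * u + \<alpha>)\<bar> \<le> 1 + \<bar>w\<bar> + w\<^sup>2" for u
      using mult_left_mono[OF abs_sin_le_one[of "w * u + \<alpha>"], of "\<bar>w\<bar>"] zero_le_power2[of w] unfolding abs_mult abs_minus by linarith
    show "\<bar>- w * w * cos (w * u + \<alpha>)\<bar> \<le> 1 + \<bar>w\<bar> + w\<^sup>2" for u
      using mult_left_mono[OF abs_cos_le_one[of "w * u + \<alpha>"], of "w\<^sup>2"] unfolding abs_mult abs_minus
      by (simp add: power2_eq_square)
  qed (auto intro!: derivative_eq_intros continuous_intros)
  have g_le: "\<bar>?g t x\<bar> \<le> w\<^sup>2 + \<bar>w\<bar>" for t x
  proof -
    have "\<bar>w * w * cos (w * ?L t x + \<alpha>)\<bar> \<le> w\<^sup>2"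
      using mult_left_mono[OF abs_cos_le_one[of "w * ?L t x + \<alpha>"], of "w\<^sup>2"] unfolding abs_mult by (simp add: power2_eq_square)
    moreover have "\<bar>w * sin (w * ?L t x + \<alpha>)\<bar> \<le> \<bar>w\<bar>"
      using mult_left_mono[OF abs_sin_le_one[of "w * ?L t x + \<alpha>"], of "\<bar>w\<bar>"] unfolding abs_mult by simp
    ultimately show ?thesis by (simp add: abs_le_iff)
  qed
  note gU = abs_integral_pair_avg_le[where v = v, OF bnd cosm(2) g_le]
  have u'_eq: "?u' t = sin t * cos t * (\<kappa> * ((\<integral>x. ?g t x * pair_avg U (rot t x) \<partial>gauss J) + k0 * w\<^sup>2 * ?u t))" for t
  proof -
    have "?u' t = (\<integral>x. sin t * cos t * \<kappa> * (?g t x * pair_avg U (rot t x)) + sin t * cos t * \<kappa> * k0 * w\<^sup>2 * cos (w * ?L t x + \<alpha>) \<partial>gauss J)"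
      by (intro Bochner_Integration.integral_cong refl) (simp add: algebra_simps power2_eq_square)
    also have "\<dots> = sin t * cos t * \<kappa> * (\<integral>x. ?g t x * pair_avg U (rot t x) \<partial>gauss J) + sin t * cos t * \<kappa> * k0 * w\<^sup>2 * ?u t"
      using gU(2)[of t t] icos[of t] by (subst Bochner_Integration.integral_add) (auto simp: mult.assoc)
    finally show ?thesis by (simp add: algebra_simps)
  qed
  \<comment> \<open>The integrating factor of the linear equation.\<close>
  have de: "(e has_real_derivative - (\<kappa> * k0 * w\<^sup>2) * (sin t * cos t) * e t) (at t)" for t
    unfolding e_def[abs_def] by (auto intro!: derivative_eq_intros)
  have deu: "((\<lambda>t. e t * ?u t) has_real_derivative e t * (sin t * cos t * \<kappa> * (\<integral>x. ?g t x * pair_avg U (rot t x) \<partial>gauss J))) (at t)" for t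
    by (rule DERIV_cong[OF DERIV_mult[OF de du]]) (simp only: u'_eq, simp add: algebra_simps)
  have e_le: "\<bar>e t\<bar> \<le> 1" for t unfolding e_def using k0 kappa_nonneg by simp
  have B0: "0 \<le> B"
  proof -
    have "0 \<le> pair_avg v x" for x using bnd by (intro pair_avg_nonneg) force
    then have "0 \<le> (\<integral>x. pair_avg v (rot 0 x) \<partial>gauss J)" by (intro integral_nonneg_AE) auto
    also have "\<dots> \<le> B" by (rule B) auto
    finally show ?thesis .
  qed
  have "\<bar>e (pi / 2) * ?u (pi / 2) - e 0 * ?u 0\<bar> \<le> (\<kappa> * ((w\<^sup>2 + \<bar>w\<bar>) * B)) * (pi / 2 - 0)"
  proof (rule abs_diff_le_of_deriv[OF deu])
    fix t :: real assume t: "0 \<le> t" "t \<le> pi / 2"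
    have "\<bar>\<integral>x. ?g t x * pair_avg U (rot t x) \<partial>gauss J\<bar> \<le> (w\<^sup>2 + \<bar>w\<bar>) * B"
      by (rule order_trans[OF gU(1) mult_left_mono[OF B[OF t]]]) auto
    then have "\<bar>e t\<bar> * (\<bar>sin t * cos t\<bar> * \<kappa> * \<bar>\<integral>x. ?g t x * pair_avg U (rot t x) \<partial>gauss J\<bar>) \<le> 1 * (1 * \<kappa> * ((w\<^sup>2 + \<bar>w\<bar>) * B))"
      using kappa_nonneg B0 by (intro mult_mono e_le abs_sin_mult_cos_le_1 order_refl mult_nonneg_nonneg) auto
    then show "\<bar>e t * (sin t * cos t * \<kappa> * (\<integral>x. ?g t x * pair_avg U (rot t x) \<partial>gauss J))\<bar> \<le> \<kappa> * ((w\<^sup>2 + \<bar>w\<bar>) * B)"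
      using kappa_nonneg by (simp add: abs_mult)
  qed auto
  also have "\<dots> \<le> (\<kappa> * ((w\<^sup>2 + \<bar>w\<bar>) * B)) * 2"
    using kappa_nonneg B0 pi_less_4 by (intro mult_left_mono mult_nonneg_nonneg) auto
  finally show ?thesis by (simp add: e_def mult_ac)
qed

end

section \<open>One-site estimates\<close>

lemma tanh_sq_le_1: "(tanh (x :: real))\<^sup>2 \<le> 1"
  using tanh_real_lt_1[of x] tanh_real_gt_neg1[of x] by (auto simp: abs_square_le_1 abs_le_iff)

text \<open>Hoeffding's lemma for a spin with mean \<open>q\<close>.\<close>

lemma hoeffding_two_point:
  fixes u q :: real
  assumes "\<bar>q\<bar> \<le> 1"
  shows "(1 + q) / 2 * exp (u * (1 - q)) + (1 - q) / 2 * exp (u * (- 1 - q)) \<le> exp (u\<^sup>2 / 2)"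
proof -
  have pos: "(1 + q) / 2 * exp (u * (1 - q)) + (1 - q) / 2 * exp (u * (- 1 - q)) \<le> exp (u\<^sup>2 / 2)"
    if q: "\<bar>q\<bar> \<le> 1" and u: "0 \<le> u" for u q :: real
  proof -
    define p where "p = (1 + q) / 2"
    have p: "0 \<le> p" using q by (simp add: p_def)
    have r: "0 < 1 + p * (exp (2 * u) - 1)" using p u by (intro add_pos_nonneg mult_nonneg_nonneg) auto
    have "- (2 * u) * p + ln (1 + p * (exp (2 * u) - 1)) \<le> (2 * u)\<^sup>2 / 8"
      using Hoeffdings_lemma_aux[of "2 * u" p] u p by simp
    then have "exp (- (2 * u) * p + ln (1 + p * (exp (2 * u) - 1))) \<le> exp ((2 * u)\<^sup>2 / 8)"
      by (simp only: exp_le_cancel_iff)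
    then have "exp (- (2 * u) * p) * (1 + p * (exp (2 * u) - 1)) \<le> exp ((2 * u)\<^sup>2 / 8)"
      by (simp only: exp_add exp_ln[OF r])
    then have "exp (- (2 * u) * p) * (1 + p * (exp (2 * u) - 1)) \<le> exp (u\<^sup>2 / 2)"
      by (simp add: power_mult_distrib)
    moreover have "(1 + q) / 2 * exp (u * (1 - q)) + (1 - q) / 2 * exp (u * (- 1 - q))
        = exp (- (2 * u) * p) * (1 + p * (exp (2 * u) - 1))"
    proof -
      have e1: "exp (u * (1 - q)) = exp (- (2 * u) * p) * exp (2 * u)"
        unfolding exp_add[symmetric] p_def by (rule arg_cong[where f = exp]) (simp add: field_simps)
      have e2: "exp (u * (- 1 - q)) = exp (- (2 * u) * p)"
        unfolding p_def by (rule arg_cong[where f = exp]) (simp add: field_simps)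
      have e3: "(1 - q) / 2 = 1 - p" by (simp add: p_def field_simps)
      show ?thesis unfolding e1 e2 e3 p_def[symmetric] by (simp only: algebra_simps)
    qed
    ultimately show ?thesis by (simp only:)
  qed
  show ?thesis
  proof (cases "0 \<le> u")
    case True
    then show ?thesis using pos assms by blast
  next
    case False
    then show ?thesis using pos[of "- q" "- u"] assms by (simp add: algebra_simps)
  qed
qed

lemma has_bochner_integral_exp_shift:
  "has_bochner_integral lborel (\<lambda>z. std_normal_density z * exp (z * y)) (exp (y\<^sup>2 / 2))"
proof -
  have "has_bochner_integral lborel (normal_density y 1) 1"
    by (simp add: has_bochner_integral_iff)
  then have "has_bochner_integral lborel (\<lambda>z. exp (y\<^sup>2 / 2) * normal_density y 1 z) (exp (y\<^sup>2 / 2) * 1)"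
    by (rule has_bochner_integral_mult_right)
  moreover have "exp (y\<^sup>2 / 2) * normal_density y 1 z = std_normal_density z * exp (z * y)" for z
  proof -
    have "exp (y\<^sup>2 / 2) * exp (- (z - y)\<^sup>2 / 2) = exp (- z\<^sup>2 / 2) * exp (z * y)"
      unfolding exp_add[symmetric] by (rule arg_cong[where f = exp]) (simp add: power2_eq_square field_simps)
    then show ?thesis by (simp add: normal_density_def)
  qed
  ultimately show ?thesis by simp
qed

text \<open>Read from right to left, this replaces the exponential of a square by a mixture of exponentials of linear functions.\<close>

lemma std_normal_mgf:
  "(\<integral>z. exp (z * y) \<partial>std_normal_distribution) = exp (y\<^sup>2 / 2)"
  "integrable std_normal_distribution (\<lambda>z. exp (z * y))"
  using has_bochner_integral_exp_shift[of y]
  by (simp_all add: integral_density integrable_density has_bochner_integral_iff)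

lemma std_normal_exp_square_integrable:
  assumes c: "c < 1 / 2"
  shows "integrable std_normal_distribution (\<lambda>z. exp (c * z\<^sup>2))"
proof -
  define s where "s = 1 / sqrt (1 - 2 * c)"
  have s: "s > 0" "s\<^sup>2 = 1 / (1 - 2 * c)" using c by (auto simp: s_def power_divide)
  have "std_normal_density z * exp (c * z\<^sup>2) = s * normal_density 0 s z" for z
  proof -
    have "exp (- z\<^sup>2 / 2) * exp (c * z\<^sup>2) = exp (- z\<^sup>2 / (2 * s\<^sup>2))"
      unfolding exp_add[symmetric] s(2) by (rule arg_cong[where f = exp]) (simp add: field_simps)
    moreover have "s / sqrt (2 * pi * s\<^sup>2) = 1 / sqrt (2 * pi)"
      using s(1) by (simp add: real_sqrt_mult)
    moreover have "s * normal_density 0 s z = (s / sqrt (2 * pi * s\<^sup>2)) * exp (- z\<^sup>2 / (2 * s\<^sup>2))"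
      by (simp add: normal_density_def)
    ultimately show ?thesis by (simp add: normal_density_def)
  qed
  moreover have "integrable lborel (\<lambda>z. s * normal_density 0 s z)"
    using s by (intro integrable_mult_right) (simp add: integrable_normal_density)
  ultimately show ?thesis by (simp add: integrable_density)
qed

definition lcosh :: "real \<Rightarrow> real \<Rightarrow> real \<Rightarrow> real" where
  "lcosh a h \<eta> = ln (cosh (sqrt a * \<eta> + h))"

definition lcosh_mean :: "real \<Rightarrow> real \<Rightarrow> real" where
  "lcosh_mean a h = (\<integral>\<eta>. lcosh a h \<eta> \<partial>std_normal_distribution)"

definition lcosh_var :: "real \<Rightarrow> real \<Rightarrow> real" where
  "lcosh_var a h = prob_space.variance std_normal_distribution (lcosh a h)"

definition lcosh_third :: "real \<Rightarrow> real \<Rightarrow> real" where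
  "lcosh_third a h = (\<integral>\<eta>. \<bar>lcosh a h \<eta> - lcosh_mean a h\<bar> ^ 3 \<partial>std_normal_distribution)"

lemma lcosh_bounds: "0 \<le> lcosh a h \<eta>" "lcosh a h \<eta> \<le> \<bar>sqrt a * \<eta> + h\<bar>"
proof -
  let ?x = "sqrt a * \<eta> + h"
  show "0 \<le> lcosh a h \<eta>" unfolding lcosh_def by (intro ln_ge_zero cosh_real_ge_1)
  have "cosh y \<le> exp \<bar>y\<bar>" for y :: real
  proof -
    have "exp y + exp (- y) \<le> exp \<bar>y\<bar> + exp \<bar>y\<bar>"
      by (intro add_mono) (simp_all only: exp_le_cancel_iff abs_ge_self abs_ge_minus_self)
    then show ?thesis by (simp add: cosh_field_def)
  qed
  then have "ln (cosh ?x) \<le> ln (exp \<bar>?x\<bar>)" using cosh_real_pos[of ?x] by (intro ln_mono) auto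
  then show "lcosh a h \<eta> \<le> \<bar>?x\<bar>" by (simp add: lcosh_def)
qed

lemma lcosh_measurable [measurable]: "lcosh a h \<in> borel_measurable borel"
  unfolding lcosh_def[abs_def] using cosh_real_pos
  by (intro borel_measurable_continuous_onI continuous_intros) (auto simp: less_imp_neq[symmetric])

lemma lcosh_power_integrable:
  assumes "k \<le> 3"
  shows "integrable std_normal_distribution (\<lambda>\<eta>. \<bar>lcosh a h \<eta> - \<mu>\<bar> ^ k)"
proof (rule Bochner_Integration.integrable_bound)
  let ?A = "\<bar>sqrt a\<bar> + 1" and ?B = "1 + \<bar>h\<bar> + \<bar>\<mu>\<bar>"
  have i: "integrable std_normal_distribution (\<lambda>\<eta>. \<bar>\<eta>\<bar> ^ k)" for k
    using integrable_std_normal_moment_abs[of k] by (simp add: integrable_density)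
  show "integrable std_normal_distribution (\<lambda>\<eta>. (\<Sum>i\<le>3. real (3 choose i) * (?A * \<bar>\<eta>\<bar>) ^ i * ?B ^ (3 - i)))"
    using i by (intro Bochner_Integration.integrable_sum integrable_mult_left integrable_mult_right)
      (simp add: power_mult_distrib)
  show "AE \<eta> in std_normal_distribution. norm (\<bar>lcosh a h \<eta> - \<mu>\<bar> ^ k)
      \<le> norm (\<Sum>i\<le>3. real (3 choose i) * (?A * \<bar>\<eta>\<bar>) ^ i * ?B ^ (3 - i))"
  proof (intro AE_I2)
    fix \<eta> :: real
    let ?y = "?A * \<bar>\<eta>\<bar> + ?B"
    have "\<bar>lcosh a h \<eta> - \<mu>\<bar> \<le> \<bar>sqrt a * \<eta> + h\<bar> + \<bar>\<mu>\<bar>"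
      using lcosh_bounds[of a h \<eta>] by linarith
    also have "\<bar>sqrt a * \<eta> + h\<bar> \<le> \<bar>sqrt a\<bar> * \<bar>\<eta>\<bar> + \<bar>h\<bar>"
      unfolding abs_mult[symmetric] by (rule abs_triangle_ineq)
    also have "\<bar>sqrt a\<bar> * \<bar>\<eta>\<bar> \<le> ?A * \<bar>\<eta>\<bar>" by (intro mult_right_mono) auto
    finally have le: "\<bar>lcosh a h \<eta> - \<mu>\<bar> \<le> ?y" by linarith
    have y1: "1 \<le> ?y" by (simp add: add_nonneg_nonneg)
    have "\<bar>lcosh a h \<eta> - \<mu>\<bar> ^ k \<le> ?y ^ k" using le by (intro power_mono) auto
    also have "\<dots> \<le> ?y ^ 3" using y1 assms by (intro power_increasing)
    also have "\<dots> = (\<Sum>i\<le>3. real (3 choose i) * (?A * \<bar>\<eta>\<bar>) ^ i * ?B ^ (3 - i))"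
      by (rule binomial_ring)
    finally have fin: "\<bar>lcosh a h \<eta> - \<mu>\<bar> ^ k \<le> (\<Sum>i\<le>3. real (3 choose i) * (?A * \<bar>\<eta>\<bar>) ^ i * ?B ^ (3 - i))" .
    show "norm (\<bar>lcosh a h \<eta> - \<mu>\<bar> ^ k) \<le> norm (\<Sum>i\<le>3. real (3 choose i) * (?A * \<bar>\<eta>\<bar>) ^ i * ?B ^ (3 - i))"
      unfolding real_norm_def by (rule order_trans[OF _ order_trans[OF fin abs_ge_self]]) simp
  qed
qed measurable

lemma lcosh_integrable: "integrable std_normal_distribution (lcosh a h)"
proof -
  have "integrable std_normal_distribution (\<lambda>\<eta>. \<bar>lcosh a h \<eta> - 0\<bar> ^ 1)"
    by (rule lcosh_power_integrable) simp
  then show ?thesis using lcosh_bounds(1) by simp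
qed

lemma lcosh_var_nonneg: "0 \<le> lcosh_var a h"
  unfolding lcosh_var_def by simp

lemma lcosh_third_nonneg: "0 \<le> lcosh_third a h"
  unfolding lcosh_third_def by simp

text \<open>Both sides are compared with \<open>1 - w\<^sup>2 v / 2\<close>, where \<open>v\<close> is the variance; the third absolute moment controls the error of this expansion for the characteristic function.\<close>

lemma lcosh_char:
  "cmod ((\<integral>\<eta>. iexp (w * (lcosh a h \<eta> - lcosh_mean a h)) \<partial>std_normal_distribution)
     - complex_of_real (exp (- (w\<^sup>2 * lcosh_var a h / 2))))
   \<le> (lcosh_third a h / 6 + (lcosh_var a h)\<^sup>2 / 8) * (\<bar>w\<bar> ^ 3 + w ^ 4)"
proof -
  let ?Y = "\<lambda>\<eta>. lcosh a h \<eta> - lcosh_mean a h" and ?v = "lcosh_var a h"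
  have i1: "integrable std_normal_distribution ?Y" using lcosh_integrable by simp
  have i2: "integrable std_normal_distribution (\<lambda>\<eta>. (?Y \<eta>)\<^sup>2)"
    using lcosh_power_integrable[of 2 a h "lcosh_mean a h"] by simp
  have i3: "integrable std_normal_distribution (\<lambda>\<eta>. \<bar>?Y \<eta>\<bar> ^ 3)"
    by (rule lcosh_power_integrable) simp
  have EY: "std_normal.expectation ?Y = 0"
    using lcosh_integrable std_normal.prob_space by (simp add: lcosh_mean_def)
  have var: "std_normal.variance ?Y = ?v"
    unfolding EY by (simp add: lcosh_var_def lcosh_mean_def)
  have ch: "char (distr std_normal_distribution borel ?Y) w = (\<integral>\<eta>. iexp (w * ?Y \<eta>) \<partial>std_normal_distribution)"
    unfolding char_def by (subst integral_distr) auto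
  have "cmod (char (distr std_normal_distribution borel ?Y) w - (1 - w\<^sup>2 * ?v / 2))
      \<le> (w\<^sup>2 / 6) * std_normal.expectation (\<lambda>\<eta>. min (6 * (?Y \<eta>)\<^sup>2) (\<bar>w\<bar> * \<bar>?Y \<eta>\<bar> ^ 3))"
    by (rule std_normal.char_approx3'[OF _ i1 i2 EY var refl]) simp
  also have "\<dots> \<le> (w\<^sup>2 / 6) * (\<integral>\<eta>. \<bar>w\<bar> * \<bar>?Y \<eta>\<bar> ^ 3 \<partial>std_normal_distribution)"
    using i2 i3 by (intro mult_left_mono integral_mono integrable_min) auto
  also have "\<dots> = lcosh_third a h / 6 * \<bar>w\<bar> ^ 3"
    by (simp add: lcosh_third_def power2_eq_square power3_eq_cube)
  finally have 1: "cmod ((\<integral>\<eta>. iexp (w * ?Y \<eta>) \<partial>std_normal_distribution) - (1 - w\<^sup>2 * ?v / 2)) \<le> lcosh_third a h / 6 * \<bar>w\<bar> ^ 3"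
    unfolding ch .
  define x where "x = w\<^sup>2 * ?v / 2"
  have x0: "0 \<le> x" using lcosh_var_nonneg by (simp add: x_def)
  have "\<bar>exp (- x) - (1 - x)\<bar> \<le> x\<^sup>2 / 2"
  proof -
    have lo: "1 - x \<le> exp (- x)" using exp_ge_add_one_self[of "- x"] by simp
    let ?f = "\<lambda>x::real. 1 - x + x\<^sup>2 / 2 - exp (- x)"
    have "?f 0 \<le> ?f x"
    proof (rule DERIV_nonneg_imp_nondecreasing[OF x0])
      fix t :: real assume "0 \<le> t"
      have "(?f has_real_derivative (- 1 + t + exp (- t))) (at t)"
        by (auto intro!: derivative_eq_intros)
      moreover have "0 \<le> - 1 + t + exp (- t)" using exp_ge_add_one_self[of "- t"] by simp
      ultimately show "\<exists>y. (?f has_real_derivative y) (at t) \<and> 0 \<le> y" by blast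
    qed
    then show ?thesis using lo by simp
  qed
  then have "\<bar>(1 - x) - exp (- x)\<bar> \<le> x\<^sup>2 / 2" by linarith
  then have 2: "cmod ((1 - complex_of_real x) - complex_of_real (exp (- x))) \<le> x\<^sup>2 / 2"
    by (metis norm_of_real of_real_1 of_real_diff)
  have "cmod ((\<integral>\<eta>. iexp (w * ?Y \<eta>) \<partial>std_normal_distribution) - complex_of_real (exp (- x)))
      \<le> cmod ((\<integral>\<eta>. iexp (w * ?Y \<eta>) \<partial>std_normal_distribution) - (1 - complex_of_real x))
        + cmod ((1 - complex_of_real x) - complex_of_real (exp (- x)))"
    by (rule norm_diff_triangle_ineq[THEN order_trans[rotated]]) (simp add: norm_triangle_ineq flip: add_diff_eq)
  also have "\<dots> \<le> lcosh_third a h / 6 * \<bar>w\<bar> ^ 3 + ?v\<^sup>2 / 8 * w ^ 4"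
  proof (intro add_mono)
    show "cmod ((\<integral>\<eta>. iexp (w * ?Y \<eta>) \<partial>std_normal_distribution) - (1 - complex_of_real x)) \<le> lcosh_third a h / 6 * \<bar>w\<bar> ^ 3"
      using 1 by (simp add: x_def)
    have "x\<^sup>2 / 2 = ?v\<^sup>2 / 8 * w ^ 4" by (simp add: x_def power2_eq_square power4_eq_xxxx)
    then show "cmod ((1 - complex_of_real x) - complex_of_real (exp (- x))) \<le> ?v\<^sup>2 / 8 * w ^ 4"
      using 2 by simp
  qed
  also have "\<dots> \<le> (lcosh_third a h / 6 + ?v\<^sup>2 / 8) * (\<bar>w\<bar> ^ 3 + w ^ 4)"
  proof -
    have "0 \<le> ?v\<^sup>2 / 8 * \<bar>w\<bar> ^ 3" "0 \<le> lcosh_third a h / 6 * w ^ 4" using lcosh_third_nonneg by auto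
    then show ?thesis by (simp add: distrib_right distrib_left)
  qed
  finally show ?thesis by (simp add: x_def)
qed

section \<open>The species model and its decoupled end point\<close>

text \<open>\<open>sp\<close> assigns a species to each site. The numbers of sites are only required to satisfy
  \<open>\<lambda>\<^sub>s N - 1 \<le> |I\<^sub>s| \<le> \<lambda>\<^sub>s N\<close>; this costs errors of relative order \<open>1/N\<close>, and makes the model available for all ratios.
  \<open>fv\<close> are the variances of the fields at \<open>t = 0\<close>.\<close>

locale species_model =
  fixes m :: nat and V :: "nat set" and sp :: "nat \<Rightarrow> nat" and N :: real
    and lam :: "nat \<Rightarrow> real" and Dv :: "nat \<Rightarrow> nat \<Rightarrow> real" and \<beta> h :: real and q fv :: "nat \<Rightarrow> real"
  assumes fin_V: "finite V" and sp: "\<And>i. i \<in> V \<Longrightarrow> sp i < m" and N: "N \<ge> 1"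
    and lam: "\<And>s. s < m \<Longrightarrow> lam s > 0"
    and Dv: "\<And>s t. s < m \<Longrightarrow> t < m \<Longrightarrow> Dv s t \<ge> 0" "\<And>s t. s < m \<Longrightarrow> t < m \<Longrightarrow> Dv s t = Dv t s"
    and beta: "\<beta> > 0"
    and q: "\<And>s. s < m \<Longrightarrow> 0 \<le> q s \<and> q s \<le> 1"
    and fv: "\<And>s. s < m \<Longrightarrow> fv s = \<beta>\<^sup>2 * (\<Sum>t<m. Dv s t * lam t * q t)"
    and fixed: "\<And>s. s < m \<Longrightarrow> q s = (\<integral>\<eta>. (tanh (sqrt (fv s) * \<eta> + h))\<^sup>2 \<partial>std_normal_distribution)"
    and sizes: "\<And>s. s < m \<Longrightarrow> real (card {i \<in> V. sp i = s}) \<le> lam s * N"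
      "\<And>s. s < m \<Longrightarrow> lam s * N - 1 \<le> real (card {i \<in> V. sp i = s})"
begin

definition pairs :: "(nat \<times> nat) set" where "pairs = {(i, j). i \<in> V \<and> j \<in> V \<and> i < j}"
text \<open>The index \<open>(i, j)\<close> with \<open>i < j\<close> is a coupling, the index \<open>(i, i)\<close> is the field at site \<open>i\<close>.\<close>

definition idx :: "(nat \<times> nat) set" where "idx = pairs \<union> (\<lambda>i. (i, i)) ` V"
definition confs :: "(nat \<Rightarrow> real) set" where "confs = V \<rightarrow>\<^sub>E {-1, 1}"

definition coef :: "nat \<times> nat \<Rightarrow> (nat \<Rightarrow> real) \<Rightarrow> real" where
  "coef = (\<lambda>(i, j) \<sigma>. if i < j then \<beta> / sqrt N * sqrt (Dv (sp i) (sp j)) * (\<sigma> i * \<sigma> j) else sqrt (fv (sp i)) * \<sigma> i)"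

definition ext :: "(nat \<Rightarrow> real) \<Rightarrow> real" where "ext \<sigma> = h * (\<Sum>i\<in>V. \<sigma> i)"

definition bil :: "(nat \<Rightarrow> real) \<Rightarrow> (nat \<Rightarrow> real) \<Rightarrow> real" where
  "bil x y = (\<Sum>s<m. \<Sum>t<m. lam s * lam t * Dv s t * (x s * y t))"

text \<open>Normalised by \<open>\<lambda>\<^sub>s N\<close> and not by the number of sites, so that the covariance is exactly a quadratic form in the overlaps.\<close>

definition ovl :: "(nat \<Rightarrow> real) \<Rightarrow> (nat \<Rightarrow> real) \<Rightarrow> nat \<Rightarrow> real" where
  "ovl \<sigma> \<tau> s = (\<Sum>i\<in>{i \<in> V. sp i = s}. \<sigma> i * \<tau> i) / (lam s * N)"

definition dev :: "(nat \<Rightarrow> real) \<Rightarrow> (nat \<Rightarrow> real) \<Rightarrow> nat \<Rightarrow> real" where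
  "dev \<sigma> \<tau> s = ovl \<sigma> \<tau> s - q s"

definition Uq :: "(nat \<Rightarrow> real) \<Rightarrow> (nat \<Rightarrow> real) \<Rightarrow> real" where
  "Uq \<sigma> \<tau> = bil (dev \<sigma> \<tau>) (dev \<sigma> \<tau>)"

definition base :: real where
  "base = bil q q + (\<Sum>i\<in>V. Dv (sp i) (sp i)) / N\<^sup>2"

definition self :: "nat \<Rightarrow> real" where "self s = real (card {i \<in> V. sp i = s}) / (lam s * N)"

lemma fv_nonneg: "s < m \<Longrightarrow> 0 \<le> fv s"
  using fv[of s] Dv lam q less_imp_le[OF lam] by (auto intro!: mult_nonneg_nonneg sum_nonneg)

lemma finite_idx: "finite idx" "finite pairs"
proof -
  have "pairs \<subseteq> V \<times> V" by (auto simp: pairs_def)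
  then show "finite pairs" using fin_V by (meson finite_SigmaI finite_subset)
  then show "finite idx" using fin_V by (simp add: idx_def)
qed

lemma confs: "finite confs" "confs \<noteq> {}"
  using fin_V by (auto simp: confs_def PiE_eq_empty_iff intro: finite_PiE)

lemma conf_sq: "\<sigma> \<in> confs \<Longrightarrow> i \<in> V \<Longrightarrow> \<sigma> i * \<sigma> i = 1"
  unfolding confs_def by (drule PiE_mem[of _ _ _ i]) auto

lemma sum_by_species: "(\<Sum>i\<in>V. f (sp i) * x i) = (\<Sum>s<m. f s * (\<Sum>i\<in>{i \<in> V. sp i = s}. x i :: real))"
proof -
  have "(\<Sum>i\<in>V. f (sp i) * x i) = (\<Sum>s<m. \<Sum>i\<in>{i \<in> V. sp i = s}. f (sp i) * x i)"
    using sp by (intro sum.group[symmetric] fin_V) auto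
  also have "\<dots> = (\<Sum>s<m. f s * (\<Sum>i\<in>{i \<in> V. sp i = s}. x i))"
    unfolding sum_distrib_left by (intro sum.cong refl) auto
  finally show ?thesis .
qed

lemma sum_pairs:
  assumes "\<And>i j. i \<in> V \<Longrightarrow> j \<in> V \<Longrightarrow> f i j = f j i"
  shows "2 * (\<Sum>(i, j)\<in>pairs. f i j) = (\<Sum>i\<in>V. \<Sum>j\<in>V. f i j) - (\<Sum>i\<in>V. f i i :: real)"
proof -
  let ?d = "(\<lambda>i. (i, i)) ` V" and ?r = "prod.swap ` pairs"
  have VV: "V \<times> V = pairs \<union> ?r \<union> ?d"
    by (auto simp: pairs_def image_iff)
  have fin: "finite ?r" "finite ?d" using finite_idx fin_V by auto
  have "(\<Sum>i\<in>V. \<Sum>j\<in>V. f i j) = (\<Sum>(i, j)\<in>V \<times> V. f i j)"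
    by (simp add: sum.cartesian_product)
  also have "\<dots> = (\<Sum>(i, j)\<in>pairs. f i j) + (\<Sum>(i, j)\<in>?r. f i j) + (\<Sum>(i, j)\<in>?d. f i j)"
    unfolding VV using finite_idx(2) fin
    by (subst sum.union_disjoint; (subst sum.union_disjoint)?) (auto simp: pairs_def)
  also have "(\<Sum>(i, j)\<in>?r. f i j) = (\<Sum>(i, j)\<in>pairs. f i j)"
    by (subst sum.reindex) (auto simp: assms pairs_def case_prod_unfold intro!: sum.cong)
  also have "(\<Sum>(i, j)\<in>?d. f i j) = (\<Sum>i\<in>V. f i i)"
    by (subst sum.reindex) (auto simp: inj_on_def)
  finally show ?thesis by simp
qed

lemma bil_diff: "bil (\<lambda>s. x s - y s) (\<lambda>s. x s - y s) = bil x x - 2 * bil x y + bil y y"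
proof -
  have sym: "bil y x = bil x y"
    unfolding bil_def by (subst sum.swap) (intro sum.cong refl, simp add: Dv(2) mult_ac)
  have "bil (\<lambda>s. x s - y s) (\<lambda>s. x s - y s) = bil x x - bil x y - bil y x + bil y y"
    unfolding bil_def sum.distrib[symmetric] sum_subtractf[symmetric]
    by (intro sum.cong refl) (simp add: algebra_simps)
  then show ?thesis using sym by simp
qed

text \<open>The couplings give \<open>N \<beta>\<^sup>2 / 2\<close> times the form at the overlap, without the diagonal \<open>i = j\<close>, and the fields give the
  linear term \<open>- N \<beta>\<^sup>2 * bil (ovl \<sigma> \<tau>) q\<close>. Together they are a square centred at \<open>q\<close>.\<close>

lemma covariance:
  assumes "\<sigma> \<in> confs" "\<tau> \<in> confs"
  shows "(\<Sum>j\<in>idx. (if j \<in> pairs then 1 else -1) * (coef j \<sigma> * coef j \<tau>)) = N * \<beta>\<^sup>2 / 2 * (Uq \<sigma> \<tau> - base)"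
proof -
  define x where "x i = \<sigma> i * \<tau> i" for i
  let ?X = "\<lambda>s. \<Sum>i\<in>{i \<in> V. sp i = s}. x i"
  have x2: "x i * x i = 1" if "i \<in> V" for i
    using conf_sq[OF assms(1) that] conf_sq[OF assms(2) that] by (simp add: x_def mult_ac)
  have X: "?X s = lam s * N * ovl \<sigma> \<tau> s" if "s < m" for s
    using lam[OF that] N by (simp add: ovl_def x_def)
  have disj: "pairs \<inter> (\<lambda>i. (i, i)) ` V = {}" by (auto simp: pairs_def)
  have "(\<Sum>j\<in>idx. (if j \<in> pairs then 1 else -1) * (coef j \<sigma> * coef j \<tau>))
      = (\<Sum>j\<in>pairs. coef j \<sigma> * coef j \<tau>) + (\<Sum>j\<in>(\<lambda>i. (i, i)) ` V. - (coef j \<sigma> * coef j \<tau>))"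
    unfolding idx_def sum.union_disjoint[OF finite_idx(2) finite_imageI[OF fin_V] disj]
    by (intro arg_cong2[where f = "(+)"] sum.cong refl) (auto simp: pairs_def)
  also have "(\<Sum>j\<in>pairs. coef j \<sigma> * coef j \<tau>) = \<beta>\<^sup>2 / N * (\<Sum>(i, j)\<in>pairs. Dv (sp i) (sp j) * (x i * x j))"
    unfolding sum_distrib_left
  proof (intro sum.cong refl)
    fix p assume p: "p \<in> pairs"
    obtain i j where ij: "p = (i, j)" by (cases p)
    have D: "0 \<le> Dv (sp i) (sp j)" using p ij sp by (intro Dv) (auto simp: pairs_def)
    have r: "\<beta> / sqrt N * sqrt (Dv (sp i) (sp j)) * (\<beta> / sqrt N * sqrt (Dv (sp i) (sp j))) = \<beta>\<^sup>2 / N * Dv (sp i) (sp j)"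
      using D N by (simp add: power2_eq_square)
    have "coef p \<sigma> * coef p \<tau> = (\<beta> / sqrt N * sqrt (Dv (sp i) (sp j)) * (\<beta> / sqrt N * sqrt (Dv (sp i) (sp j)))) * (x i * x j)"
      using p by (simp add: ij coef_def pairs_def x_def mult_ac)
    then show "coef p \<sigma> * coef p \<tau> = \<beta>\<^sup>2 / N * (case p of (i, j) \<Rightarrow> Dv (sp i) (sp j) * (x i * x j))"
      unfolding r by (simp add: ij mult.assoc)
  qed
  also have "(\<Sum>(i, j)\<in>pairs. Dv (sp i) (sp j) * (x i * x j))
      = ((\<Sum>i\<in>V. \<Sum>j\<in>V. Dv (sp i) (sp j) * (x i * x j)) - (\<Sum>i\<in>V. Dv (sp i) (sp i))) / 2"
  proof -
    have sym: "Dv (sp i) (sp j) * (x i * x j) = Dv (sp j) (sp i) * (x j * x i)" if "i \<in> V" "j \<in> V" for i j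
      using Dv(2)[OF sp[OF that(1)] sp[OF that(2)]] by simp
    have "(\<Sum>i\<in>V. Dv (sp i) (sp i) * (x i * x i)) = (\<Sum>i\<in>V. Dv (sp i) (sp i))"
      by (intro sum.cong refl) (simp add: x2)
    then show ?thesis
      using sum_pairs[of "\<lambda>i j. Dv (sp i) (sp j) * (x i * x j)", OF sym] by (simp only:) simp
  qed
  also have "(\<Sum>i\<in>V. \<Sum>j\<in>V. Dv (sp i) (sp j) * (x i * x j)) = N\<^sup>2 * bil (ovl \<sigma> \<tau>) (ovl \<sigma> \<tau>)"
  proof -
    have "(\<Sum>i\<in>V. \<Sum>j\<in>V. Dv (sp i) (sp j) * (x i * x j)) = (\<Sum>i\<in>V. (\<Sum>t<m. Dv (sp i) t * ?X t) * x i)"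
    proof (intro sum.cong refl)
      fix i assume "i \<in> V"
      have "(\<Sum>j\<in>V. Dv (sp i) (sp j) * (x i * x j)) = (\<Sum>j\<in>V. Dv (sp i) (sp j) * x j) * x i"
        unfolding sum_distrib_right by (intro sum.cong refl) simp
      then show "(\<Sum>j\<in>V. Dv (sp i) (sp j) * (x i * x j)) = (\<Sum>t<m. Dv (sp i) t * ?X t) * x i"
        unfolding sum_by_species[of "Dv (sp i)" x] .
    qed
    also have "\<dots> = (\<Sum>s<m. (\<Sum>t<m. Dv s t * ?X t) * ?X s)"
      by (rule sum_by_species)
    also have "\<dots> = (\<Sum>s<m. (\<Sum>t<m. Dv s t * (lam t * N * ovl \<sigma> \<tau> t)) * (lam s * N * ovl \<sigma> \<tau> s))"
      by (intro sum.cong refl arg_cong2[where f = "(*)"] X) auto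
    also have "\<dots> = N\<^sup>2 * bil (ovl \<sigma> \<tau>) (ovl \<sigma> \<tau>)"
      unfolding bil_def sum_distrib_left sum_distrib_right
      by (intro sum.cong refl) (simp add: power2_eq_square)
    finally show ?thesis .
  qed
  also have "(\<Sum>j\<in>(\<lambda>i. (i, i)) ` V. - (coef j \<sigma> * coef j \<tau>)) = - (N * \<beta>\<^sup>2 * bil (ovl \<sigma> \<tau>) q)"
  proof -
    have "(\<Sum>j\<in>(\<lambda>i. (i, i)) ` V. - (coef j \<sigma> * coef j \<tau>)) = (\<Sum>i\<in>V. - (fv (sp i)) * x i)"
    proof (subst sum.reindex)
      show "(\<Sum>i\<in>V. ((\<lambda>j. - (coef j \<sigma> * coef j \<tau>)) \<circ> (\<lambda>i. (i, i))) i) = (\<Sum>i\<in>V. - (fv (sp i)) * x i)"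
      proof (intro sum.cong refl)
        fix i assume i: "i \<in> V"
        have "sqrt (fv (sp i)) * sqrt (fv (sp i)) = fv (sp i)" using fv_nonneg[OF sp[OF i]] by simp
        then show "((\<lambda>j. - (coef j \<sigma> * coef j \<tau>)) \<circ> (\<lambda>i. (i, i))) i = - (fv (sp i)) * x i"
          by (simp add: coef_def x_def mult_ac)
      qed
    qed (auto simp: inj_on_def)
    also have "\<dots> = (\<Sum>s<m. - fv s * ?X s)" by (rule sum_by_species)
    also have "\<dots> = - (\<Sum>s<m. (\<beta>\<^sup>2 * (\<Sum>t<m. Dv s t * lam t * q t)) * (lam s * N * ovl \<sigma> \<tau> s))"
      unfolding sum_negf[symmetric]
      by (intro sum.cong refl) (simp only: fv X lessThan_iff mult_minus_left)
    also have "\<dots> = - (N * \<beta>\<^sup>2 * bil (ovl \<sigma> \<tau>) q)"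
      unfolding bil_def sum_distrib_left sum_distrib_right
      by (intro arg_cong[where f = uminus] sum.cong refl) simp
    finally show ?thesis .
  qed
  finally have "(\<Sum>j\<in>idx. (if j \<in> pairs then 1 else -1) * (coef j \<sigma> * coef j \<tau>))
     = \<beta>\<^sup>2 / N * ((N\<^sup>2 * bil (ovl \<sigma> \<tau>) (ovl \<sigma> \<tau>) - (\<Sum>i\<in>V. Dv (sp i) (sp i))) / 2) + - (N * \<beta>\<^sup>2 * bil (ovl \<sigma> \<tau>) q)" .
  also have "\<dots> = N * \<beta>\<^sup>2 / 2 * (Uq \<sigma> \<tau> - base)"
    unfolding Uq_def dev_def[abs_def] bil_diff base_def using N by (simp add: field_simps power2_eq_square)
  finally show ?thesis .
qed

lemma Uq_self: "\<sigma> \<in> confs \<Longrightarrow> Uq \<sigma> \<sigma> = bil (\<lambda>s. self s - q s) (\<lambda>s. self s - q s)"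
proof -
  assume s: "\<sigma> \<in> confs"
  have "dev \<sigma> \<sigma> = (\<lambda>s. self s - q s)"
    by (rule ext) (simp add: dev_def ovl_def self_def conf_sq[OF s])
  then show ?thesis by (simp add: Uq_def)
qed

lemma Uq_sym: "Uq \<sigma> \<tau> = Uq \<tau> \<sigma>"
  by (simp add: Uq_def dev_def[abs_def] ovl_def[abs_def] mult.commute)

sublocale gibbs_interpolation idx pairs confs coef ext Uq "N * \<beta>\<^sup>2 / 2" base "bil (\<lambda>s. self s - q s) (\<lambda>s. self s - q s)"
  by unfold_locales (use finite_idx confs covariance Uq_self N in auto)

definition fld :: "nat \<Rightarrow> real \<Rightarrow> real" where "fld i \<eta> = sqrt (fv (sp i)) * \<eta> + h"

lemma fld_measurable [measurable]: "fld i \<in> borel_measurable borel"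
  unfolding fld_def[abs_def] by measurable

lemma en_zero: "en (rot 0 x) \<sigma> = (\<Sum>i\<in>V. fld i (x (i, i)) * \<sigma> i)"
proof -
  have disj: "pairs \<inter> (\<lambda>i. (i, i)) ` V = {}" by (auto simp: pairs_def)
  have "(\<Sum>j\<in>idx. rate j 0 * x j * coef j \<sigma>)
      = (\<Sum>j\<in>pairs. rate j 0 * x j * coef j \<sigma>) + (\<Sum>j\<in>(\<lambda>i. (i, i)) ` V. rate j 0 * x j * coef j \<sigma>)"
    unfolding idx_def by (rule sum.union_disjoint[OF finite_idx(2) finite_imageI[OF fin_V] disj])
  also have "(\<Sum>j\<in>pairs. rate j 0 * x j * coef j \<sigma>) = 0"
    by (intro sum.neutral ballI) (simp add: rate_def)
  also have "(\<Sum>j\<in>(\<lambda>i. (i, i)) ` V. rate j 0 * x j * coef j \<sigma>) = (\<Sum>i\<in>V. x (i, i) * (sqrt (fv (sp i)) * \<sigma> i))"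
  proof -
    have "(i, i) \<notin> pairs" for i by (simp add: pairs_def)
    then have "rate (i, i) 0 = 1" for i by (simp add: rate_def)
    then show ?thesis by (subst sum.reindex) (auto simp: inj_on_def coef_def)
  qed
  finally have "(\<Sum>j\<in>idx. rate j 0 * x j * coef j \<sigma>) = (\<Sum>i\<in>V. x (i, i) * (sqrt (fv (sp i)) * \<sigma> i))" by simp
  moreover have "(\<Sum>i\<in>V. (sqrt (fv (sp i)) * x (i, i) + h) * \<sigma> i)
      = h * (\<Sum>i\<in>V. \<sigma> i) + (\<Sum>i\<in>V. x (i, i) * (sqrt (fv (sp i)) * \<sigma> i))"
    unfolding sum_distrib_left sum.distrib[symmetric] by (intro sum.cong refl) (simp add: algebra_simps)
  ultimately show ?thesis unfolding en_def ext_def fld_def by simp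
qed

lemma sum_confs_prod:
  fixes f :: "nat \<Rightarrow> real \<Rightarrow> real"
  shows "(\<Sum>\<sigma>\<in>confs. \<Prod>i\<in>V. f i (\<sigma> i)) = (\<Prod>i\<in>V. f i (-1) + f i 1)"
  unfolding confs_def using fin_V by (subst prod_sum_PiE[symmetric]) auto

lemma Z_zero: "Z (rot 0 x) = (\<Prod>i\<in>V. 2 * cosh (fld i (x (i, i))))"
proof -
  have "Z (rot 0 x) = (\<Sum>\<sigma>\<in>confs. \<Prod>i\<in>V. exp (fld i (x (i, i)) * \<sigma> i))"
    unfolding Z_def en_zero using fin_V by (simp add: exp_sum)
  also have "\<dots> = (\<Prod>i\<in>V. 2 * cosh (fld i (x (i, i))))"
    by (subst sum_confs_prod) (auto intro!: prod.cong simp: cosh_field_def)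
  finally show ?thesis .
qed

lemma ln_Z_zero: "ln (Z (rot 0 x)) = (\<Sum>i\<in>V. ln (2 * cosh (fld i (x (i, i)))))"
  unfolding Z_zero using cosh_real_pos by (subst ln_prod) (auto simp: fin_V less_imp_neq[symmetric])

text \<open>Without couplings the Gibbs measure is a product; the mean of \<open>a i * b i\<close> is the squared tanh of the field at \<open>i\<close>.\<close>

lemma pair_avg_prod:
  fixes g :: "nat \<Rightarrow> real \<Rightarrow> real"
  shows "pair_avg (\<lambda>a b. \<Prod>i\<in>V. g i (a i * b i)) (rot 0 x)
    = (\<Prod>i\<in>V. (1 + (tanh (fld i (x (i, i))))\<^sup>2) / 2 * g i 1 + (1 - (tanh (fld i (x (i, i))))\<^sup>2) / 2 * g i (-1))"
proof -
  define w where "w i y = exp (fld i (x (i, i)) * y) / (2 * cosh (fld i (x (i, i))))" for i and y :: real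
  have wt: "wt (rot 0 x) a = (\<Prod>i\<in>V. w i (a i))" for a
    unfolding wt_def Z_zero en_zero w_def using fin_V by (simp add: exp_sum prod_dividef)
  have "pair_avg (\<lambda>a b. \<Prod>i\<in>V. g i (a i * b i)) (rot 0 x)
      = (\<Sum>a\<in>confs. (\<Prod>i\<in>V. w i (a i)) * (\<Sum>b\<in>confs. \<Prod>i\<in>V. w i (b i) * g i (a i * b i)))"
    unfolding pair_avg_def wt sum_distrib_left by (simp add: prod.distrib mult.assoc)
  also have "\<dots> = (\<Sum>a\<in>confs. \<Prod>i\<in>V. w i (a i) * (w i (-1) * g i (a i * -1) + w i 1 * g i (a i * 1)))"
  proof (intro sum.cong refl)
    fix a
    have "(\<Sum>b\<in>confs. \<Prod>i\<in>V. w i (b i) * g i (a i * b i)) = (\<Prod>i\<in>V. w i (-1) * g i (a i * -1) + w i 1 * g i (a i * 1))"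
      by (rule sum_confs_prod)
    then show "(\<Prod>i\<in>V. w i (a i)) * (\<Sum>b\<in>confs. \<Prod>i\<in>V. w i (b i) * g i (a i * b i))
        = (\<Prod>i\<in>V. w i (a i) * (w i (-1) * g i (a i * -1) + w i 1 * g i (a i * 1)))"
      by (simp only: prod.distrib)
  qed
  also have "\<dots> = (\<Prod>i\<in>V. w i (-1) * (w i (-1) * g i (-1 * -1) + w i 1 * g i (-1 * 1))
      + w i 1 * (w i (-1) * g i (1 * -1) + w i 1 * g i (1 * 1)))"
    by (rule sum_confs_prod)
  also have "\<dots> = (\<Prod>i\<in>V. (1 + (tanh (fld i (x (i, i))))\<^sup>2) / 2 * g i 1 + (1 - (tanh (fld i (x (i, i))))\<^sup>2) / 2 * g i (-1))"
  proof (intro prod.cong refl)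
    fix i
    let ?H = "fld i (x (i, i))"
    have c: "cosh ?H \<noteq> 0" using cosh_real_pos[of ?H] by simp
    have w1: "w i 1 = (1 + tanh ?H) / 2" "w i (-1) = (1 - tanh ?H) / 2"
    proof -
      have "w i 1 = (cosh ?H + sinh ?H) / (2 * cosh ?H)" "w i (-1) = (cosh ?H - sinh ?H) / (2 * cosh ?H)"
        by (simp_all add: w_def cosh_plus_sinh cosh_minus_sinh)
      then show "w i 1 = (1 + tanh ?H) / 2" "w i (-1) = (1 - tanh ?H) / 2"
        using c by (simp_all add: tanh_def field_simps)
    qed
    show "w i (-1) * (w i (-1) * g i (-1 * -1) + w i 1 * g i (-1 * 1)) + w i 1 * (w i (-1) * g i (1 * -1) + w i 1 * g i (1 * 1))
       = (1 + (tanh ?H)\<^sup>2) / 2 * g i 1 + (1 - (tanh ?H)\<^sup>2) / 2 * g i (-1)"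
      unfolding w1 by (simp add: power2_eq_square field_simps)
  qed
  finally show ?thesis .
qed

lemma gauss_diag_prod:
  fixes f :: "nat \<Rightarrow> real \<Rightarrow> 'b :: {real_normed_field, banach, second_countable_topology}"
  assumes "\<And>i. i \<in> V \<Longrightarrow> integrable std_normal_distribution (f i)"
  shows "(\<integral>x. (\<Prod>i\<in>V. f i (x (i, i))) \<partial>gauss idx) = (\<Prod>i\<in>V. \<integral>\<eta>. f i \<eta> \<partial>std_normal_distribution)"
    and "integrable (gauss idx) (\<lambda>x. \<Prod>i\<in>V. f i (x (i, i)))"
proof -
  define F where "F j = (if j \<in> pairs then (\<lambda>_. 1) else f (fst j))" for j :: "nat \<times> nat"
  have disj: "pairs \<inter> (\<lambda>i. (i, i)) ` V = {}" by (auto simp: pairs_def)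
  have split: "(\<Prod>j\<in>idx. G j) = (\<Prod>i\<in>V. G (i, i))" if "\<And>j. j \<in> pairs \<Longrightarrow> G j = 1" for G :: "nat \<times> nat \<Rightarrow> 'b"
  proof -
    have "(\<Prod>j\<in>idx. G j) = (\<Prod>j\<in>pairs. G j) * (\<Prod>j\<in>(\<lambda>i. (i, i)) ` V. G j)"
      unfolding idx_def by (rule prod.union_disjoint[OF finite_idx(2) finite_imageI[OF fin_V] disj])
    also have "\<dots> = (\<Prod>i\<in>V. G (i, i))"
      using that by (subst prod.reindex) (auto simp: inj_on_def)
    finally show ?thesis .
  qed
  have Fi: "F (i, i) = f i" for i by (simp add: F_def pairs_def)
  have int: "integrable std_normal_distribution (F j)" if "j \<in> idx" for j
    using that assms by (auto simp: F_def idx_def)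
  have eq: "(\<Prod>j\<in>idx. F j (x j)) = (\<Prod>i\<in>V. f i (x (i, i)))" for x
    by (subst split) (auto simp: F_def pairs_def)
  show "integrable (gauss idx) (\<lambda>x. \<Prod>i\<in>V. f i (x (i, i)))"
    unfolding eq[symmetric] by (rule std_normals.product_integrable_prod[OF finite_idx(1) int])
  have "(\<integral>x. (\<Prod>i\<in>V. f i (x (i, i))) \<partial>gauss idx) = (\<Prod>j\<in>idx. \<integral>\<eta>. F j \<eta> \<partial>std_normal_distribution)"
    unfolding eq[symmetric] by (rule std_normals.product_integral_prod[OF finite_idx(1) int])
  also have "\<dots> = (\<Prod>i\<in>V. \<integral>\<eta>. f i \<eta> \<partial>std_normal_distribution)"
  proof (subst split)
    fix j assume "j \<in> pairs"
    then show "(\<integral>\<eta>. F j \<eta> \<partial>std_normal_distribution) = 1"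
      using std_normal.prob_space by (simp add: F_def)
  qed (simp add: Fi)
  finally show "(\<integral>x. (\<Prod>i\<in>V. f i (x (i, i))) \<partial>gauss idx) = (\<Prod>i\<in>V. \<integral>\<eta>. f i \<eta> \<partial>std_normal_distribution)" .
qed

lemma tanh_sq_integrable: "integrable std_normal_distribution (\<lambda>\<eta>. (tanh (fld i \<eta>))\<^sup>2)"
proof (rule integrable_std_normal_bounded[of _ 1])
  show "(\<lambda>\<eta>. (tanh (fld i \<eta>))\<^sup>2) \<in> borel_measurable borel"
    unfolding fld_def by (intro borel_measurable_continuous_onI continuous_intros) auto
  show "\<bar>(tanh (fld i \<eta>))\<^sup>2\<bar> \<le> 1" for \<eta> using tanh_sq_le_1 by simp
qed

text \<open>After averaging over the fields, the products \<open>a i * b i\<close> behave like independent spins, and by the fixed point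
  equation their means are \<open>q\<close>.\<close>

lemma mean_pair_avg_prod:
  fixes g :: "nat \<Rightarrow> real \<Rightarrow> real"
  shows "(\<integral>x. pair_avg (\<lambda>a b. \<Prod>i\<in>V. g i (a i * b i)) (rot 0 x) \<partial>gauss idx)
    = (\<Prod>i\<in>V. (1 + q (sp i)) / 2 * g i 1 + (1 - q (sp i)) / 2 * g i (-1))"
proof -
  have int: "integrable std_normal_distribution (\<lambda>\<eta>. (1 + (tanh (fld i \<eta>))\<^sup>2) / 2 * g i 1 + (1 - (tanh (fld i \<eta>))\<^sup>2) / 2 * g i (-1))" for i
    using tanh_sq_integrable[of i] by simp
  have "(\<integral>\<eta>. (1 + (tanh (fld i \<eta>))\<^sup>2) / 2 * g i 1 + (1 - (tanh (fld i \<eta>))\<^sup>2) / 2 * g i (-1) \<partial>std_normal_distribution)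
      = (1 + q (sp i)) / 2 * g i 1 + (1 - q (sp i)) / 2 * g i (-1)" if "i \<in> V" for i
    using tanh_sq_integrable[of i] fixed[OF sp[OF that]] std_normal.prob_space
    by (simp add: fld_def)
  then show ?thesis unfolding pair_avg_prod by (subst gauss_diag_prod(1)[OF int]) simp
qed

text \<open>The averaged weights turn the mean of any two-replica average into a finite sum; the integral over the auxiliary
  Gaussian variables below can then be exchanged with it by linearity alone.\<close>

definition mean_wt :: "(nat \<Rightarrow> real) \<Rightarrow> (nat \<Rightarrow> real) \<Rightarrow> real" where
  "mean_wt a b = (\<integral>x. wt (rot 0 x) a * wt (rot 0 x) b \<partial>gauss idx)"

lemma mean_wt_nonneg: "0 \<le> mean_wt a b"
  unfolding mean_wt_def by (intro integral_nonneg_AE AE_I2 mult_nonneg_nonneg wt_nonneg)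

lemma mean_pair_avg_linear:
  "(\<integral>x. pair_avg f (rot 0 x) \<partial>gauss idx) = (\<Sum>a\<in>confs. \<Sum>b\<in>confs. mean_wt a b * f a b)"
proof -
  interpret G: prob_space "gauss idx" by (rule prob_gauss)
  have wt1: "wt x a \<le> 1" if "a \<in> confs" for a x
    using that fin_S member_le_sum[of a confs "wt x"] by (simp add: wt_nonneg wt_sum)
  have int: "integrable (gauss idx) (\<lambda>x. wt (rot 0 x) a * wt (rot 0 x) b)" if "a \<in> confs" "b \<in> confs" for a b
  proof (rule integrable_gauss_path[where P = "\<lambda>x. wt x a * wt x b" and k = 1])
    show "(\<lambda>x. wt x a * wt x b) \<in> borel_measurable (PiM idx (\<lambda>_. borel))" unfolding wt_def by measurable
    show "wt x a * wt x b = wt (restrict x idx) a * wt (restrict x idx) b" for x using depends_on_J(4)[of x] by simp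
    show "\<bar>wt x a * wt x b\<bar> \<le> 1" for x
      using mult_mono[OF wt1[OF that(1), of x] wt1[OF that(2), of x]] by (simp add: abs_mult wt_nonneg)
  qed
  show ?thesis
    unfolding pair_avg_def mean_wt_def using int by (simp add: Bochner_Integration.integral_sum)
qed

text \<open>With \<open>T\<close> the sum of the centred products over a species, the exponent is at most \<open>c * T\<^sup>2 / M\<close>, \<open>M = \<lambda>\<^sub>s N\<close>, up to a
  constant. Linearise the square by a standard normal variable \<open>z s\<close> for each species, so that the sites
  become independent; Hoeffding's bound at each site then leaves \<open>exp (c * (z s)\<^sup>2)\<close>, which is integrable for
  \<open>c < 1 / 2\<close>. The auxiliary \<open>\<epsilon>\<close> absorbs the deviation of the number of sites from \<open>\<lambda>\<^sub>s N\<close>. The bound does not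
  depend on \<open>N\<close>, except through \<open>c1\<close>.\<close>

lemma initial_exponential_bound:
  assumes v: "\<And>a b. a \<in> confs \<Longrightarrow> b \<in> confs \<Longrightarrow> v a b \<le> \<rho> * (\<Sum>s<m. lam s * (dev a b s)\<^sup>2)"
    and s: "0 \<le> s0" "0 \<le> \<rho>" and \<epsilon>: "0 < \<epsilon>" and c1: "c1 = s0 * \<rho> / N" and c2: "(1 + \<epsilon>) * c1 < 1 / 2"
  shows "(\<integral>x. pair_exp v s0 (rot 0 x) \<partial>gauss idx)
    \<le> exp (\<Sum>s<m. c1 * (1 + 1 / \<epsilon>) / lam s) * (\<integral>z. exp ((1 + \<epsilon>) * c1 * z\<^sup>2) \<partial>std_normal_distribution) ^ m"
proof -
  define c where "c = (1 + \<epsilon>) * c1"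
  have c1_0: "0 \<le> c1" and c0: "0 \<le> c" using s N \<epsilon> by (auto simp: c_def c1)
  define A where "A = exp (\<Sum>s<m. c1 * (1 + 1 / \<epsilon>) / lam s)"
  define M where "M s = lam s * N" for s
  define T where "T a b s = (\<Sum>i\<in>{i \<in> V. sp i = s}. a i * b i - q s)" for a b :: "nat \<Rightarrow> real" and s
  define u where "u z s = z s * sqrt (2 * c / M s)" for z :: "nat \<Rightarrow> real" and s
  define g where "g z i y = exp (u z (sp i) * (y - q (sp i)))" for z i and y :: real
  have M: "0 < M s" "lam s \<le> M s" if "s < m" for s
    using lam[OF that] N by (auto simp: M_def)
  \<comment> \<open>The cross term of the square is split with weight \<open>\<epsilon>\<close>.\<close>
  have young: "(t + d)\<^sup>2 \<le> (1 + \<epsilon>) * t\<^sup>2 + (1 + 1 / \<epsilon>) * d\<^sup>2" for t d :: real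
  proof -
    have "0 \<le> (\<epsilon> * t - d)\<^sup>2 / \<epsilon>" using \<epsilon> by simp
    also have "\<dots> = \<epsilon> * t\<^sup>2 - 2 * t * d + d\<^sup>2 / \<epsilon>" using \<epsilon> by (simp add: power2_eq_square field_simps)
    finally show ?thesis by (simp add: power2_eq_square algebra_simps)
  qed
  have dev: "dev a b s = (T a b s + (real (card {i \<in> V. sp i = s}) - M s) * q s) / M s" if "s < m" for a b s
    using M[OF that] unfolding dev_def ovl_def T_def M_def[symmetric] by (simp add: sum_subtractf field_simps)
  have term_le: "s0 * \<rho> * (lam s * (dev a b s)\<^sup>2) \<le> c1 * (1 + 1 / \<epsilon>) / lam s + c * (T a b s)\<^sup>2 / M s" if s: "s < m" for a b s
  proof -
    define d where "d = (real (card {i \<in> V. sp i = s}) - M s) * q s"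
    have d: "\<bar>d\<bar> \<le> 1 * 1" unfolding d_def abs_mult
      using sizes[OF s] q[OF s] by (intro mult_mono) (auto simp: M_def)
    then have d2: "d\<^sup>2 \<le> 1" by (simp add: abs_square_le_1)
    have "s0 * \<rho> * (lam s * (dev a b s)\<^sup>2) = c1 / M s * (T a b s + d)\<^sup>2"
      unfolding dev[OF s] d_def[symmetric] c1 using lam[OF s] N M[OF s]
      by (simp add: M_def power_divide power2_eq_square)
    also have "\<dots> \<le> c1 / M s * ((1 + \<epsilon>) * (T a b s)\<^sup>2 + (1 + 1 / \<epsilon>) * d\<^sup>2)"
      using c1_0 M[OF s] by (intro mult_left_mono young) auto
    also have "\<dots> = c1 * (1 + 1 / \<epsilon>) * d\<^sup>2 / M s + c * (T a b s)\<^sup>2 / M s"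
      by (simp add: c_def algebra_simps add_divide_distrib)
    also have "c1 * (1 + 1 / \<epsilon>) * d\<^sup>2 / M s \<le> c1 * (1 + 1 / \<epsilon>) * 1 / lam s"
      using c1_0 \<epsilon> M[OF s] lam[OF s] d2 by (intro frac_le mult_left_mono mult_nonneg_nonneg) auto
    finally show ?thesis by simp
  qed
  \<comment> \<open>\<open>exp (y\<^sup>2 / 2)\<close> is the moment generating function of a standard normal variable at \<open>y\<close>.\<close>
  have lin: "exp (c * (T a b s)\<^sup>2 / M s) = (\<integral>z. exp (z * (sqrt (2 * c / M s) * T a b s)) \<partial>std_normal_distribution)"
    if "s < m" for a b s
    unfolding std_normal_mgf using M[OF that] c0 by (simp add: power_mult_distrib)
  have prod_s: "(\<Prod>s<m. exp (z s * (sqrt (2 * c / M s) * T a b s))) = (\<Prod>i\<in>V. g z i (a i * b i))" for z a b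
  proof -
    have "(\<Prod>i\<in>V. g z i (a i * b i)) = exp (\<Sum>i\<in>V. u z (sp i) * (a i * b i - q (sp i)))"
      using fin_V by (simp add: g_def exp_sum)
    also have "(\<Sum>i\<in>V. u z (sp i) * (a i * b i - q (sp i))) = (\<Sum>s<m. u z s * (\<Sum>i\<in>{i \<in> V. sp i = s}. a i * b i - q (sp i)))"
      by (rule sum_by_species)
    also have "\<dots> = (\<Sum>s<m. z s * (sqrt (2 * c / M s) * T a b s))"
      unfolding T_def u_def by (intro sum.cong refl) (auto simp: mult.assoc intro!: arg_cong2[where f = "(*)"] sum.cong)
    finally show ?thesis by (simp add: exp_sum)
  qed
  have int_z: "integrable (gauss {..<m}) (\<lambda>z. \<Prod>i\<in>V. g z i (a i * b i))" for a b
    unfolding prod_s[symmetric]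
    by (rule std_normals.product_integrable_prod) (auto intro: std_normal_mgf)
  have expv: "exp (s0 * v a b) \<le> A * (\<integral>z. (\<Prod>i\<in>V. g z i (a i * b i)) \<partial>gauss {..<m})" if ab: "a \<in> confs" "b \<in> confs" for a b
  proof -
    have "s0 * v a b \<le> s0 * (\<rho> * (\<Sum>s<m. lam s * (dev a b s)\<^sup>2))" using v[OF ab] s(1) by (rule mult_left_mono)
    also have "\<dots> = (\<Sum>s<m. s0 * \<rho> * (lam s * (dev a b s)\<^sup>2))" by (simp add: sum_distrib_left mult.assoc)
    also have "\<dots> \<le> (\<Sum>s<m. c1 * (1 + 1 / \<epsilon>) / lam s + c * (T a b s)\<^sup>2 / M s)"
      by (intro sum_mono term_le) auto
    finally have "exp (s0 * v a b) \<le> exp (\<Sum>s<m. c1 * (1 + 1 / \<epsilon>) / lam s + c * (T a b s)\<^sup>2 / M s)" by simp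
    also have "\<dots> = A * (\<Prod>s<m. exp (c * (T a b s)\<^sup>2 / M s))"
      by (simp add: sum.distrib exp_add A_def exp_sum)
    also have "(\<Prod>s<m. exp (c * (T a b s)\<^sup>2 / M s)) = (\<Prod>s<m. (\<integral>z. exp (z * (sqrt (2 * c / M s) * T a b s)) \<partial>std_normal_distribution))"
      by (intro prod.cong refl lin) auto
    also have "\<dots> = (\<integral>z. (\<Prod>s<m. exp (z s * (sqrt (2 * c / M s) * T a b s))) \<partial>gauss {..<m})"
      by (rule std_normals.product_integral_prod[symmetric]) (auto intro: std_normal_mgf)
    finally show ?thesis unfolding prod_s .
  qed
  note \<omega> = mean_wt_nonneg mean_pair_avg_linear
  have mean_g: "(\<Sum>a\<in>confs. \<Sum>b\<in>confs. mean_wt a b * (\<Prod>i\<in>V. g z i (a i * b i))) \<le> (\<Prod>s<m. exp (c * (z s)\<^sup>2))" for z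
  proof -
    have "(\<Sum>a\<in>confs. \<Sum>b\<in>confs. mean_wt a b * (\<Prod>i\<in>V. g z i (a i * b i)))
        = (\<Prod>i\<in>V. (1 + q (sp i)) / 2 * g z i 1 + (1 - q (sp i)) / 2 * g z i (-1))"
      unfolding \<omega>(2)[symmetric] by (rule mean_pair_avg_prod)
    also have "\<dots> \<le> (\<Prod>i\<in>V. exp ((u z (sp i))\<^sup>2 / 2))"
    proof (rule prod_mono, intro conjI)
      fix i assume i: "i \<in> V"
      have "\<bar>q (sp i)\<bar> \<le> 1" using q[OF sp[OF i]] by simp
      from hoeffding_two_point[OF this, of "u z (sp i)"]
      show "(1 + q (sp i)) / 2 * g z i 1 + (1 - q (sp i)) / 2 * g z i (-1) \<le> exp ((u z (sp i))\<^sup>2 / 2)"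
        by (simp add: g_def)
      show "0 \<le> (1 + q (sp i)) / 2 * g z i 1 + (1 - q (sp i)) / 2 * g z i (-1)"
        using q[OF sp[OF i]] by (intro add_nonneg_nonneg mult_nonneg_nonneg) (auto simp: g_def)
    qed
    also have "\<dots> = exp (\<Sum>i\<in>V. (u z (sp i))\<^sup>2 / 2 * 1)" using fin_V by (simp add: exp_sum)
    also have "(\<Sum>i\<in>V. (u z (sp i))\<^sup>2 / 2 * 1) = (\<Sum>s<m. (u z s)\<^sup>2 / 2 * (\<Sum>i\<in>{i \<in> V. sp i = s}. 1))"
      by (rule sum_by_species)
    also have "\<dots> \<le> (\<Sum>s<m. c * (z s)\<^sup>2)"
    proof (intro sum_mono)
      fix s assume "s \<in> {..<m}"
      then have s: "s < m" by simp
      have "(u z s)\<^sup>2 / 2 * (\<Sum>i\<in>{i \<in> V. sp i = s}. 1) = c * (z s)\<^sup>2 * (real (card {i \<in> V. sp i = s}) / M s)"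
        using M[OF s] c0 by (simp add: u_def power_mult_distrib)
      also have "\<dots> \<le> c * (z s)\<^sup>2 * 1"
        using M[OF s] c0 sizes(1)[OF s] by (intro mult_left_mono) (auto simp: M_def)
      finally show "(u z s)\<^sup>2 / 2 * (\<Sum>i\<in>{i \<in> V. sp i = s}. 1) \<le> c * (z s)\<^sup>2" by simp
    qed
    finally show ?thesis by (simp add: exp_sum)
  qed
  have "(\<integral>x. pair_exp v s0 (rot 0 x) \<partial>gauss idx) = (\<Sum>a\<in>confs. \<Sum>b\<in>confs. mean_wt a b * exp (s0 * v a b))"
    unfolding pair_exp_pair_avg by (rule \<omega>)
  also have "\<dots> \<le> (\<Sum>a\<in>confs. \<Sum>b\<in>confs. mean_wt a b * (A * (\<integral>z. (\<Prod>i\<in>V. g z i (a i * b i)) \<partial>gauss {..<m})))"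
    by (intro sum_mono mult_left_mono expv \<omega>)
  also have "\<dots> = A * (\<integral>z. (\<Sum>a\<in>confs. \<Sum>b\<in>confs. mean_wt a b * (\<Prod>i\<in>V. g z i (a i * b i))) \<partial>gauss {..<m})"
    using int_z by (simp add: Bochner_Integration.integral_sum sum_distrib_left mult_ac)
  also have "\<dots> \<le> A * (\<integral>z. (\<Prod>s<m. exp (c * (z s)\<^sup>2)) \<partial>gauss {..<m})"
    using int_z mean_g c2
    by (intro mult_left_mono integral_mono Bochner_Integration.integrable_sum integrable_mult_right
        std_normals.product_integrable_prod std_normal_exp_square_integrable) (auto simp: A_def c_def)
  also have "(\<integral>z. (\<Prod>s<m. exp (c * (z s)\<^sup>2)) \<partial>gauss {..<m}) = (\<Prod>s<m. \<integral>z. exp (c * z\<^sup>2) \<partial>std_normal_distribution)"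
    using c2 by (intro std_normals.product_integral_prod std_normal_exp_square_integrable) (auto simp: c_def)
  finally show ?thesis by (simp add: A_def c_def)
qed

lemma mean_ln_Z_zero: "(\<integral>x. ln (Z (rot 0 x)) \<partial>gauss idx) = (\<Sum>i\<in>V. ln 2 + lcosh_mean (fv (sp i)) h)"
proof -
  interpret G: prob_space "gauss idx" by (rule prob_gauss)
  have mem: "(i, i) \<in> idx" if "i \<in> V" for i using that by (simp add: idx_def)
  have distr: "distr (gauss idx) std_normal_distribution (\<lambda>x. x (i, i)) = std_normal_distribution" if "i \<in> V" for i
    by (intro distr_PiM_component prob_std_normal mem that)
  have eq: "(\<integral>x. lcosh (fv (sp i)) h (x (i, i)) \<partial>gauss idx) = lcosh_mean (fv (sp i)) h" if i: "i \<in> V" for i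
  proof -
    have "(\<integral>\<eta>. lcosh (fv (sp i)) h \<eta> \<partial>distr (gauss idx) std_normal_distribution (\<lambda>x. x (i, i)))
        = (\<integral>x. lcosh (fv (sp i)) h (x (i, i)) \<partial>gauss idx)"
      using mem[OF i] by (intro integral_distr) auto
    then show ?thesis unfolding distr[OF i] by (simp add: lcosh_mean_def)
  qed
  have int: "integrable (gauss idx) (\<lambda>x. lcosh (fv (sp i)) h (x (i, i)))" if i: "i \<in> V" for i
  proof -
    have "integrable (distr (gauss idx) std_normal_distribution (\<lambda>x. x (i, i))) (lcosh (fv (sp i)) h)"
      unfolding distr[OF i] by (rule lcosh_integrable)
    then show ?thesis using mem[OF i] by (subst (asm) integrable_distr_eq) auto
  qed
  have "ln (Z (rot 0 x)) = (\<Sum>i\<in>V. ln 2 + lcosh (fv (sp i)) h (x (i, i)))" for x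
    unfolding ln_Z_zero lcosh_def fld_def using cosh_real_pos
    by (intro sum.cong refl ln_mult_pos) auto
  then show ?thesis
    using int eq G.prob_space by (simp add: Bochner_Integration.integral_sum)
qed

text \<open>Without couplings \<open>log Z\<close> is a sum of independent terms, one for each site.\<close>

lemma char_ln_Z_zero:
  "cmod ((\<integral>x. iexp (w * (ln (Z (rot 0 x)) - (\<Sum>i\<in>V. ln 2 + lcosh_mean (fv (sp i)) h))) \<partial>gauss idx)
      - complex_of_real (exp (- (w\<^sup>2 / 2 * (\<Sum>s<m. real (card {i \<in> V. sp i = s}) * lcosh_var (fv s) h)))))
    \<le> N * (\<Sum>s<m. lam s * (lcosh_third (fv s) h / 6 + (lcosh_var (fv s) h)\<^sup>2 / 8)) * (\<bar>w\<bar> ^ 3 + w ^ 4)"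
proof -
  define k where "k s = lcosh_third (fv s) h / 6 + (lcosh_var (fv s) h)\<^sup>2 / 8" for s
  define \<phi> where "\<phi> s = (\<integral>\<eta>. iexp (w * (lcosh (fv s) h \<eta> - lcosh_mean (fv s) h)) \<partial>std_normal_distribution)" for s
  define \<gamma> where "\<gamma> s = complex_of_real (exp (- (w\<^sup>2 * lcosh_var (fv s) h / 2)))" for s
  have k0: "0 \<le> k s" for s using lcosh_third_nonneg by (auto simp: k_def)
  have w0: "0 \<le> \<bar>w\<bar> ^ 3 + w ^ 4" by auto
  have int: "integrable std_normal_distribution (\<lambda>\<eta>. iexp (w * (lcosh a h \<eta> - lcosh_mean a h)))" for a
    by (rule std_normal.integrable_iexp) auto
  have "iexp (w * (ln (Z (rot 0 x)) - (\<Sum>i\<in>V. ln 2 + lcosh_mean (fv (sp i)) h)))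
      = (\<Prod>i\<in>V. iexp (w * (lcosh (fv (sp i)) h (x (i, i)) - lcosh_mean (fv (sp i)) h)))" for x
  proof -
    have "ln (Z (rot 0 x)) = (\<Sum>i\<in>V. ln 2 + lcosh (fv (sp i)) h (x (i, i)))"
      unfolding ln_Z_zero lcosh_def fld_def using cosh_real_pos
      by (intro sum.cong refl ln_mult_pos) auto
    then have "ln (Z (rot 0 x)) - (\<Sum>i\<in>V. ln 2 + lcosh_mean (fv (sp i)) h)
        = (\<Sum>i\<in>V. lcosh (fv (sp i)) h (x (i, i)) - lcosh_mean (fv (sp i)) h)"
      by (simp add: sum.distrib sum_subtractf)
    then show ?thesis
      using fin_V by (simp only: sum_distrib_left of_real_sum exp_sum)
  qed
  then have "(\<integral>x. iexp (w * (ln (Z (rot 0 x)) - (\<Sum>i\<in>V. ln 2 + lcosh_mean (fv (sp i)) h))) \<partial>gauss idx)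
      = (\<integral>x. (\<Prod>i\<in>V. iexp (w * (lcosh (fv (sp i)) h (x (i, i)) - lcosh_mean (fv (sp i)) h))) \<partial>gauss idx)"
    by simp
  also have "\<dots> = (\<Prod>i\<in>V. \<phi> (sp i))"
    unfolding \<phi>_def by (rule gauss_diag_prod(1)[where f = "\<lambda>i \<eta>. iexp (w * (lcosh (fv (sp i)) h \<eta> - lcosh_mean (fv (sp i)) h))"]) (rule int)
  finally have lhs: "(\<integral>x. iexp (w * (ln (Z (rot 0 x)) - (\<Sum>i\<in>V. ln 2 + lcosh_mean (fv (sp i)) h))) \<partial>gauss idx)
      = (\<Prod>i\<in>V. \<phi> (sp i))" .
  have "(\<Sum>i\<in>V. w\<^sup>2 * lcosh_var (fv (sp i)) h / 2 * 1) = (\<Sum>s<m. w\<^sup>2 * lcosh_var (fv s) h / 2 * (\<Sum>i\<in>{i \<in> V. sp i = s}. 1))"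
    by (rule sum_by_species)
  also have "\<dots> = w\<^sup>2 / 2 * (\<Sum>s<m. real (card {i \<in> V. sp i = s}) * lcosh_var (fv s) h)"
    unfolding sum_distrib_left by (intro sum.cong refl) simp
  finally have "(\<Prod>i\<in>V. \<gamma> (sp i)) = complex_of_real (exp (- (w\<^sup>2 / 2 * (\<Sum>s<m. real (card {i \<in> V. sp i = s}) * lcosh_var (fv s) h))))"
  proof -
    assume eq: "(\<Sum>i\<in>V. w\<^sup>2 * lcosh_var (fv (sp i)) h / 2 * 1)
      = w\<^sup>2 / 2 * (\<Sum>s<m. real (card {i \<in> V. sp i = s}) * lcosh_var (fv s) h)"
    have "(\<Prod>i\<in>V. \<gamma> (sp i)) = complex_of_real (exp (\<Sum>i\<in>V. - (w\<^sup>2 * lcosh_var (fv (sp i)) h / 2 * 1)))"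
      unfolding \<gamma>_def exp_sum[OF fin_V] by simp
    then show ?thesis unfolding sum_negf eq .
  qed
  moreover have "cmod ((\<Prod>i\<in>V. \<phi> (sp i)) - (\<Prod>i\<in>V. \<gamma> (sp i))) \<le> (\<Sum>i\<in>V. cmod (\<phi> (sp i) - \<gamma> (sp i)))"
  proof (rule norm_prod_diff)
    show "cmod (\<phi> (sp i)) \<le> 1" for i
    proof -
      have "cmod (\<phi> (sp i)) \<le> (\<integral>\<eta>. 1 \<partial>std_normal_distribution)"
        unfolding \<phi>_def by (rule order_trans[OF integral_norm_bound]) simp
      then show ?thesis using std_normal.prob_space by simp
    qed
    show "cmod (\<gamma> (sp i)) \<le> 1" for i unfolding \<gamma>_def using lcosh_var_nonneg by simp
  qed
  moreover have "(\<Sum>i\<in>V. cmod (\<phi> (sp i) - \<gamma> (sp i))) \<le> (\<Sum>i\<in>V. k (sp i) * (\<bar>w\<bar> ^ 3 + w ^ 4))"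
    unfolding \<phi>_def \<gamma>_def k_def by (intro sum_mono lcosh_char)
  moreover have "(\<Sum>i\<in>V. k (sp i) * (\<bar>w\<bar> ^ 3 + w ^ 4)) \<le> N * (\<Sum>s<m. lam s * k s) * (\<bar>w\<bar> ^ 3 + w ^ 4)"
  proof -
    have "(\<Sum>i\<in>V. k (sp i) * 1) = (\<Sum>s<m. k s * (\<Sum>i\<in>{i \<in> V. sp i = s}. 1))" by (rule sum_by_species)
    also have "\<dots> \<le> (\<Sum>s<m. k s * (lam s * N))"
      using sizes(1) k0 by (intro sum_mono mult_left_mono) auto
    also have "\<dots> = N * (\<Sum>s<m. lam s * k s)" by (simp add: sum_distrib_left mult_ac)
    finally show ?thesis using w0 by (simp add: sum_distrib_right[symmetric] mult_right_mono)
  qed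
  ultimately show ?thesis unfolding lhs k_def by simp
qed

lemma dev_sym: "dev a b = dev b a"
  by (simp add: dev_def[abs_def] ovl_def[abs_def] mult.commute)

text \<open>The exponent starts at \<open>s N\<close> with \<open>s\<close> half way between \<open>K \<beta>\<^sup>2 / 2\<close>, which the path consumes, and \<open>1 / (2 \<rho>)\<close>, where the
  exponential moment at \<open>t = 0\<close> ceases to be bounded. \<open>C\<close> is written out because it must not depend on \<open>N\<close>, \<open>V\<close> and \<open>sp\<close>.\<close>

theorem overlap_bound:
  assumes form: "\<And>x. \<bar>bil x x\<bar> \<le> vq x" "\<And>x. vq x \<le> \<rho> * (\<Sum>s<m. lam s * (x s)\<^sup>2)"
    and K: "K = 8 \<or> (K = 4 \<and> (\<forall>x. 0 \<le> bil x x))"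
    and \<rho>: "0 < \<rho>" "K * \<beta>\<^sup>2 * \<rho> < 1" and t: "0 \<le> t" "t \<le> pi / 2"
    and c1: "c1 = (K * \<beta>\<^sup>2 * \<rho> + 1) / 4" and \<epsilon>: "\<epsilon> = (1 / (2 * c1) - 1) / 2"
    and C: "C = exp (\<Sum>s<m. c1 * (1 + 1 / \<epsilon>) / lam s) * (\<integral>z. exp ((1 + \<epsilon>) * c1 * z\<^sup>2) \<partial>std_normal_distribution) ^ m
       / ((1 / (2 * \<rho>) - K * \<beta>\<^sup>2 / 2) / 2)"
  shows "(\<integral>x. pair_avg (\<lambda>a b. vq (dev a b)) (rot t x) \<partial>gauss idx) \<le> C / N"
proof -
  define s where "s = (K * \<beta>\<^sup>2 / 2 + 1 / (2 * \<rho>)) / 2"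
  have K0: "0 < K" using K by auto
  have Kr: "0 < K * \<beta>\<^sup>2 * \<rho>" using K0 beta \<rho> by simp
  have c1_b: "0 < c1" "c1 < 1 / 2" using Kr \<rho>(2) by (auto simp: c1)
  \<comment> \<open>\<open>\<epsilon>\<close> is chosen so that \<open>(1 + \<epsilon>) * c1\<close> is the midpoint of \<open>c1\<close> and \<open>1 / 2\<close>.\<close>
  have eps: "0 < \<epsilon>" using c1_b by (simp add: \<epsilon> field_simps)
  have "(1 + \<epsilon>) * c1 = c1 / 2 + 1 / 4" using c1_b by (simp add: \<epsilon> field_simps)
  then have c2: "(1 + \<epsilon>) * c1 < 1 / 2" using c1_b by simp
  have gap: "s - K * \<beta>\<^sup>2 / 2 = (1 / (2 * \<rho>) - K * \<beta>\<^sup>2 / 2) / 2" by (simp add: s_def field_simps)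
  have gap0: "0 < (1 / (2 * \<rho>) - K * \<beta>\<^sup>2 / 2) / 2" using \<rho> by (simp add: field_simps)
  have s0: "0 \<le> s" using K0 \<rho> by (simp add: s_def)
  have "(\<integral>x. pair_avg (\<lambda>a b. vq (dev a b)) (rot t x) \<partial>gauss idx)
      \<le> (\<integral>x. pair_exp (\<lambda>a b. vq (dev a b)) (N * s) (rot 0 x) \<partial>gauss idx) / (N * s - K * (N * \<beta>\<^sup>2 / 2))"
  proof (rule overlap_second_moment[where v = "\<lambda>a b. vq (dev a b)", OF Uq_sym _ _ _ _ t])
    show "vq (dev a b) = vq (dev b a)" for a b by (simp add: dev_sym[of a b])
    show "\<bar>Uq a b\<bar> \<le> vq (dev a b)" for a b unfolding Uq_def by (rule form)
    show "K = 8 \<or> K = 4 \<and> (\<forall>a\<in>confs. \<forall>b\<in>confs. 0 \<le> Uq a b)" using K by (auto simp: Uq_def)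
    have "N * (K * \<beta>\<^sup>2 / 2) < N * s" using gap gap0 N by (intro mult_strict_left_mono) auto
    then show "K * (N * \<beta>\<^sup>2 / 2) < N * s" by (simp add: mult_ac)
  qed
  also have "N * s - K * (N * \<beta>\<^sup>2 / 2) = N * ((1 / (2 * \<rho>) - K * \<beta>\<^sup>2 / 2) / 2)"
    unfolding gap[symmetric] by (simp add: algebra_simps)
  also have "(\<integral>x. pair_exp (\<lambda>a b. vq (dev a b)) (N * s) (rot 0 x) \<partial>gauss idx)
      \<le> exp (\<Sum>s<m. c1 * (1 + 1 / \<epsilon>) / lam s) * (\<integral>z. exp ((1 + \<epsilon>) * c1 * z\<^sup>2) \<partial>std_normal_distribution) ^ m"
  proof (rule initial_exponential_bound[where \<rho> = \<rho>])
    show "c1 = N * s * \<rho> / N" using N \<rho> by (simp add: s_def c1 field_simps)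
  qed (use form N s0 \<rho> eps c2 in auto)
  finally have "(\<integral>x. pair_avg (\<lambda>a b. vq (dev a b)) (rot t x) \<partial>gauss idx)
    \<le> exp (\<Sum>s<m. c1 * (1 + 1 / \<epsilon>) / lam s) * (\<integral>z. exp ((1 + \<epsilon>) * c1 * z\<^sup>2) \<partial>std_normal_distribution) ^ m
      / (N * ((1 / (2 * \<rho>) - K * \<beta>\<^sup>2 / 2) / 2))"
    using N gap0 by (simp add: divide_right_mono)
  also have "\<dots> = C / N" unfolding C by (simp add: mult.commute)
  finally show ?thesis .
qed

text \<open>\<open>log Z\<close> of the model, centred by the value that the interpolation predicts for its mean; if the numbers of sites are exactly \<open>\<lambda>\<^sub>s N\<close>, this is \<open>N\<close> times the replica symmetric value.\<close>

definition fluct :: "(nat \<times> nat \<Rightarrow> real) \<Rightarrow> real" where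
  "fluct x = ln (Z (rot (pi / 2) x)) - N * \<beta>\<^sup>2 / 4 * bil (\<lambda>s. self s - q s) (\<lambda>s. self s - q s)
     - (\<Sum>i\<in>V. ln 2 + lcosh_mean (fv (sp i)) h)"

lemma fluct_measurable: "fluct \<in> borel_measurable (gauss idx)"
  unfolding fluct_def[abs_def]
  by (intro borel_measurable_diff borel_measurable_const ln_Z_path_measurable)

lemma fluct_integrable: "integrable (gauss idx) fluct"
proof -
  interpret G: prob_space "gauss idx" by (rule prob_gauss)
  show ?thesis unfolding fluct_def[abs_def]
    by (intro Bochner_Integration.integrable_diff integrable_ln_Z_path) auto
qed

lemma fluct_mean_bound:
  assumes form: "\<And>x. \<bar>bil x x\<bar> \<le> vq x"
    and C: "\<And>t. 0 \<le> t \<Longrightarrow> t \<le> pi / 2 \<Longrightarrow> (\<integral>x. pair_avg (\<lambda>a b. vq (dev a b)) (rot t x) \<partial>gauss idx) \<le> C / N"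
  shows "\<bar>\<integral>x. fluct x \<partial>gauss idx\<bar> \<le> \<beta>\<^sup>2 * C"
proof -
  interpret G: prob_space "gauss idx" by (rule prob_gauss)
  have "\<bar>(\<integral>x. ln (Z (rot (pi / 2) x)) \<partial>gauss idx) - N * \<beta>\<^sup>2 / 2 * bil (\<lambda>s. self s - q s) (\<lambda>s. self s - q s) / 2
      - (\<integral>x. ln (Z (rot 0 x)) \<partial>gauss idx)\<bar> \<le> 2 * (N * \<beta>\<^sup>2 / 2) * (C / N)"
    by (rule mean_log_partition_comparison[where v = "\<lambda>a b. vq (dev a b)", OF _ C]) (auto simp: Uq_def form)
  then show ?thesis
    unfolding mean_ln_Z_zero fluct_def using integrable_ln_Z_path N
    by (simp add: G.prob_space field_simps)
qed

lemma iexp_eq_cos_sin: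
  assumes "prob_space M" and [measurable]: "f \<in> borel_measurable M"
  shows "(\<integral>x. iexp (f x) \<partial>M) = Complex (\<integral>x. cos (f x) \<partial>M) (\<integral>x. cos (f x + - pi / 2) \<partial>M)"
proof -
  interpret prob_space M by fact
  have i: "integrable M (\<lambda>x. iexp (f x))" by (rule integrable_iexp) auto
  have "Re (\<integral>x. iexp (f x) \<partial>M) = (\<integral>x. Re (iexp (f x)) \<partial>M)" "Im (\<integral>x. iexp (f x) \<partial>M) = (\<integral>x. Im (iexp (f x)) \<partial>M)"
    using i by (simp_all add: integral_Re integral_Im)
  moreover have "Re (iexp a) = cos a" "Im (iexp a) = sin a" "cos (a + - pi / 2) = sin a" for a :: real
    by (simp_all add: cis_conv_exp[symmetric] cos_diff)
  ultimately show ?thesis by (simp only: complex_eq_iff complex.sel)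
qed

text \<open>At \<open>w = y / \<surd>N\<close> the exponential factor of the comparison is of order one, whereas the errors are of order \<open>1/\<surd>N\<close>.\<close>

theorem fluct_char_bound:
  assumes form: "\<And>x. \<bar>bil x x\<bar> \<le> vq x"
    and C: "\<And>t. 0 \<le> t \<Longrightarrow> t \<le> pi / 2 \<Longrightarrow> (\<integral>x. pair_avg (\<lambda>a b. vq (dev a b)) (rot t x) \<partial>gauss idx) \<le> C / N"
  shows "cmod (complex_of_real (exp (- (\<beta>\<^sup>2 / 4 * base * y\<^sup>2))) * (\<integral>x. iexp (y / sqrt N * fluct x) \<partial>gauss idx)
      - complex_of_real (exp (- (y\<^sup>2 / 2 * (\<Sum>s<m. real (card {i \<in> V. sp i = s}) / N * lcosh_var (fv s) h)))))
    \<le> 2 * \<beta>\<^sup>2 * C * (y\<^sup>2 / N + \<bar>y\<bar> / sqrt N)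
      + (\<Sum>s<m. lam s * (lcosh_third (fv s) h / 6 + (lcosh_var (fv s) h)\<^sup>2 / 8)) * (\<bar>y\<bar> ^ 3 / sqrt N + y ^ 4 / N)"
proof -
  define w where "w = y / sqrt N"
  define c where "c = (\<Sum>i\<in>V. ln 2 + lcosh_mean (fv (sp i)) h)"
  define U1 where "U1 = bil (\<lambda>s. self s - q s) (\<lambda>s. self s - q s)"
  define \<kappa> where "\<kappa> = N * \<beta>\<^sup>2 / 2"
  have N0: "N > 0" and sN: "sqrt N > 0" "sqrt N * sqrt N = N" using N by auto
  have base0: "0 \<le> base"
    unfolding base_def bil_def using lam Dv q sp N0
    by (intro add_nonneg_nonneg sum_nonneg divide_nonneg_nonneg mult_nonneg_nonneg) (auto simp: less_imp_le)
  have w2: "w\<^sup>2 = y\<^sup>2 / N" using N0 by (simp add: w_def power_divide)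
  have \<kappa>w: "\<kappa> * base * w\<^sup>2 / 2 = \<beta>\<^sup>2 / 4 * base * y\<^sup>2" using N0 by (simp add: \<kappa>_def w2)
  \<comment> \<open>The centring of \<open>fluct\<close> only changes the phase.\<close>
  have fl: "w * fluct x + \<alpha> = w * (ln (Z (rot (pi / 2) x)) - \<kappa> * U1 / 2) + (\<alpha> - w * c)" for x \<alpha>
    by (simp add: fluct_def c_def U1_def \<kappa>_def algebra_simps)
  have cosb: "\<bar>exp (- (\<beta>\<^sup>2 / 4 * base * y\<^sup>2)) * (\<integral>x. cos (w * fluct x + \<alpha>) \<partial>gauss idx)
     - (\<integral>x. cos (w * (ln (Z (rot 0 x)) - c) + \<alpha>) \<partial>gauss idx)\<bar> \<le> 2 * \<kappa> * (w\<^sup>2 + \<bar>w\<bar>) * (C / N)" for \<alpha>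
  proof -
    have "\<bar>exp (- (\<kappa> * base * w\<^sup>2 / 2)) * (\<integral>x. cos (w * (ln (Z (rot (pi / 2) x)) - \<kappa> * U1 / 2) + (\<alpha> - w * c)) \<partial>gauss idx)
     - (\<integral>x. cos (w * ln (Z (rot 0 x)) + (\<alpha> - w * c)) \<partial>gauss idx)\<bar> \<le> 2 * \<kappa> * (w\<^sup>2 + \<bar>w\<bar>) * (C / N)"
      unfolding \<kappa>_def U1_def
      by (rule cos_log_partition_comparison[where v = "\<lambda>a b. vq (dev a b)", OF _ C base0]) (auto simp: Uq_def form)
    then show ?thesis unfolding \<kappa>w fl by (simp add: algebra_simps)
  qed
  let ?L = "\<integral>x. iexp (w * fluct x) \<partial>gauss idx" and ?R = "\<integral>x. iexp (w * (ln (Z (rot 0 x)) - c)) \<partial>gauss idx"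
  have m1: "(\<lambda>x. w * fluct x) \<in> borel_measurable (gauss idx)" using fluct_measurable by simp
  have m2: "(\<lambda>x. w * (ln (Z (rot 0 x)) - c)) \<in> borel_measurable (gauss idx)" using ln_Z_path_measurable[of 0] by simp
  have "cmod (complex_of_real (exp (- (\<beta>\<^sup>2 / 4 * base * y\<^sup>2))) * ?L - ?R) \<le>
      \<bar>Re (complex_of_real (exp (- (\<beta>\<^sup>2 / 4 * base * y\<^sup>2))) * ?L - ?R)\<bar> + \<bar>Im (complex_of_real (exp (- (\<beta>\<^sup>2 / 4 * base * y\<^sup>2))) * ?L - ?R)\<bar>"
    by (rule cmod_le)
  also have "\<dots> \<le> 2 * \<kappa> * (w\<^sup>2 + \<bar>w\<bar>) * (C / N) + 2 * \<kappa> * (w\<^sup>2 + \<bar>w\<bar>) * (C / N)"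
    unfolding iexp_eq_cos_sin[OF prob_gauss m1] iexp_eq_cos_sin[OF prob_gauss m2]
    using cosb[of 0] cosb[of "- pi / 2"] by (intro add_mono) simp_all
  also have "\<dots> = 2 * \<beta>\<^sup>2 * C * (y\<^sup>2 / N + \<bar>y\<bar> / sqrt N)"
    using N0 unfolding w2 by (simp add: \<kappa>_def w_def algebra_simps)
  finally have 1: "cmod (complex_of_real (exp (- (\<beta>\<^sup>2 / 4 * base * y\<^sup>2))) * ?L - ?R) \<le> 2 * \<beta>\<^sup>2 * C * (y\<^sup>2 / N + \<bar>y\<bar> / sqrt N)" .
  have N34: "N * (\<bar>w\<bar> ^ 3 + w ^ 4) = \<bar>y\<bar> ^ 3 / sqrt N + y ^ 4 / N"
  proof -
    have "\<bar>w\<bar> ^ 3 = \<bar>y\<bar> ^ 3 / (N * sqrt N)"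
      using sN by (simp add: w_def power_divide power3_eq_cube)
    moreover have "w ^ 4 = y ^ 4 / (N * N)"
    proof -
      have "sqrt N ^ 4 = N * N" using sN(2) by (simp add: power4_eq_xxxx mult.assoc)
      then show ?thesis by (simp add: w_def power_divide)
    qed
    ultimately show ?thesis using N0 by (simp add: field_simps)
  qed
  have "cmod (?R - complex_of_real (exp (- (w\<^sup>2 / 2 * (\<Sum>s<m. real (card {i \<in> V. sp i = s}) * lcosh_var (fv s) h)))))
    \<le> (\<Sum>s<m. lam s * (lcosh_third (fv s) h / 6 + (lcosh_var (fv s) h)\<^sup>2 / 8)) * (N * (\<bar>w\<bar> ^ 3 + w ^ 4))"
    using char_ln_Z_zero[of w] unfolding c_def by (simp add: mult_ac)
  also have "w\<^sup>2 / 2 * (\<Sum>s<m. real (card {i \<in> V. sp i = s}) * lcosh_var (fv s) h)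
      = y\<^sup>2 / 2 * (\<Sum>s<m. real (card {i \<in> V. sp i = s}) / N * lcosh_var (fv s) h)"
    unfolding w2 sum_distrib_left by (intro sum.cong refl) simp
  finally have 2: "cmod (?R - complex_of_real (exp (- (y\<^sup>2 / 2 * (\<Sum>s<m. real (card {i \<in> V. sp i = s}) / N * lcosh_var (fv s) h)))))
    \<le> (\<Sum>s<m. lam s * (lcosh_third (fv s) h / 6 + (lcosh_var (fv s) h)\<^sup>2 / 8)) * (\<bar>y\<bar> ^ 3 / sqrt N + y ^ 4 / N)"
    unfolding N34 .
  show ?thesis
    using norm_triangle_le[OF add_mono[OF 1 2]] unfolding w_def by simp
qed

lemma base_bounds: "\<bar>base - bil q q\<bar> \<le> (\<Sum>s<m. lam s * Dv s s) / N"
proof -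
  have "(\<Sum>i\<in>V. Dv (sp i) (sp i) * 1) = (\<Sum>s<m. Dv s s * (\<Sum>i\<in>{i \<in> V. sp i = s}. 1))"
    by (rule sum_by_species)
  also have "\<dots> \<le> (\<Sum>s<m. Dv s s * (lam s * N))"
    using sizes(1) Dv(1) by (intro sum_mono mult_left_mono) auto
  also have "\<dots> = (\<Sum>s<m. lam s * Dv s s) * N" by (simp add: sum_distrib_left sum_distrib_right mult_ac)
  finally have le: "(\<Sum>i\<in>V. Dv (sp i) (sp i)) \<le> (\<Sum>s<m. lam s * Dv s s) * N" by simp
  have nn: "0 \<le> (\<Sum>i\<in>V. Dv (sp i) (sp i))" using Dv(1) sp by (intro sum_nonneg) auto
  have "(\<Sum>i\<in>V. Dv (sp i) (sp i)) / N\<^sup>2 \<le> (\<Sum>s<m. lam s * Dv s s) * N / N\<^sup>2"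
    using le by (intro divide_right_mono) auto
  then show ?thesis using nn N by (simp add: base_def power2_eq_square)
qed

lemma size_ratio: "s < m \<Longrightarrow> \<bar>real (card {i \<in> V. sp i = s}) / N - lam s\<bar> \<le> 1 / N"
proof -
  assume s: "s < m"
  have "real (card {i \<in> V. sp i = s}) / N - lam s = (real (card {i \<in> V. sp i = s}) - lam s * N) / N"
    using N by (simp add: field_simps)
  also have "\<bar>\<dots>\<bar> \<le> 1 / N"
    using sizes[OF s] N by (simp add: abs_divide divide_right_mono)
  finally show ?thesis .
qed

lemma en_one:
  "en (rot (pi / 2) x) \<sigma> = \<beta> / sqrt N * (\<Sum>(i, j)\<in>pairs. sqrt (Dv (sp i) (sp j)) * x (i, j) * \<sigma> i * \<sigma> j) + h * (\<Sum>i\<in>V. \<sigma> i)"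
proof -
  have disj: "pairs \<inter> (\<lambda>i. (i, i)) ` V = {}" by (auto simp: pairs_def)
  have "(\<Sum>j\<in>idx. rate j (pi / 2) * x j * coef j \<sigma>)
      = (\<Sum>j\<in>pairs. rate j (pi / 2) * x j * coef j \<sigma>) + (\<Sum>j\<in>(\<lambda>i. (i, i)) ` V. rate j (pi / 2) * x j * coef j \<sigma>)"
    unfolding idx_def by (rule sum.union_disjoint[OF finite_idx(2) finite_imageI[OF fin_V] disj])
  also have "(\<Sum>j\<in>(\<lambda>i. (i, i)) ` V. rate j (pi / 2) * x j * coef j \<sigma>) = 0"
    using disj by (intro sum.neutral ballI) (auto simp: rate_def)
  also have "(\<Sum>j\<in>pairs. rate j (pi / 2) * x j * coef j \<sigma>)
      = \<beta> / sqrt N * (\<Sum>(i, j)\<in>pairs. sqrt (Dv (sp i) (sp j)) * x (i, j) * \<sigma> i * \<sigma> j)"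
    unfolding sum_distrib_left
  proof (intro sum.cong refl)
    fix p assume p: "p \<in> pairs"
    obtain i j where ij: "p = (i, j)" by (cases p)
    have "rate p (pi / 2) = 1" using p by (simp add: rate_def)
    then show "rate p (pi / 2) * x p * coef p \<sigma> = \<beta> / sqrt N * (case p of (i, j) \<Rightarrow> sqrt (Dv (sp i) (sp j)) * x (i, j) * \<sigma> i * \<sigma> j)"
      using p by (simp add: ij coef_def pairs_def)
  qed
  finally show ?thesis unfolding en_def ext_def by simp
qed

end

section \<open>The fixed point equation for the overlaps\<close>

definition tanh_sq_mean :: "real \<Rightarrow> real \<Rightarrow> real" where
  "tanh_sq_mean h a = (\<integral>\<eta>. (tanh (sqrt a * \<eta> + h))\<^sup>2 \<partial>std_normal_distribution)"

lemma tanh_sq_mean_bounds: "0 \<le> tanh_sq_mean h a" "tanh_sq_mean h a \<le> 1"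
proof -
  have int: "integrable std_normal_distribution (\<lambda>\<eta>. (tanh (sqrt a * \<eta> + h))\<^sup>2)"
    using tanh_sq_le_1 by (intro integrable_std_normal_bounded[of _ 1] borel_measurable_continuous_onI continuous_intros) auto
  show "0 \<le> tanh_sq_mean h a" unfolding tanh_sq_mean_def by (intro integral_nonneg_AE) auto
  have "tanh_sq_mean h a \<le> (\<integral>\<eta>. 1 \<partial>std_normal_distribution)"
    unfolding tanh_sq_mean_def using int tanh_sq_le_1 by (intro integral_mono) auto
  then show "tanh_sq_mean h a \<le> 1" using std_normal.prob_space by simp
qed

text \<open>Rotate a field of variance \<open>b\<close> into an independent one of variance \<open>a\<close>. The derivative is
  \<open>sin t * cos t * (a - b)\<close> times the mean of the second derivative of \<open>tanh\<^sup>2\<close>, which is between \<open>- 2\<close> and \<open>2\<close>.\<close>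

lemma tanh_sq_mean_lipschitz:
  assumes a: "0 \<le> a" and b: "0 \<le> b"
  shows "\<bar>tanh_sq_mean h a - tanh_sq_mean h b\<bar> \<le> 2 * \<bar>a - b\<bar>"
proof -
  define J :: "nat set" where "J = {0, 1}"
  define k where "k j = (if j = 0 then sqrt b else sqrt a)" for j :: nat
  define r where "r j t = (if j = 0 then cos t else sin t)" for j :: nat and t :: real
  define r' where "r' j t = (if j = 0 then - sin t else cos t)" for j :: nat and t :: real
  define l where "l x = k 0 * x 0 + k 1 * x 1 + h" for x :: "nat \<Rightarrow> real"
  define F where "F y = (tanh y)\<^sup>2" for y :: real
  define F1 where "F1 y = 2 * tanh y * (1 - (tanh y)\<^sup>2)" for y :: real
  define F2 where "F2 y = 2 * (1 - (tanh y)\<^sup>2) * (1 - 3 * (tanh y)\<^sup>2)" for y :: real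
  have cosh0: "cosh y \<noteq> 0" for y :: real using cosh_real_pos[of y] by simp
  have dF: "(F has_real_derivative F1 y) (at y)" for y
    unfolding F_def[abs_def] F1_def by (auto intro!: derivative_eq_intros simp: cosh0)
  have dF1: "(F1 has_real_derivative F2 y) (at y)" for y
    unfolding F1_def[abs_def] F2_def
    by (auto intro!: derivative_eq_intros simp: cosh0 power2_eq_square algebra_simps)
  have cF2: "isCont F2 y" for y unfolding F2_def[abs_def] by (intro continuous_intros cosh0)
  have bF: "\<bar>F y\<bar> \<le> 2" "\<bar>F1 y\<bar> \<le> 2" "\<bar>F2 y\<bar> \<le> 2" for y
  proof -
    define u where "u = (tanh y)\<^sup>2"
    have u: "0 \<le> u" "u \<le> 1" using tanh_sq_le_1[of y] by (auto simp: u_def)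
    show "\<bar>F y\<bar> \<le> 2" using u by (simp add: F_def u_def[symmetric])
    have "\<bar>tanh y\<bar> \<le> 1" using tanh_real_lt_1[of y] tanh_real_gt_neg1[of y] by (simp add: abs_le_iff)
    then have "\<bar>tanh y\<bar> * \<bar>1 - u\<bar> \<le> 1 * 1" using u by (intro mult_mono) auto
    then show "\<bar>F1 y\<bar> \<le> 2" by (simp add: F1_def u_def[symmetric] abs_mult)
    have "F2 y = 2 - 2 * (u * (4 - 3 * u))" by (simp add: F2_def u_def[symmetric] algebra_simps)
    moreover have "0 \<le> u * (4 - 3 * u)" using u by (intro mult_nonneg_nonneg) auto
    moreover have "u * (4 - 3 * u) \<le> 2"
    proof -
      have "2 - u * (4 - 3 * u) = 3 * (u - 2 / 3)\<^sup>2 + 2 / 3" by (simp add: power2_eq_square algebra_simps)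
      then show ?thesis using zero_le_power2[of "u - 2 / 3"] by linarith
    qed
    ultimately show "\<bar>F2 y\<bar> \<le> 2" by (simp add: abs_le_iff)
  qed
  have meas: "F \<in> borel_measurable borel" "F1 \<in> borel_measurable borel" "F2 \<in> borel_measurable borel"
    using dF dF1 cF2 DERIV_isCont by (blast intro: borel_measurable_continuous_onI continuous_at_imp_continuous_on)+
  have lm: "l \<in> borel_measurable (PiM J (\<lambda>_. borel))"
    unfolding l_def[abs_def] J_def by measurable
  have lr: "l x = l (restrict x J)" for x by (simp add: l_def J_def)
  have k0: "0 \<le> k j" for j using a b by (simp add: k_def)
  define K where "K = 2 + 2 * (k 0 + k 1) + 2 * ((k 0)\<^sup>2 + (k 1)\<^sup>2)"
  have K: "2 \<le> K" "2 * k j \<le> K" "2 * (k j)\<^sup>2 \<le> K" if "j \<in> J" for j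
    using that k0[of 0] k0[of 1] by (auto simp: K_def J_def intro!: add_nonneg_nonneg)
  have l_upd: "((\<lambda>u. l (x(j := u))) has_real_derivative k j) (at u)" if "j \<in> J" for x j u
    using that unfolding l_def J_def by (auto intro!: derivative_eq_intros)
  let ?r = "\<lambda>t x j. r j t * x j"
  have deriv: "((\<lambda>t. \<integral>x. F (l (?r t x)) \<partial>gauss J) has_real_derivative
      ((\<integral>x. 0 \<partial>gauss J) + (\<Sum>j\<in>J. r j t * r' j t * (\<integral>x. (k j)\<^sup>2 * F2 (l (?r t x)) \<partial>gauss J)))) (at t)" for t
  proof (rule gaussian_interpolation[where F = "\<lambda>t x. F (l x)" and Ft = "\<lambda>t x. 0" and Fj = "\<lambda>j t x. k j * F1 (l x)"
        and Fjj = "\<lambda>j t x. (k j)\<^sup>2 * F2 (l x)" and K = K])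
    show "finite J" by (simp add: J_def)
    show "(\<lambda>x. F (l x)) \<in> borel_measurable (PiM J (\<lambda>_. borel))"
      "(\<lambda>x. k j * F1 (l x)) \<in> borel_measurable (PiM J (\<lambda>_. borel))"
      "(\<lambda>x. (k j)\<^sup>2 * F2 (l x)) \<in> borel_measurable (PiM J (\<lambda>_. borel))" for j
      using meas lm by measurable
    show "F (l x) = F (l (restrict x J))" "k j * F1 (l x) = k j * F1 (l (restrict x J))"
      "(k j)\<^sup>2 * F2 (l x) = (k j)\<^sup>2 * F2 (l (restrict x J))" for x j
      using lr[of x] by simp_all
    show "((\<lambda>t. F (l (?r t x))) has_real_derivative 0 + (\<Sum>j\<in>J. r' j t * x j * (k j * F1 (l (?r t x))))) (at t)" for t x
    proof -
      have "((\<lambda>t. l (?r t x)) has_real_derivative k 0 * (r' 0 t * x 0) + k 1 * (r' 1 t * x 1)) (at t)"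
        unfolding l_def r_def r'_def by (auto intro!: derivative_eq_intros)
      from DERIV_chain2[OF dF this] show ?thesis
        by (rule DERIV_cong) (simp add: J_def algebra_simps)
    qed
    show "((\<lambda>u. k j * F1 (l (x(j := u)))) has_real_derivative (k j)\<^sup>2 * F2 (l (x(j := u)))) (at u)" if "j \<in> J" for j x u
      by (rule DERIV_cong[OF DERIV_cmult[OF DERIV_chain2[OF dF1 l_upd[OF that]]]]) (simp add: power2_eq_square)
    show "isCont (\<lambda>u. (k j)\<^sup>2 * F2 (l (x(j := u)))) u" if "j \<in> J" for j x u
      using l_upd[OF that] DERIV_isCont by (intro continuous_intros isCont_o2[OF _ cF2]) blast
    show "\<bar>F (l x)\<bar> \<le> K * (1 + (\<Sum>j\<in>J. \<bar>x j\<bar>))" for x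
    proof -
      have "\<bar>F (l x)\<bar> \<le> K * 1" using bF(1)[of "l x"] K(1)[of 0] by (simp add: J_def)
      also have "\<dots> \<le> K * (1 + (\<Sum>j\<in>J. \<bar>x j\<bar>))"
        using K(1)[of 0] by (intro mult_left_mono) (auto simp: J_def)
      finally show ?thesis .
    qed
    show "\<bar>0::real\<bar> \<le> K" using K(1)[of 0] by (simp add: J_def)
    show "\<bar>k j * F1 (l x)\<bar> \<le> K" if "j \<in> J" for j x
      using mult_left_mono[OF bF(2)[of "l x"] k0[of j]] K(2)[OF that] k0[of j] by (simp add: abs_mult)
    show "\<bar>(k j)\<^sup>2 * F2 (l x)\<bar> \<le> K" if "j \<in> J" for j x
      using mult_left_mono[OF bF(3)[of "l x"], of "(k j)\<^sup>2"] K(3)[OF that] by (simp add: abs_mult)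
    show "\<bar>r j t\<bar> \<le> 1" "\<bar>r' j t\<bar> \<le> 1" for j t by (auto simp: r_def r'_def)
  qed auto
  interpret G: prob_space "gauss J" by (rule prob_gauss)
  have intF2: "integrable (gauss J) (\<lambda>x. F2 (l (?r t x)))" for t
  proof (rule G.integrable_const_bound[of _ 2])
    have "(\<lambda>x. F2 (l (restrict (?r t x) J))) \<in> borel_measurable (gauss J)" using meas lm by measurable
    then show "(\<lambda>x. F2 (l (?r t x))) \<in> borel_measurable (gauss J)" by (subst (asm) lr[symmetric])
  qed (use bF in auto)
  have EF2: "\<bar>\<integral>x. F2 (l (?r t x)) \<partial>gauss J\<bar> \<le> 2" for t
  proof -
    have "\<bar>\<integral>x. F2 (l (?r t x)) \<partial>gauss J\<bar> \<le> (\<integral>x. 2 \<partial>gauss J)"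
      by (rule order_trans[OF integral_abs_bound integral_mono]) (use intF2 bF in auto)
    then show ?thesis by (simp add: G.prob_space)
  qed
  have sc: "\<bar>sin t * cos t\<bar> \<le> 1 / 2" for t :: real
    using abs_sin_le_one[of "2 * t"] by (simp add: sin_double abs_mult)
  have comp: "(\<integral>x. F (c * x j + h) \<partial>gauss J) = (\<integral>\<eta>. F (c * \<eta> + h) \<partial>std_normal_distribution)" if "j \<in> J" for j c
  proof -
    have "(\<integral>\<eta>. F (c * \<eta> + h) \<partial>distr (gauss J) std_normal_distribution (\<lambda>x. x j)) = (\<integral>x. F (c * x j + h) \<partial>gauss J)"
      using that meas by (intro integral_distr) auto
    moreover have "distr (gauss J) std_normal_distribution (\<lambda>x. x j) = std_normal_distribution"
      by (intro distr_PiM_component prob_std_normal that)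
    ultimately show ?thesis by simp
  qed
  have e0: "(\<integral>x. F (l (?r 0 x)) \<partial>gauss J) = tanh_sq_mean h b"
    using comp[of 0 "sqrt b"] by (simp add: l_def r_def k_def F_def tanh_sq_mean_def J_def)
  have e1: "(\<integral>x. F (l (?r (pi / 2) x)) \<partial>gauss J) = tanh_sq_mean h a"
    using comp[of 1 "sqrt a"] by (simp add: l_def r_def k_def F_def tanh_sq_mean_def J_def)
  have "\<bar>(\<integral>x. F (l (?r (pi / 2) x)) \<partial>gauss J) - (\<integral>x. F (l (?r 0 x)) \<partial>gauss J)\<bar> \<le> \<bar>a - b\<bar> * (pi / 2 - 0)"
  proof (rule abs_diff_le_of_deriv[OF deriv])
    fix t :: real
    have "(\<integral>x. 0 \<partial>gauss J) + (\<Sum>j\<in>J. r j t * r' j t * (\<integral>x. (k j)\<^sup>2 * F2 (l (?r t x)) \<partial>gauss J))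
        = sin t * cos t * (a - b) * (\<integral>x. F2 (l (?r t x)) \<partial>gauss J)"
      using a b by (simp add: J_def r_def r'_def k_def algebra_simps)
    also have "\<bar>\<dots>\<bar> \<le> (1 / 2 * \<bar>a - b\<bar>) * 2"
      unfolding abs_mult[of "sin t * cos t * (a - b)"] abs_mult[of "sin t * cos t" "a - b"]
      by (intro mult_mono sc EF2) auto
    finally show "\<bar>(\<integral>x. 0 \<partial>gauss J) + (\<Sum>j\<in>J. r j t * r' j t * (\<integral>x. (k j)\<^sup>2 * F2 (l (?r t x)) \<partial>gauss J))\<bar> \<le> \<bar>a - b\<bar>"
      by simp
  qed auto
  also have "\<dots> \<le> \<bar>a - b\<bar> * 2" using pi_less_4 by (intro mult_left_mono) auto
  finally show ?thesis unfolding e0 e1 by simp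
qed

abbreviation wform :: "nat \<Rightarrow> (nat \<Rightarrow> real) \<Rightarrow> (nat \<Rightarrow> nat \<Rightarrow> real) \<Rightarrow> (nat \<Rightarrow> real) \<Rightarrow> real" where
  "wform m lam A x \<equiv> (\<Sum>s<m. \<Sum>t<m. lam s * lam t * A s t * (x s * x t))"

text \<open>Polarisation: a bound for a symmetric form on the diagonal bounds the operator that represents it in the weighted
  inner product. The vector \<open>z\<close> is the image of \<open>y\<close>, compared with \<open>\<rho> * y\<close>.\<close>

lemma symmetric_form_operator_bound:
  fixes A :: "nat \<Rightarrow> nat \<Rightarrow> real" and lam y :: "nat \<Rightarrow> real"
  assumes sym: "\<And>s t. s < m \<Longrightarrow> t < m \<Longrightarrow> A s t = A t s"
    and form: "\<And>x. \<bar>wform m lam A x\<bar> \<le> \<rho> * (\<Sum>s<m. lam s * (x s)\<^sup>2)"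
    and \<rho>: "0 < \<rho>"
  shows "(\<Sum>s<m. lam s * (\<Sum>t<m. A s t * lam t * y t)\<^sup>2) \<le> \<rho>\<^sup>2 * (\<Sum>s<m. lam s * (y s)\<^sup>2)"
proof -
  define z where "z s = (\<Sum>t<m. A s t * lam t * y t)" for s
  define B where "B x x' = (\<Sum>s<m. \<Sum>t<m. lam s * lam t * A s t * (x s * x' t))" for x x' :: "nat \<Rightarrow> real"
  define n where "n x = (\<Sum>s<m. lam s * (x s)\<^sup>2)" for x :: "nat \<Rightarrow> real"
  have Bzy: "B z y = n z"
    unfolding B_def n_def z_def power2_eq_square sum_distrib_left by (intro sum.cong refl) (simp add: sum_distrib_left sum_distrib_right mult_ac)
  have Bsym: "B y z = B z y"
    unfolding B_def by (subst sum.swap) (intro sum.cong refl, simp add: sym mult_ac)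
  have pol: "B (\<lambda>s. z s + \<rho> * y s) (\<lambda>s. z s + \<rho> * y s) - B (\<lambda>s. z s - \<rho> * y s) (\<lambda>s. z s - \<rho> * y s) = 2 * \<rho> * (B z y + B y z)"
    unfolding B_def sum_distrib_left sum.distrib[symmetric] sum_subtractf[symmetric]
    by (intro sum.cong refl) (simp add: algebra_simps)
  have par: "n (\<lambda>s. z s + \<rho> * y s) + n (\<lambda>s. z s - \<rho> * y s) = 2 * n z + 2 * \<rho>\<^sup>2 * n y"
    unfolding n_def sum_distrib_left sum.distrib[symmetric]
    by (intro sum.cong refl) (simp add: power2_eq_square algebra_simps)
  \<comment> \<open>\<open>B z y = n z\<close> by the choice of \<open>z\<close>, so the polarisation identity computes \<open>n z\<close>.\<close>
  have "4 * \<rho> * n z = B (\<lambda>s. z s + \<rho> * y s) (\<lambda>s. z s + \<rho> * y s) - B (\<lambda>s. z s - \<rho> * y s) (\<lambda>s. z s - \<rho> * y s)"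
    unfolding pol Bsym Bzy by simp
  also have "\<dots> \<le> \<rho> * n (\<lambda>s. z s + \<rho> * y s) + \<rho> * n (\<lambda>s. z s - \<rho> * y s)"
    using form[of "\<lambda>s. z s + \<rho> * y s"] form[of "\<lambda>s. z s - \<rho> * y s"] unfolding B_def n_def by linarith
  also have "\<dots> = \<rho> * (2 * n z + 2 * \<rho>\<^sup>2 * n y)" unfolding par[symmetric] by (simp add: algebra_simps)
  finally have "\<rho> * (4 * n z) \<le> \<rho> * (2 * n z + 2 * \<rho>\<^sup>2 * n y)" by (simp add: algebra_simps)
  then have "4 * n z \<le> 2 * n z + 2 * \<rho>\<^sup>2 * n y" using \<rho> by (simp only: mult_le_cancel_left_pos)
  then show ?thesis unfolding n_def z_def by simp
qed

text \<open>By the Lipschitz bound and the operator bound, the map contracts the weighted norm by \<open>2 \<beta>\<^sup>2 \<rho> < 1 / 2\<close>. Points of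
  \<open>nat \<Rightarrow> real\<close> that agree below \<open>m\<close> are identified, so that uniqueness is stated for these coordinates.\<close>

theorem unique_species_fixed_point:
  fixes A :: "nat \<Rightarrow> nat \<Rightarrow> real" and lam :: "nat \<Rightarrow> real" and \<beta> h :: real
  assumes lam: "\<And>s. s < m \<Longrightarrow> 0 < lam s" and A: "\<And>s t. s < m \<Longrightarrow> t < m \<Longrightarrow> 0 \<le> A s t"
    and sym: "\<And>s t. s < m \<Longrightarrow> t < m \<Longrightarrow> A s t = A t s"
    and form: "\<And>x. \<bar>wform m lam A x\<bar> \<le> \<rho> * (\<Sum>s<m. lam s * (x s)\<^sup>2)"
    and \<rho>: "0 < \<rho>" and small: "4 * \<beta>\<^sup>2 * \<rho> < 1"
  defines "T \<equiv> \<lambda>q s. tanh_sq_mean h (\<beta>\<^sup>2 * (\<Sum>t<m. A s t * lam t * q t))"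
  shows "\<exists>q. (\<forall>s<m. 0 \<le> q s \<and> q s \<le> 1 \<and> q s = T q s) \<and>
    (\<forall>q'. (\<forall>s<m. 0 \<le> q' s \<and> q' s \<le> 1 \<and> q' s = T q' s) \<longrightarrow> (\<forall>s<m. q' s = q s))"
proof -
  define n where "n x = (\<Sum>s<m. lam s * (x s)\<^sup>2)" for x :: "nat \<Rightarrow> real"
  define c where "c = (2 * \<beta>\<^sup>2 * \<rho>)\<^sup>2"
  have c: "0 \<le> c" "sqrt c < 1" "c < 1"
  proof -
    have "0 \<le> 2 * \<beta>\<^sup>2 * \<rho>" "2 * \<beta>\<^sup>2 * \<rho> < 1" using \<rho> small by auto
    then show "0 \<le> c" "sqrt c < 1" "c < 1" by (auto simp: c_def abs_square_less_1)
  qed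
  have n0: "0 \<le> n x" for x unfolding n_def using lam by (intro sum_nonneg mult_nonneg_nonneg) (auto simp: less_imp_le)
  have arg0: "0 \<le> \<beta>\<^sup>2 * (\<Sum>t<m. A s t * lam t * q t)" if "s < m" "\<forall>t<m. 0 \<le> q t" for s q
    using that A lam by (intro mult_nonneg_nonneg sum_nonneg) (auto simp: less_imp_le)
  \<comment> \<open>The constant is the square of the contraction factor because \<open>n\<close> is a squared norm.\<close>
  have contr: "n (\<lambda>s. T q s - T q' s) \<le> c * n (\<lambda>s. q s - q' s)"
    if nn: "\<forall>t<m. 0 \<le> q t" "\<forall>t<m. 0 \<le> q' t" for q q'
  proof -
    have "n (\<lambda>s. T q s - T q' s) \<le> (\<Sum>s<m. lam s * (4 * \<beta>\<^sup>2 * \<beta>\<^sup>2 * (\<Sum>t<m. A s t * lam t * (q t - q' t))\<^sup>2))"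
      unfolding n_def
    proof (intro sum_mono mult_left_mono)
      fix s assume "s \<in> {..<m}"
      then have s: "s < m" by simp
      have "\<bar>T q s - T q' s\<bar> \<le> 2 * \<bar>\<beta>\<^sup>2 * (\<Sum>t<m. A s t * lam t * q t) - \<beta>\<^sup>2 * (\<Sum>t<m. A s t * lam t * q' t)\<bar>"
        unfolding T_def by (intro tanh_sq_mean_lipschitz arg0 s nn)
      also have "\<beta>\<^sup>2 * (\<Sum>t<m. A s t * lam t * q t) - \<beta>\<^sup>2 * (\<Sum>t<m. A s t * lam t * q' t)
          = \<beta>\<^sup>2 * (\<Sum>t<m. A s t * lam t * (q t - q' t))"
        by (simp add: right_diff_distrib sum_subtractf)
      finally have "\<bar>T q s - T q' s\<bar> \<le> \<bar>2 * (\<beta>\<^sup>2 * (\<Sum>t<m. A s t * lam t * (q t - q' t)))\<bar>" by simp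
      then have "(T q s - T q' s)\<^sup>2 \<le> (2 * (\<beta>\<^sup>2 * (\<Sum>t<m. A s t * lam t * (q t - q' t))))\<^sup>2"
        by (simp only: abs_le_square_iff)
      then show "(T q s - T q' s)\<^sup>2 \<le> 4 * \<beta>\<^sup>2 * \<beta>\<^sup>2 * (\<Sum>t<m. A s t * lam t * (q t - q' t))\<^sup>2"
        by (simp add: power2_eq_square mult_ac)
      show "0 \<le> lam s" using lam[OF s] by simp
    qed
    also have "\<dots> = 4 * \<beta>\<^sup>2 * \<beta>\<^sup>2 * (\<Sum>s<m. lam s * (\<Sum>t<m. A s t * lam t * (q t - q' t))\<^sup>2)"
      by (simp add: sum_distrib_left mult_ac)
    also have "\<dots> \<le> 4 * \<beta>\<^sup>2 * \<beta>\<^sup>2 * (\<rho>\<^sup>2 * n (\<lambda>s. q s - q' s))"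
      unfolding n_def by (intro mult_left_mono symmetric_form_operator_bound sym form \<rho>) auto
    also have "\<dots> = c * n (\<lambda>s. q s - q' s)" by (simp add: c_def power2_eq_square)
    finally show ?thesis .
  qed
  define x where "x k = (T ^^ k) (\<lambda>_. 0)" for k
  have x0: "x 0 = (\<lambda>_. 0)" and xS: "x (Suc k) = T (x k)" for k by (simp_all add: x_def)
  have T01: "0 \<le> T q s" "T q s \<le> 1" for q s unfolding T_def by (rule tanh_sq_mean_bounds)+
  have x01: "0 \<le> x k s" "x k s \<le> 1" for k s by (cases k; simp add: x0 xS T01)+
  define e where "e = n (\<lambda>s. x 1 s - x 0 s)"
  have en: "n (\<lambda>s. x (Suc k) s - x k s) \<le> c ^ k * e" for k
  proof (induction k)
    case (Suc k)
    have "n (\<lambda>s. x (Suc (Suc k)) s - x (Suc k) s) \<le> c * n (\<lambda>s. x (Suc k) s - x k s)"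
      unfolding xS by (rule contr) (auto simp: x01 T01)
    also have "\<dots> \<le> c * (c ^ k * e)" by (intro mult_left_mono Suc c)
    finally show ?case by (simp add: mult.assoc)
  qed (simp add: e_def)
  have conv: "convergent (\<lambda>k. x k s)" if s: "s < m" for s
  proof -
    have step: "norm (x (Suc k) s - x k s) \<le> sqrt (e / lam s) * sqrt c ^ k" for k
    proof -
      have "lam s * (x (Suc k) s - x k s)\<^sup>2 \<le> n (\<lambda>s. x (Suc k) s - x k s)"
        unfolding n_def using s lam by (intro member_le_sum) (auto simp: less_imp_le)
      also have "\<dots> \<le> c ^ k * e" by (rule en)
      finally have "(x (Suc k) s - x k s)\<^sup>2 \<le> e / lam s * c ^ k" using lam[OF s] by (simp add: field_simps)
      then have "sqrt ((x (Suc k) s - x k s)\<^sup>2) \<le> sqrt (e / lam s * c ^ k)" by (rule real_sqrt_le_mono)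
      then have "\<bar>x (Suc k) s - x k s\<bar> \<le> sqrt (e / lam s * c ^ k)" by (simp only: real_sqrt_abs)
      then show ?thesis by (simp only: real_sqrt_mult real_sqrt_power real_norm_def)
    qed
    have "summable (\<lambda>k. sqrt (e / lam s) * sqrt c ^ k)"
      using c by (intro summable_mult summable_geometric) auto
    then have "summable (\<lambda>k. x (Suc k) s - x k s)"
      by (rule summable_comparison_test'[where N = 0]) (rule step)
    then have "convergent (\<lambda>k. \<Sum>i<k. x (Suc i) s - x i s)" using summable_iff_convergent by blast
    moreover have "(\<Sum>i<k. x (Suc i) s - x i s) = x k s" for k
      using sum_lessThan_telescope[of "\<lambda>k. x k s" k] by (simp add: x0)
    ultimately show ?thesis by simp
  qed
  define q where "q s = lim (\<lambda>k. x k s)" for s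
  have xq: "(\<lambda>k. x k s) \<longlonglongrightarrow> q s" if "s < m" for s
    using conv[OF that] unfolding q_def convergent_LIMSEQ_iff .
  have q01: "0 \<le> q s" "q s \<le> 1" if "s < m" for s
    using LIMSEQ_le_const[OF xq[OF that], of 0] LIMSEQ_le_const2[OF xq[OF that], of 1] x01 by blast+
  have fix_q: "q s = T q s" if s: "s < m" for s
  proof -
    have "(\<lambda>k. 2 * \<bar>\<beta>\<^sup>2 * (\<Sum>t<m. A s t * lam t * x k t) - \<beta>\<^sup>2 * (\<Sum>t<m. A s t * lam t * q t)\<bar>)
        \<longlonglongrightarrow> 2 * \<bar>\<beta>\<^sup>2 * (\<Sum>t<m. A s t * lam t * q t) - \<beta>\<^sup>2 * (\<Sum>t<m. A s t * lam t * q t)\<bar>"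
      by (intro tendsto_intros xq) auto
    then have lim0: "(\<lambda>k. 2 * \<bar>\<beta>\<^sup>2 * (\<Sum>t<m. A s t * lam t * x k t) - \<beta>\<^sup>2 * (\<Sum>t<m. A s t * lam t * q t)\<bar>) \<longlonglongrightarrow> 0" by simp
    have "(\<lambda>k. T (x k) s - T q s) \<longlonglongrightarrow> 0"
    proof (rule Lim_null_comparison[OF _ lim0])
      show "\<forall>\<^sub>F k in sequentially. norm (T (x k) s - T q s)
         \<le> 2 * \<bar>\<beta>\<^sup>2 * (\<Sum>t<m. A s t * lam t * x k t) - \<beta>\<^sup>2 * (\<Sum>t<m. A s t * lam t * q t)\<bar>"
        unfolding T_def real_norm_def
        by (intro always_eventually allI tanh_sq_mean_lipschitz arg0 s) (auto simp: x01 q01)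
    qed
    then have "(\<lambda>k. x (Suc k) s) \<longlonglongrightarrow> T q s" unfolding xS by (simp add: LIM_zero_iff)
    moreover have "(\<lambda>k. x (Suc k) s) \<longlonglongrightarrow> q s" using xq[OF s] by (rule LIMSEQ_Suc)
    ultimately show ?thesis by (rule LIMSEQ_unique[symmetric])
  qed
  have uniq: "q' s = q s" if q': "\<forall>s<m. 0 \<le> q' s \<and> q' s \<le> 1 \<and> q' s = T q' s" and s: "s < m" for q' s
  proof -
    have "n (\<lambda>s. q' s - q s) = n (\<lambda>s. T q' s - T q s)"
      unfolding n_def using q' fix_q by (intro sum.cong refl) (metis lessThan_iff)
    also have "\<dots> \<le> c * n (\<lambda>s. q' s - q s)" using q' q01 by (intro contr) auto
    finally have "(1 - c) * n (\<lambda>s. q' s - q s) \<le> 0" by (simp add: algebra_simps)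
    then have "n (\<lambda>s. q' s - q s) \<le> 0" using c by (simp add: mult_le_0_iff)
    moreover have "lam s * (q' s - q s)\<^sup>2 \<le> n (\<lambda>s. q' s - q s)"
      unfolding n_def using s lam by (intro member_le_sum) (auto simp: less_imp_le)
    ultimately have "lam s * (q' s - q s)\<^sup>2 \<le> lam s * 0" by linarith
    then have "(q' s - q s)\<^sup>2 \<le> 0" using lam[OF s] by (simp only: mult_le_cancel_left_pos)
    then show ?thesis by simp
  qed
  show ?thesis using q01 fix_q uniq by (intro exI[of _ q]) blast
qed

section \<open>The quadratic form and the spectral radius\<close>

lemma quadratic_nonneg_imp_linear_zero:
  fixes a b :: real
  assumes "\<And>e. 0 \<le> 2 * e * a + e\<^sup>2 * b"
  shows "a = 0"
proof (rule ccontr)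
  assume a: "a \<noteq> 0"
  define k where "k = \<bar>b\<bar> + 1"
  have k: "0 < k" "b \<le> k" by (auto simp: k_def)
  have "0 \<le> 2 * (- a / k) * a + (- a / k)\<^sup>2 * b" by (rule assms)
  also have "\<dots> \<le> 2 * (- a / k) * a + (- a / k)\<^sup>2 * k" using k by (intro add_left_mono mult_left_mono) auto
  also have "\<dots> = - (a\<^sup>2 / k)" using k by (simp add: power2_eq_square)
  finally show False using a k by (simp add: divide_le_0_iff zero_le_divide_iff)
qed

text \<open>Outside \<open>{..<m}\<close> the coordinates are fixed to zero, which makes the sphere a closed part of a product of compact intervals.\<close>

lemma compact_weighted_sphere:
  fixes lam :: "nat \<Rightarrow> real"
  assumes lam: "\<And>s. s < m \<Longrightarrow> 0 < lam s"
  shows "compact {x :: nat \<Rightarrow> real. (\<forall>s\<ge>m. x s = 0) \<and> (\<Sum>s<m. lam s * (x s)\<^sup>2) = 1}"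
proof -
  define I where "I s = (if s < m then {- (1 / sqrt (lam s)) .. 1 / sqrt (lam s)} else {0 :: real})" for s
  have "compactin (product_topology (\<lambda>_. euclidean) UNIV) (PiE UNIV I)"
    by (subst compactin_PiE) (auto simp: I_def)
  then have cB: "compact (PiE UNIV I)" by (simp add: euclidean_product_topology)
  have "continuous_on UNIV (\<lambda>x :: nat \<Rightarrow> real. \<Sum>s<m. lam s * (x s)\<^sup>2)"
    by (intro continuous_intros continuous_on_product_coordinates)
  then have cl: "closed {x :: nat \<Rightarrow> real. (\<Sum>s<m. lam s * (x s)\<^sup>2) = 1}"
    by (intro closed_Collect_eq) auto
  have "{x :: nat \<Rightarrow> real. (\<forall>s\<ge>m. x s = 0) \<and> (\<Sum>s<m. lam s * (x s)\<^sup>2) = 1}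
      = PiE UNIV I \<inter> {x. (\<Sum>s<m. lam s * (x s)\<^sup>2) = 1}"
  proof (intro equalityI subsetI IntI)
    fix x :: "nat \<Rightarrow> real" assume x: "x \<in> {x. (\<forall>s\<ge>m. x s = 0) \<and> (\<Sum>s<m. lam s * (x s)\<^sup>2) = 1}"
    show "x \<in> PiE UNIV I"
    proof (rule PiE_I)
      fix s
      show "x s \<in> I s"
      proof (cases "s < m")
        case True
        have "lam s * (x s)\<^sup>2 \<le> (\<Sum>s<m. lam s * (x s)\<^sup>2)"
          using True lam by (intro member_le_sum) (auto simp: less_imp_le)
        then have "(x s)\<^sup>2 \<le> 1 / lam s" using x lam[OF True] by (simp add: field_simps)
        then have "sqrt ((x s)\<^sup>2) \<le> sqrt (1 / lam s)" by (rule real_sqrt_le_mono)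
        then have "\<bar>x s\<bar> \<le> 1 / sqrt (lam s)" by (simp only: real_sqrt_abs real_sqrt_divide real_sqrt_one)
        then show ?thesis using True by (auto simp: I_def abs_le_iff)
      next
        case False
        then show ?thesis using x by (simp add: I_def)
      qed
    qed auto
    show "x \<in> {x. (\<Sum>s<m. lam s * (x s)\<^sup>2) = 1}" using x by simp
  next
    fix x assume x: "x \<in> PiE UNIV I \<inter> {x. (\<Sum>s<m. lam s * (x s)\<^sup>2) = 1}"
    have "x s = 0" if "m \<le> s" for s
      using x PiE_mem[of x UNIV I s] that by (auto simp: I_def)
    then show "x \<in> {x. (\<forall>s\<ge>m. x s = 0) \<and> (\<Sum>s<m. lam s * (x s)\<^sup>2) = 1}" using x by simp
  qed
  then show ?thesis using cB cl by (simp add: compact_Int_closed)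
qed

text \<open>A maximiser \<open>v\<close> of the form on the weighted unit sphere is a zero of the nonnegative form
  \<open>\<mu> * \<Sum> lam s * (x s)\<^sup>2 - form\<close>, hence a critical point, and the vanishing of the derivative is the eigenvalue equation.\<close>

lemma maximal_rayleigh_eigenvector:
  fixes lam :: "nat \<Rightarrow> real" and A :: "nat \<Rightarrow> nat \<Rightarrow> real"
  assumes m: "m > 0" and lam: "\<And>s. s < m \<Longrightarrow> 0 < lam s"
    and sym: "\<And>s t. s < m \<Longrightarrow> t < m \<Longrightarrow> A s t = A t s"
  shows "\<exists>\<mu> v. (\<exists>s<m. v s \<noteq> 0) \<and> (\<forall>s<m. (\<Sum>t<m. A s t * lam t * v t) = \<mu> * v s) \<and>
    (\<forall>x. wform m lam A x \<le> \<mu> * (\<Sum>s<m. lam s * (x s)\<^sup>2))"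
proof -
  define B where "B x y = (\<Sum>s<m. \<Sum>t<m. lam s * lam t * A s t * (x s * y t))" for x y :: "nat \<Rightarrow> real"
  define ip where "ip x y = (\<Sum>s<m. lam s * (x s * y s))" for x y :: "nat \<Rightarrow> real"
  have ip_sq: "(\<Sum>s<m. lam s * (x s)\<^sup>2) = ip x x" for x by (simp add: ip_def power2_eq_square)
  define K where "K = {x :: nat \<Rightarrow> real. (\<forall>s\<ge>m. x s = 0) \<and> (\<Sum>s<m. lam s * (x s)\<^sup>2) = 1}"
  have compact: "compact K" unfolding K_def by (rule compact_weighted_sphere[OF lam])
  have "(\<lambda>s. if s = 0 then 1 / sqrt (lam 0) else 0) \<in> K"
  proof -
    have "(\<Sum>s<m. lam s * (if s = 0 then 1 / sqrt (lam 0) else 0)\<^sup>2) = (\<Sum>s<m. if s = 0 then 1 else 0)"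
      using lam[OF m] by (intro sum.cong refl) (auto simp: power_divide)
    then show ?thesis using m by (simp add: K_def)
  qed
  then have ne: "K \<noteq> {}" by blast
  have "continuous_on K (\<lambda>x. B x x)"
    unfolding B_def by (intro continuous_intros continuous_on_subset[OF continuous_on_product_coordinates]) auto
  from continuous_attains_sup[OF compact ne this]
  obtain v where v: "v \<in> K" and max: "\<forall>y\<in>K. B y y \<le> B v v" ..
  define \<mu> where "\<mu> = B v v"
  have ipv: "ip v v = 1" using v by (simp add: K_def ip_sq)
  have le: "B x x \<le> \<mu> * ip x x" for x
  proof (cases "ip x x = 0")
    case True
    have "x s = 0" if "s < m" for s
    proof -
      have "\<forall>s\<in>{..<m}. lam s * (x s)\<^sup>2 = 0"
        using True lam unfolding ip_sq[symmetric] by (subst (asm) sum_nonneg_eq_0_iff) (auto simp: less_imp_le)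
      then have "lam s * (x s)\<^sup>2 = 0" using that by blast
      then show ?thesis using lam[OF that] by simp
    qed
    then have "B x x = 0" by (simp add: B_def)
    then show ?thesis using True by simp
  next
    case False
    moreover have "0 \<le> ip x x" unfolding ip_sq[symmetric] using lam by (intro sum_nonneg) (auto simp: less_imp_le)
    ultimately have pos: "0 < ip x x" by simp
    define k where "k = 1 / sqrt (ip x x)"
    have k2: "k * k = 1 / ip x x" using pos by (simp add: k_def)
    define y where "y s = (if s < m then k * x s else 0)" for s
    have "ip y y = k * k * ip x x" unfolding ip_def sum_distrib_left by (intro sum.cong refl) (simp add: y_def)
    then have "y \<in> K" using k2 pos by (simp add: K_def ip_sq y_def)
    moreover have "B y y = k * k * B x x"
      unfolding B_def sum_distrib_left by (intro sum.cong refl) (simp add: y_def)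
    ultimately have "B x x / ip x x \<le> \<mu>" using max by (auto simp: k2 \<mu>_def dest!: bspec[where x = y])
    then show ?thesis using pos by (simp add: field_simps)
  qed
  \<comment> \<open>First order condition at the maximiser in the direction \<open>y\<close>.\<close>
  have lin: "\<mu> * ip v y = B v y" for y
  proof -
    have Bsym: "B y v = B v y" unfolding B_def by (subst sum.swap) (intro sum.cong refl, simp add: sym mult_ac)
    have "0 \<le> 2 * e * (\<mu> * ip v y - B v y) + e\<^sup>2 * (\<mu> * ip y y - B y y)" for e
    proof -
      have "ip (\<lambda>s. v s + e * y s) (\<lambda>s. v s + e * y s) = ip v v + 2 * e * ip v y + e\<^sup>2 * ip y y"
        unfolding ip_def sum_distrib_left sum.distrib[symmetric]
        by (intro sum.cong refl) (simp add: algebra_simps power2_eq_square)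
      moreover have "B (\<lambda>s. v s + e * y s) (\<lambda>s. v s + e * y s) = B v v + e * (B v y + B y v) + e\<^sup>2 * B y y"
        unfolding B_def sum_distrib_left sum.distrib[symmetric]
        by (intro sum.cong refl) (simp add: algebra_simps power2_eq_square)
      ultimately show ?thesis
        using le[of "\<lambda>s. v s + e * y s"] by (simp add: Bsym ipv \<mu>_def[symmetric] algebra_simps)
    qed
    then have "\<mu> * ip v y - B v y = 0" by (rule quadratic_nonneg_imp_linear_zero)
    then show ?thesis by simp
  qed
  show ?thesis
  proof (intro exI[of _ \<mu>] exI[of _ v] conjI allI impI)
    show "\<exists>s<m. v s \<noteq> 0"
    proof (rule ccontr)
      assume "\<not> (\<exists>s<m. v s \<noteq> 0)"
      then have "ip v v = 0" by (simp add: ip_def)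
      then show False using ipv by simp
    qed
    show "wform m lam A x \<le> \<mu> * (\<Sum>s<m. lam s * (x s)\<^sup>2)" for x
      using le[of x] by (simp add: B_def ip_sq)
    show "(\<Sum>t<m. A s t * lam t * v t) = \<mu> * v s" if s: "s < m" for s
    proof -
      define d where "d r = (if r = s then 1 else 0 :: real)" for r
      have "ip v d = (\<Sum>r<m. if r = s then lam r * v r else 0)" unfolding ip_def d_def by (intro sum.cong refl) auto
      then have 1: "ip v d = lam s * v s" using s by simp
      have "B v d = (\<Sum>r<m. \<Sum>t<m. if t = s then lam r * lam s * A r s * v r else 0)"
        unfolding B_def d_def by (intro sum.cong refl) auto
      also have "\<dots> = (\<Sum>r<m. lam r * lam s * A r s * v r)" using s by simp
      also have "\<dots> = lam s * (\<Sum>t<m. A s t * lam t * v t)"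
        unfolding sum_distrib_left using s by (intro sum.cong refl) (simp add: sym)
      finally have "lam s * (\<mu> * v s) = lam s * (\<Sum>t<m. A s t * lam t * v t)" using lin[of d] 1 by (simp add: mult_ac)
      then show ?thesis using lam[OF s] by simp
    qed
  qed
qed

lemma symmetric_mat_entry:
  assumes "D \<in> carrier_mat m m" "transpose_mat D = D" "s < m" "t < m"
  shows "D $$ (s, t) = D $$ (t, s)"
proof -
  have "D $$ (s, t) = transpose_mat D $$ (s, t)" by (simp only: assms(2))
  also have "\<dots> = D $$ (t, s)" using assms(1,3,4) by auto
  finally show ?thesis .
qed

text \<open>Apply the maximal Rayleigh quotient to the form and to its negative.\<close>

theorem form_le_spectral_radius:
  fixes D :: "real mat" and lam :: "nat \<Rightarrow> real"
  assumes m: "m > 0" and D: "D \<in> carrier_mat m m" and sym: "transpose_mat D = D"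
    and lam: "\<And>s. s < m \<Longrightarrow> 0 < lam s"
  shows "\<bar>\<Sum>s<m. \<Sum>t<m. lam s * lam t * D $$ (s, t) * (x s * x t)\<bar>
    \<le> spectral_radius (map_mat complex_of_real (D * mat_diag m lam)) * (\<Sum>s<m. lam s * (x s)\<^sup>2)"
proof -
  let ?C = "map_mat complex_of_real (D * mat_diag m lam)"
  let ?\<rho> = "spectral_radius ?C"
  have C: "?C \<in> carrier_mat m m" using D by (simp add: mat_diag_mult_right)
  have Dsym: "D $$ (s, t) = D $$ (t, s)" if "s < m" "t < m" for s t
  by (rule symmetric_mat_entry[OF D sym that])
  have Q: "(\<Sum>s<m. \<Sum>t<m. lam s * lam t * (\<epsilon> * D $$ (s, t)) * (x s * x t)) \<le> ?\<rho> * (\<Sum>s<m. lam s * (x s)\<^sup>2)"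
    if \<epsilon>: "\<epsilon> = 1 \<or> \<epsilon> = - 1" for \<epsilon> :: real
  proof -
    have "\<exists>\<mu> v. (\<exists>s<m. v s \<noteq> 0) \<and> (\<forall>s<m. (\<Sum>t<m. \<epsilon> * D $$ (s, t) * lam t * v t) = \<mu> * v s) \<and>
      (\<forall>x. (\<Sum>s<m. \<Sum>t<m. lam s * lam t * (\<epsilon> * D $$ (s, t)) * (x s * x t)) \<le> \<mu> * (\<Sum>s<m. lam s * (x s)\<^sup>2))"
      by (rule maximal_rayleigh_eigenvector[where lam = lam and A = "\<lambda>s t. \<epsilon> * D $$ (s, t)"])
        (simp_all add: m lam Dsym)
    then obtain \<mu> v where v0: "(\<exists>s<m. v s \<noteq> 0) \<and> (\<forall>s<m. (\<Sum>t<m. \<epsilon> * D $$ (s, t) * lam t * v t) = \<mu> * v s) \<and>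
      (\<forall>x. (\<Sum>s<m. \<Sum>t<m. lam s * lam t * (\<epsilon> * D $$ (s, t)) * (x s * x t)) \<le> \<mu> * (\<Sum>s<m. lam s * (x s)\<^sup>2))"
      by (elim exE) (rule that)
    have v: "\<exists>s<m. v s \<noteq> 0"
      "\<And>s. s < m \<Longrightarrow> (\<Sum>t<m. \<epsilon> * D $$ (s, t) * lam t * v t) = \<mu> * v s"
      "\<And>x. (\<Sum>s<m. \<Sum>t<m. lam s * lam t * (\<epsilon> * D $$ (s, t)) * (x s * x t)) \<le> \<mu> * (\<Sum>s<m. lam s * (x s)\<^sup>2)"
      using v0 by blast+
    define w where "w = Matrix.vec m (\<lambda>s. complex_of_real (v s))"
    have "eigenvector ?C w (complex_of_real (\<epsilon> * \<mu>))"
      unfolding eigenvector_def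
    proof (intro conjI)
      show "w \<in> carrier_vec (dim_row ?C)" using D by (auto simp: w_def)
      show "w \<noteq> 0\<^sub>v (dim_row ?C)"
      proof
        assume w0: "w = 0\<^sub>v (dim_row ?C)"
        obtain s where s: "s < m" "v s \<noteq> 0" using v(1) by blast
        have "vec_index w s = 0" unfolding w0 using s D by auto
        then show False using s by (simp add: w_def)
      qed
      show "?C *\<^sub>v w = complex_of_real (\<epsilon> * \<mu>) \<cdot>\<^sub>v w"
      proof (rule eq_vecI)
        fix s assume "s < dim_vec (complex_of_real (\<epsilon> * \<mu>) \<cdot>\<^sub>v w)"
        then have s: "s < m" by (simp add: w_def)
        have "(\<Sum>t<m. \<epsilon> * D $$ (s, t) * lam t * v t) = \<epsilon> * (\<Sum>t<m. D $$ (s, t) * lam t * v t)"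
          by (simp add: sum_distrib_left mult_ac)
        then have e: "(\<Sum>t<m. D $$ (s, t) * lam t * v t) = \<epsilon> * \<mu> * v s"
          using v(2)[OF s] \<epsilon> by auto
        have "vec_index (?C *\<^sub>v w) s = (\<Sum>t<m. complex_of_real (D $$ (s, t) * lam t * v t))"
          using s D C by (simp add: mat_diag_mult_right[OF D] scalar_prod_def w_def lessThan_atLeast0)
        also have "\<dots> = complex_of_real (\<epsilon> * \<mu> * v s)" unfolding e[symmetric] by simp
        finally show "vec_index (?C *\<^sub>v w) s = vec_index (complex_of_real (\<epsilon> * \<mu>) \<cdot>\<^sub>v w) s"
          using s by (simp add: w_def)
      qed (use D in \<open>auto simp: w_def\<close>)
    qed
    then have "complex_of_real (\<epsilon> * \<mu>) \<in> spectrum ?C"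
      unfolding spectrum_def eigenvalue_def by blast
    then have "cmod (complex_of_real (\<epsilon> * \<mu>)) \<in> norm ` spectrum ?C" by (rule imageI)
    then have "cmod (complex_of_real (\<epsilon> * \<mu>)) \<le> ?\<rho>"
      using spectral_radius_mem_max(2)[OF C] m by blast
    then have "\<mu> \<le> ?\<rho>" using \<epsilon> by (auto simp: norm_mult abs_le_iff)
    moreover have "0 \<le> (\<Sum>s<m. lam s * (x s)\<^sup>2)" using lam by (intro sum_nonneg) (auto simp: less_imp_le)
    ultimately show ?thesis using v(3)[of x] mult_right_mono by fastforce
  qed
  have "(\<Sum>s<m. \<Sum>t<m. lam s * lam t * (- 1 * D $$ (s, t)) * (x s * x t)) = - (\<Sum>s<m. \<Sum>t<m. lam s * lam t * D $$ (s, t) * (x s * x t))"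
    by (simp add: sum_negf)
  then show ?thesis using Q[of 1] Q[of "- 1"] by (simp add: abs_le_iff)
qed

section \<open>Uniformity in the system size and the limiting variance\<close>

text \<open>The dominating form \<open>vq\<close> is \<open>Q\<close> itself when \<open>Q\<close> is nonnegative, which is what allows the constant \<open>4\<close>.\<close>

lemma fluct_uniform_bounds:
  fixes lam q fv :: "nat \<Rightarrow> real" and Dv :: "nat \<Rightarrow> nat \<Rightarrow> real"
  assumes form: "\<And>x. \<bar>wform m lam Dv x\<bar> \<le> \<rho> * (\<Sum>s<m. lam s * (x s)\<^sup>2)"
    and K: "K = 8 \<or> (K = 4 \<and> (\<forall>x. 0 \<le> wform m lam Dv x))"
    and \<rho>: "0 < \<rho>" "K * \<beta>\<^sup>2 * \<rho> < 1"
  shows "\<exists>C. \<forall>V sp N. species_model m V sp N lam Dv \<beta> h q fv \<longrightarrow>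
    \<bar>\<integral>x. species_model.fluct m V sp N lam Dv \<beta> h q fv x \<partial>gauss (species_model.idx V)\<bar> \<le> \<beta>\<^sup>2 * C \<and>
    (\<forall>y. cmod (complex_of_real (exp (- (\<beta>\<^sup>2 / 4 * species_model.base m V sp N lam Dv q * y\<^sup>2)))
          * (\<integral>x. iexp (y / sqrt N * species_model.fluct m V sp N lam Dv \<beta> h q fv x) \<partial>gauss (species_model.idx V))
        - complex_of_real (exp (- (y\<^sup>2 / 2 * (\<Sum>s<m. real (card {i \<in> V. sp i = s}) / N * lcosh_var (fv s) h)))))
      \<le> 2 * \<beta>\<^sup>2 * C * (y\<^sup>2 / N + \<bar>y\<bar> / sqrt N)
        + (\<Sum>s<m. lam s * (lcosh_third (fv s) h / 6 + (lcosh_var (fv s) h)\<^sup>2 / 8)) * (\<bar>y\<bar> ^ 3 / sqrt N + y ^ 4 / N))"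
proof -
  define c1 where "c1 = (K * \<beta>\<^sup>2 * \<rho> + 1) / 4"
  define \<epsilon> where "\<epsilon> = (1 / (2 * c1) - 1) / 2"
  define C where "C = exp (\<Sum>s<m. c1 * (1 + 1 / \<epsilon>) / lam s) * (\<integral>z. exp ((1 + \<epsilon>) * c1 * z\<^sup>2) \<partial>std_normal_distribution) ^ m
       / ((1 / (2 * \<rho>) - K * \<beta>\<^sup>2 / 2) / 2)"
  define Q where "Q x = wform m lam Dv x" for x :: "nat \<Rightarrow> real"
  define vq where "vq x = (if K = 8 then \<rho> * (\<Sum>s<m. lam s * (x s)\<^sup>2) else Q x)" for x :: "nat \<Rightarrow> real"
  have vq: "\<bar>Q x\<bar> \<le> vq x" "vq x \<le> \<rho> * (\<Sum>s<m. lam s * (x s)\<^sup>2)" for x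
    using form[of x] K by (auto simp: vq_def Q_def)
  have main: "\<bar>\<integral>x. species_model.fluct m V sp N lam Dv \<beta> h q fv x \<partial>gauss (species_model.idx V)\<bar> \<le> \<beta>\<^sup>2 * C \<and>
    (\<forall>y. cmod (complex_of_real (exp (- (\<beta>\<^sup>2 / 4 * species_model.base m V sp N lam Dv q * y\<^sup>2)))
          * (\<integral>x. iexp (y / sqrt N * species_model.fluct m V sp N lam Dv \<beta> h q fv x) \<partial>gauss (species_model.idx V))
        - complex_of_real (exp (- (y\<^sup>2 / 2 * (\<Sum>s<m. real (card {i \<in> V. sp i = s}) / N * lcosh_var (fv s) h)))))
      \<le> 2 * \<beta>\<^sup>2 * C * (y\<^sup>2 / N + \<bar>y\<bar> / sqrt N)
        + (\<Sum>s<m. lam s * (lcosh_third (fv s) h / 6 + (lcosh_var (fv s) h)\<^sup>2 / 8)) * (\<bar>y\<bar> ^ 3 / sqrt N + y ^ 4 / N))"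
    if "species_model m V sp N lam Dv \<beta> h q fv" for V sp N
  proof -
    interpret species_model m V sp N lam Dv \<beta> h q fv by (rule that)
    have bil: "bil x x = Q x" for x by (simp add: bil_def Q_def)
    have vqb: "\<bar>bil x x\<bar> \<le> vq x" for x unfolding bil by (rule vq)
    have Kb: "K = 8 \<or> K = 4 \<and> (\<forall>x. 0 \<le> bil x x)" using K unfolding bil Q_def .
    note ov = overlap_bound[OF vqb vq(2) Kb \<rho> _ _ c1_def \<epsilon>_def C_def]
    show ?thesis
      using fluct_mean_bound[OF vqb ov] fluct_char_bound[OF vqb ov] by blast
  qed
  show ?thesis using main by blast
qed

text \<open>Sizes and species assignments vary with \<open>k\<close>, the ratios and the fixed point do not.\<close>

lemma fluct_char_limit:
  fixes lam q fv :: "nat \<Rightarrow> real" and Dv :: "nat \<Rightarrow> nat \<Rightarrow> real" and N :: "nat \<Rightarrow> real"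
  assumes form: "\<And>x. \<bar>wform m lam Dv x\<bar> \<le> \<rho> * (\<Sum>s<m. lam s * (x s)\<^sup>2)"
    and K: "K = 8 \<or> (K = 4 \<and> (\<forall>x. 0 \<le> wform m lam Dv x))"
    and \<rho>: "0 < \<rho>" "K * \<beta>\<^sup>2 * \<rho> < 1"
    and model: "\<And>k. species_model m (V k) (sp k) (N k) lam Dv \<beta> h q fv"
    and N: "filterlim N at_top sequentially"
  shows "(\<lambda>k. \<integral>x. iexp (y / sqrt (N k) * species_model.fluct m (V k) (sp k) (N k) lam Dv \<beta> h q fv x) \<partial>gauss (species_model.idx (V k)))
    \<longlonglongrightarrow> complex_of_real (exp (- (y\<^sup>2 / 2 * ((\<Sum>s<m. lam s * lcosh_var (fv s) h)
        - \<beta>\<^sup>2 / 2 * wform m lam Dv q))))"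
proof -
  define Q where "Q = wform m lam Dv q"
  define E where "E k = (\<integral>x. iexp (y / sqrt (N k) * species_model.fluct m (V k) (sp k) (N k) lam Dv \<beta> h q fv x) \<partial>gauss (species_model.idx (V k)))" for k
  define ba where "ba k = species_model.base m (V k) (sp k) (N k) lam Dv q" for k
  define p where "p k = (\<Sum>s<m. real (card {i \<in> V k. sp k i = s}) / N k * lcosh_var (fv s) h)" for k
  define kk where "kk = (\<Sum>s<m. lam s * (lcosh_third (fv s) h / 6 + (lcosh_var (fv s) h)\<^sup>2 / 8))"
  have inv: "(\<lambda>k. c / N k) \<longlonglongrightarrow> 0" for c :: real
    by (rule real_tendsto_divide_at_top[OF tendsto_const N])
  have "filterlim (\<lambda>k. sqrt (N k)) at_top sequentially"
    by (rule filterlim_compose[OF sqrt_at_top N])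
  then have inv_sqrt: "(\<lambda>k. c / sqrt (N k)) \<longlonglongrightarrow> 0" for c :: real
    by (rule real_tendsto_divide_at_top[OF tendsto_const])
  obtain C where C: "\<And>k. cmod (complex_of_real (exp (- (\<beta>\<^sup>2 / 4 * ba k * y\<^sup>2))) * E k - complex_of_real (exp (- (y\<^sup>2 / 2 * p k))))
      \<le> 2 * \<beta>\<^sup>2 * C * (y\<^sup>2 / N k + \<bar>y\<bar> / sqrt (N k)) + kk * (\<bar>y\<bar> ^ 3 / sqrt (N k) + y ^ 4 / N k)"
    using fluct_uniform_bounds[OF form K \<rho>, of h q fv] model unfolding ba_def E_def p_def kk_def by blast
  have "(\<lambda>k. 2 * \<beta>\<^sup>2 * C * (y\<^sup>2 / N k + \<bar>y\<bar> / sqrt (N k)) + kk * (\<bar>y\<bar> ^ 3 / sqrt (N k) + y ^ 4 / N k))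
      \<longlonglongrightarrow> 2 * \<beta>\<^sup>2 * C * (0 + 0) + kk * (0 + 0)"
    by (intro tendsto_intros inv inv_sqrt)
  then have "(\<lambda>k. complex_of_real (exp (- (\<beta>\<^sup>2 / 4 * ba k * y\<^sup>2))) * E k - complex_of_real (exp (- (y\<^sup>2 / 2 * p k)))) \<longlonglongrightarrow> 0"
    by (intro Lim_null_comparison[OF always_eventually[OF allI[OF C]]]) simp
  moreover have p_lim: "p \<longlonglongrightarrow> (\<Sum>s<m. lam s * lcosh_var (fv s) h)"
    unfolding p_def[abs_def]
  proof (intro tendsto_intros)
    fix s assume "s \<in> {..<m}"
    then have s: "s < m" by simp
    have "(\<lambda>k. real (card {i \<in> V k. sp k i = s}) / N k - lam s) \<longlonglongrightarrow> 0"
    proof (rule Lim_null_comparison[OF _ inv[of 1]])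
      show "\<forall>\<^sub>F k in sequentially. norm (real (card {i \<in> V k. sp k i = s}) / N k - lam s) \<le> 1 / N k"
        using species_model.size_ratio[OF model s] by (intro always_eventually) simp
    qed
    then show "(\<lambda>k. real (card {i \<in> V k. sp k i = s}) / N k) \<longlonglongrightarrow> lam s" by (simp add: LIM_zero_iff)
  qed
  have "(\<lambda>k. ba k - Q) \<longlonglongrightarrow> 0"
  proof (rule Lim_null_comparison[OF _ inv[of "\<Sum>s<m. lam s * Dv s s"]])
    show "\<forall>\<^sub>F k in sequentially. norm (ba k - Q) \<le> (\<Sum>s<m. lam s * Dv s s) / N k"
      using species_model.base_bounds[OF model] unfolding ba_def Q_def species_model.bil_def[OF model]
      by (intro always_eventually) simp
  qed
  then have ba_lim: "ba \<longlonglongrightarrow> Q" by (simp add: LIM_zero_iff)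
  have "(\<lambda>k. complex_of_real (exp (- (y\<^sup>2 / 2 * p k)))) \<longlonglongrightarrow> complex_of_real (exp (- (y\<^sup>2 / 2 * (\<Sum>s<m. lam s * lcosh_var (fv s) h))))"
    by (intro tendsto_intros p_lim)
  ultimately have "(\<lambda>k. (complex_of_real (exp (- (\<beta>\<^sup>2 / 4 * ba k * y\<^sup>2))) * E k - complex_of_real (exp (- (y\<^sup>2 / 2 * p k)))) + complex_of_real (exp (- (y\<^sup>2 / 2 * p k))))
      \<longlonglongrightarrow> 0 + complex_of_real (exp (- (y\<^sup>2 / 2 * (\<Sum>s<m. lam s * lcosh_var (fv s) h))))"
    by (intro tendsto_add)
  then have "(\<lambda>k. (complex_of_real (exp (- (\<beta>\<^sup>2 / 4 * ba k * y\<^sup>2))) * E k) * complex_of_real (exp (\<beta>\<^sup>2 / 4 * ba k * y\<^sup>2)))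
      \<longlonglongrightarrow> complex_of_real (exp (- (y\<^sup>2 / 2 * (\<Sum>s<m. lam s * lcosh_var (fv s) h)))) * complex_of_real (exp (\<beta>\<^sup>2 / 4 * Q * y\<^sup>2))"
    by (intro tendsto_intros ba_lim) simp
  note lim = this
  have eq1: "(complex_of_real (exp (- (\<beta>\<^sup>2 / 4 * ba k * y\<^sup>2))) * E k) * complex_of_real (exp (\<beta>\<^sup>2 / 4 * ba k * y\<^sup>2)) = E k" for k
  proof -
    have "complex_of_real (exp (- (\<beta>\<^sup>2 / 4 * ba k * y\<^sup>2))) * complex_of_real (exp (\<beta>\<^sup>2 / 4 * ba k * y\<^sup>2)) = 1"
      unfolding of_real_mult[symmetric] exp_add[symmetric] by simp
    then show ?thesis by (simp only: mult.assoc mult.commute[of "E k"]) (simp only: mult.assoc[symmetric] mult_1_left)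
  qed
  have eq2: "complex_of_real (exp (- (y\<^sup>2 / 2 * (\<Sum>s<m. lam s * lcosh_var (fv s) h)))) * complex_of_real (exp (\<beta>\<^sup>2 / 4 * Q * y\<^sup>2))
      = complex_of_real (exp (- (y\<^sup>2 / 2 * ((\<Sum>s<m. lam s * lcosh_var (fv s) h) - \<beta>\<^sup>2 / 2 * Q))))"
    unfolding of_real_mult[symmetric] exp_add[symmetric] by (simp add: algebra_simps)
  show ?thesis using lim unfolding eq1 eq2 unfolding E_def Q_def .
qed

text \<open>Sites are coded as pairs of a species and a counter.\<close>

lemma species_of_size:
  fixes n :: "nat \<Rightarrow> nat"
  shows "\<exists>V (sp :: nat \<Rightarrow> nat). finite V \<and> (\<forall>i\<in>V. sp i < m) \<and> (\<forall>s<m. card {i \<in> V. sp i = s} = n s)"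
proof -
  define V where "V = prod_encode ` (SIGMA s:{..<m}. {..<n s})"
  define sp where "sp i = fst (prod_decode i)" for i
  have "card {i \<in> V. sp i = s} = n s" if "s < m" for s
  proof -
    have "{i \<in> V. sp i = s} = prod_encode ` ({s} \<times> {..<n s})"
      using that by (auto simp: V_def sp_def)
    then show ?thesis by (simp add: card_image[OF inj_prod_encode])
  qed
  then show ?thesis by (intro exI[of _ V] exI[of _ sp]) (auto simp: V_def sp_def)
qed

text \<open>Systems with \<open>\<lfloor>\<lambda>\<^sub>s N\<rfloor>\<close> sites of species \<open>s\<close> exist for every \<open>N\<close>, and their characteristic functions have modulus at most one.\<close>

theorem limiting_variance_nonneg:
  fixes lam q fv :: "nat \<Rightarrow> real" and Dv :: "nat \<Rightarrow> nat \<Rightarrow> real"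
  assumes form: "\<And>x. \<bar>wform m lam Dv x\<bar> \<le> \<rho> * (\<Sum>s<m. lam s * (x s)\<^sup>2)"
    and K: "K = 8 \<or> (K = 4 \<and> (\<forall>x. 0 \<le> wform m lam Dv x))"
    and \<rho>: "0 < \<rho>" "K * \<beta>\<^sup>2 * \<rho> < 1"
    and lam: "\<And>s. s < m \<Longrightarrow> lam s > 0"
    and Dv: "\<And>s t. s < m \<Longrightarrow> t < m \<Longrightarrow> Dv s t \<ge> 0" "\<And>s t. s < m \<Longrightarrow> t < m \<Longrightarrow> Dv s t = Dv t s"
    and beta: "\<beta> > 0" and q: "\<And>s. s < m \<Longrightarrow> 0 \<le> q s \<and> q s \<le> 1"
    and fv: "\<And>s. s < m \<Longrightarrow> fv s = \<beta>\<^sup>2 * (\<Sum>t<m. Dv s t * lam t * q t)"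
    and fixed: "\<And>s. s < m \<Longrightarrow> q s = (\<integral>\<eta>. (tanh (sqrt (fv s) * \<eta> + h))\<^sup>2 \<partial>std_normal_distribution)"
  shows "0 \<le> (\<Sum>s<m. lam s * lcosh_var (fv s) h) - \<beta>\<^sup>2 / 2 * wform m lam Dv q"
    (is "0 \<le> ?b")
proof -
  \<comment> \<open>Rounding down keeps the numbers of sites within the tolerance of the species model.\<close>
  define n where "n k s = nat \<lfloor>lam s * real (Suc k)\<rfloor>" for k s
  have "\<forall>k. \<exists>V (sp :: nat \<Rightarrow> nat). finite V \<and> (\<forall>i\<in>V. sp i < m) \<and> (\<forall>s<m. card {i \<in> V. sp i = s} = n k s)"
    using species_of_size by blast
  then obtain V and sp :: "nat \<Rightarrow> nat \<Rightarrow> nat" where V: "\<And>k. finite (V k)" "\<And>k i. i \<in> V k \<Longrightarrow> sp k i < m"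
    "\<And>k s. s < m \<Longrightarrow> card {i \<in> V k. sp k i = s} = n k s" by metis
  have n: "real (n k s) \<le> lam s * real (Suc k)" "lam s * real (Suc k) - 1 \<le> real (n k s)" if "s < m" for k s
  proof -
    have "0 \<le> lam s * real (Suc k)" using lam[OF that] by simp
    then have "real (n k s) = real_of_int \<lfloor>lam s * real (Suc k)\<rfloor>" by (simp add: n_def)
    then show "real (n k s) \<le> lam s * real (Suc k)" "lam s * real (Suc k) - 1 \<le> real (n k s)" by linarith+
  qed
  have model: "species_model m (V k) (sp k) (real (Suc k)) lam Dv \<beta> h q fv" for k
  proof (rule species_model.intro)
    show "finite (V k)" by (rule V)
    show "sp k i < m" if "i \<in> V k" for i using that by (rule V)
    show "1 \<le> real (Suc k)" by simp
    show "0 < lam s" if "s < m" for s using that by (rule lam)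
    show "0 \<le> Dv s t" "Dv s t = Dv t s" if "s < m" "t < m" for s t using that by (rule Dv)+
    show "0 < \<beta>" by (rule beta)
    show "0 \<le> q s \<and> q s \<le> 1" if "s < m" for s using that by (rule q)
    show "fv s = \<beta>\<^sup>2 * (\<Sum>t<m. Dv s t * lam t * q t)" if "s < m" for s using that by (rule fv)
    show "q s = (\<integral>\<eta>. (tanh (sqrt (fv s) * \<eta> + h))\<^sup>2 \<partial>std_normal_distribution)" if "s < m" for s using that by (rule fixed)
    show "real (card {i \<in> V k. sp k i = s}) \<le> lam s * real (Suc k)"
      "lam s * real (Suc k) - 1 \<le> real (card {i \<in> V k. sp k i = s})" if "s < m" for s
      unfolding V(3)[OF that] by (rule n[OF that])+
  qed
  have "filterlim (\<lambda>k. real (Suc k)) at_top sequentially"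
    by (intro filterlim_compose[OF filterlim_real_sequentially] filterlim_Suc)
  from fluct_char_limit[OF form K \<rho> model this, of 1]
  have "(\<lambda>k. cmod (\<integral>x. iexp (1 / sqrt (real (Suc k)) * species_model.fluct m (V k) (sp k) (real (Suc k)) lam Dv \<beta> h q fv x) \<partial>gauss (species_model.idx (V k))))
     \<longlonglongrightarrow> cmod (complex_of_real (exp (- (1\<^sup>2 / 2 * ?b))))"
    by (rule tendsto_norm)
  moreover have "cmod (\<integral>x. iexp (1 / sqrt (real (Suc k)) * species_model.fluct m (V k) (sp k) (real (Suc k)) lam Dv \<beta> h q fv x) \<partial>gauss (species_model.idx (V k))) \<le> 1" for k
  proof -
    interpret G: prob_space "gauss (species_model.idx (V k))" by (rule prob_gauss)
    show ?thesis by (rule order_trans[OF integral_norm_bound]) (simp add: G.prob_space)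
  qed
  ultimately have "cmod (complex_of_real (exp (- (1\<^sup>2 / 2 * ?b)))) \<le> 1"
    by (intro LIMSEQ_le_const2) auto
  then show ?thesis by (simp only: norm_of_real) simp
qed

section \<open>Free energy of the multi-species model\<close>

lemma indep_vars_gauss_coordinates:
  assumes "finite J" "J \<noteq> {}"
  shows "prob_space.indep_vars (gauss J) (\<lambda>_. std_normal_distribution) (\<lambda>j x. x j) J"
proof -
  interpret G: prob_space "gauss J" by (rule prob_gauss)
  have "distr (gauss J) (gauss J) (\<lambda>x. \<lambda>j\<in>J. x j) = distr (gauss J) (gauss J) (\<lambda>x. x)"
    by (intro distr_cong refl) (auto simp: space_PiM restrict_PiE_iff PiE_restrict)
  also have "\<dots> = gauss J" by (simp add: distr_id)
  also have "\<dots> = PiM J (\<lambda>j. distr (gauss J) std_normal_distribution (\<lambda>x. x j))"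
    by (intro PiM_cong refl distr_PiM_component[symmetric] prob_std_normal)
  finally show ?thesis
    using assms by (subst G.indep_vars_iff_distr_eq_PiM') auto
qed

text \<open>Independence and the marginal laws determine the joint law, which may therefore be realised by scaled standard normal variables.\<close>

lemma distr_gaussian_array:
  fixes g :: "'j \<Rightarrow> 'a \<Rightarrow> real" and var :: "'j \<Rightarrow> real"
  assumes M: "prob_space M" and P: "finite J" "P \<subseteq> J" "P \<noteq> {}"
    and indep: "prob_space.indep_vars M (\<lambda>_. borel) g P"
    and law: "\<And>p. p \<in> P \<Longrightarrow> distr M borel (g p) = normal_law 0 (var p)"
    and f: "f \<in> borel_measurable (PiM P (\<lambda>_. borel))"
  shows "distr M borel (\<lambda>\<omega>. f (\<lambda>p\<in>P. g p \<omega>)) = distr (gauss J) borel (\<lambda>x. f (\<lambda>p\<in>P. sqrt (var p) * x p))"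
proof -
  interpret M: prob_space M by (rule M)
  interpret G: prob_space "gauss J" by (rule prob_gauss)
  have J: "J \<noteq> {}" using P by auto
  have g_meas: "g p \<in> borel_measurable M" if "p \<in> P" for p
    using indep that unfolding M.indep_vars_def by auto
  have x_meas: "(\<lambda>x. sqrt (var p) * x p) \<in> borel_measurable (gauss J)" if "p \<in> P" for p
    using subsetD[OF P(2) that] by measurable
  have "G.indep_vars (\<lambda>_. std_normal_distribution) (\<lambda>j x. x j) P"
    by (rule G.indep_vars_subset[OF indep_vars_gauss_coordinates[OF P(1) J] P(2)])
  then have "G.indep_vars (\<lambda>_. borel) (\<lambda>p x. sqrt (var p) * x p) P"
    by (rule G.indep_vars_compose2[where Y = "\<lambda>p y. sqrt (var p) * y"]) auto
  then have 1: "distr (gauss J) (PiM P (\<lambda>_. borel)) (\<lambda>x. \<lambda>p\<in>P. sqrt (var p) * x p)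
      = PiM P (\<lambda>p. distr (gauss J) borel (\<lambda>x. sqrt (var p) * x p))"
    using x_meas P(3) by (subst (asm) G.indep_vars_iff_distr_eq_PiM') auto
  have 2: "distr M (PiM P (\<lambda>_. borel)) (\<lambda>\<omega>. \<lambda>p\<in>P. g p \<omega>) = PiM P (\<lambda>p. distr M borel (g p))"
    using indep g_meas P(3) by (subst (asm) M.indep_vars_iff_distr_eq_PiM') auto
  have 3: "distr (gauss J) borel (\<lambda>x. sqrt (var p) * x p) = normal_law 0 (var p)" if p: "p \<in> P" for p
  proof -
    have "normal_law 0 (var p) = distr (distr (gauss J) std_normal_distribution (\<lambda>x. x p)) borel (\<lambda>x. 0 + sqrt (var p) * x)"
      unfolding normal_law_def using p P by (subst distr_PiM_component) (auto intro: prob_std_normal)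
    also have "\<dots> = distr (gauss J) borel (\<lambda>x. sqrt (var p) * x p)"
      using p P by (subst distr_distr) (auto simp: comp_def)
    finally show ?thesis by simp
  qed
  have "distr M (PiM P (\<lambda>_. borel)) (\<lambda>\<omega>. \<lambda>p\<in>P. g p \<omega>) = distr (gauss J) (PiM P (\<lambda>_. borel)) (\<lambda>x. \<lambda>p\<in>P. sqrt (var p) * x p)"
    unfolding 1 2 by (intro PiM_cong refl) (simp add: law 3)
  note law_eq = this
  have m1: "(\<lambda>\<omega>. \<lambda>p\<in>P. g p \<omega>) \<in> measurable M (PiM P (\<lambda>_. borel))"
    by (rule measurable_restrict) (rule g_meas)
  have m2: "(\<lambda>x. \<lambda>p\<in>P. sqrt (var p) * x p) \<in> measurable (gauss J) (PiM P (\<lambda>_. borel))"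
    by (rule measurable_restrict) (rule x_meas)
  show ?thesis
    using arg_cong[where f = "\<lambda>\<mu>. distr \<mu> borel f", OF law_eq]
    unfolding distr_distr[OF f m1] distr_distr[OF f m2] comp_def .
qed

lemma mat_vec_ratio:
  assumes "D \<in> carrier_mat m m" "q \<in> carrier_vec m" "s < m"
  shows "vec_index (D * ratio_mat m lam *\<^sub>v q) s = (\<Sum>t<m. D $$ (s, t) * lam t * vec_index q t)"
  using assms by (simp add: ratio_mat_def mat_diag_mult_right scalar_prod_def lessThan_atLeast0)

lemma msk_Q_eq:
  assumes D: "D \<in> carrier_mat m m" and x: "x \<in> carrier_vec m"
  shows "msk_Q m D lam x = (\<Sum>s<m. \<Sum>t<m. lam s * lam t * D $$ (s, t) * (vec_index x s * vec_index x t))"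
proof -
  have "ratio_mat m lam * D * ratio_mat m lam = Matrix.mat m m (\<lambda>(i, j). lam i * D $$ (i, j) * lam j)"
  proof -
    have "mat_diag m lam * D \<in> carrier_mat m m" using D by (intro mult_carrier_mat[OF mat_diag_dim])
    then have "ratio_mat m lam * D * ratio_mat m lam = Matrix.mat m m (\<lambda>(i, j). (mat_diag m lam * D) $$ (i, j) * lam j)"
      unfolding ratio_mat_def by (rule mat_diag_mult_right)
    then show ?thesis unfolding mat_diag_mult_left[OF D] by (auto intro!: eq_matI)
  qed
  then show ?thesis
    using x by (simp add: msk_Q_def scalar_prod_def lessThan_atLeast0 sum_distrib_left mult_ac)
qed

lemma msk_field_eq:
  assumes "\<beta> > 0"
  shows "msk_field m D lam \<beta> h q s \<eta> = sqrt (\<beta>\<^sup>2 * vec_index (D * ratio_mat m lam *\<^sub>v q) s) * \<eta> + h"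
  using assms by (simp add: msk_field_def real_sqrt_mult mult_ac)

lemma msk_fixed_point_iff:
  assumes "D \<in> carrier_mat m m" "\<beta> > 0"
  shows "msk_fixed_point m D lam \<beta> h q \<longleftrightarrow> q \<in> carrier_vec m \<and> (\<forall>s<m. 0 \<le> vec_index q s \<and> vec_index q s \<le> 1 \<and>
    vec_index q s = tanh_sq_mean h (\<beta>\<^sup>2 * (\<Sum>t<m. D $$ (s, t) * lam t * vec_index q t)))"
proof (cases "q \<in> carrier_vec m")
  case True
  have field: "(\<integral>\<eta>. (tanh (msk_field m D lam \<beta> h q s \<eta>))\<^sup>2 \<partial>std_normal_distribution)
      = tanh_sq_mean h (\<beta>\<^sup>2 * (\<Sum>t<m. D $$ (s, t) * lam t * vec_index q t))" if "s < m" for s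
    unfolding msk_field_eq[OF assms(2)] tanh_sq_mean_def mat_vec_ratio[OF assms(1) True that] ..
  have "(\<forall>s<m. 0 \<le> vec_index q s \<and> vec_index q s \<le> 1 \<and>
      vec_index q s = (\<integral>\<eta>. (tanh (msk_field m D lam \<beta> h q s \<eta>))\<^sup>2 \<partial>std_normal_distribution))
    \<longleftrightarrow> (\<forall>s<m. 0 \<le> vec_index q s \<and> vec_index q s \<le> 1 \<and>
      vec_index q s = tanh_sq_mean h (\<beta>\<^sup>2 * (\<Sum>t<m. D $$ (s, t) * lam t * vec_index q t)))"
    by (rule all_cong) (simp only: field)
  then show ?thesis unfolding msk_fixed_point_def atLeastAtMost_iff by blast
next
  case False
  then show ?thesis by (simp add: msk_fixed_point_def)
qed

text \<open>A vanishing spectral radius is excluded because \<open>0 powr (- 1 / 2) = 0\<close>, so that no positive \<open>\<beta>\<close> would lie below \<open>beta_0\<close>.\<close>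

lemma high_temperature_condition:
  fixes D :: "real mat"
  assumes m: "m > 0" and D: "D \<in> carrier_mat m m" and \<beta>: "0 < \<beta>" "\<beta> < beta_0 m D lam"
  defines "\<rho> \<equiv> spectral_radius (map_mat complex_of_real (D * mat_diag m lam))"
  shows "0 < \<rho>" "4 * (1 + of_bool (indefinite_mat m D)) * \<beta>\<^sup>2 * \<rho> < 1"
proof -
  define \<alpha> :: real where "\<alpha> = 4 * (1 + of_bool (indefinite_mat m D))"
  have \<alpha>: "0 < \<alpha>" by (simp add: \<alpha>_def add_pos_nonneg)
  have C: "map_mat complex_of_real (D * mat_diag m lam) \<in> carrier_mat m m" using D by (simp add: mat_diag_mult_right)
  have \<rho>0: "0 \<le> \<rho>" using spectral_radius_mem_max(1)[OF C] m unfolding \<rho>_def by fastforce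
  have lt: "\<beta> < \<rho> powr (- 1 / 2) / sqrt \<alpha>"
    using \<beta>(2) unfolding beta_0_def beta_c_def ratio_mat_def \<rho>_def \<alpha>_def .
  show pos: "0 < \<rho>"
  proof (rule ccontr)
    assume "\<not> 0 < \<rho>"
    then have "\<rho> = 0" using \<rho>0 by simp
    then show False using lt \<beta>(1) by simp
  qed
  have "\<rho> powr (- 1 / 2) = 1 / sqrt \<rho>"
    using pos by (simp add: powr_minus powr_half_sqrt inverse_eq_divide)
  then have "\<beta> < 1 / sqrt (\<rho> * \<alpha>)" using lt by (simp add: real_sqrt_mult)
  then have "\<beta> * sqrt (\<rho> * \<alpha>) < 1" using pos \<alpha> by (simp add: pos_less_divide_eq)
  moreover have "0 \<le> \<beta> * sqrt (\<rho> * \<alpha>)" using \<beta>(1) pos \<alpha> by simp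
  ultimately have "(\<beta> * sqrt (\<rho> * \<alpha>))\<^sup>2 < 1" by (simp only: abs_square_less_1 abs_of_nonneg)
  then show "4 * (1 + of_bool (indefinite_mat m D)) * \<beta>\<^sup>2 * \<rho> < 1"
    using pos \<alpha> unfolding \<alpha>_def[symmetric] by (simp add: power_mult_distrib mult_ac)
qed

text \<open>Nonnegative entries that do not all vanish make the form positive at the all-ones vector, so the matrix cannot be negative semidefinite.\<close>

lemma form_nonneg_if_not_indefinite:
  fixes D :: "real mat"
  assumes D: "D \<in> carrier_mat m m" "D \<noteq> 0\<^sub>m m m" "\<forall>s<m. \<forall>t<m. D $$ (s, t) \<ge> 0"
    and ni: "\<not> indefinite_mat m D"
  shows "0 \<le> (\<Sum>s<m. \<Sum>t<m. lam s * lam t * D $$ (s, t) * (x s * x t))"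
proof -
  have sp: "scalar_prod (Matrix.vec m f) (D *\<^sub>v Matrix.vec m f) = (\<Sum>s<m. \<Sum>t<m. f s * (D $$ (s, t) * f t))" for f
    using D(1) by (simp add: scalar_prod_def lessThan_atLeast0 sum_distrib_left)
  obtain s0 t0 where st: "s0 < m" "t0 < m" "D $$ (s0, t0) \<noteq> 0"
  proof -
    have "\<not> (\<forall>s<m. \<forall>t<m. D $$ (s, t) = 0)"
    proof
      assume "\<forall>s<m. \<forall>t<m. D $$ (s, t) = 0"
      then have "D = 0\<^sub>m m m" using D(1) by (intro eq_matI) auto
      then show False using D(2) by simp
    qed
    then show ?thesis using that by blast
  qed
  have "0 < D $$ (s0, t0)" using st D(3) by (metis less_eq_real_def)
  also have "\<dots> \<le> (\<Sum>t<m. D $$ (s0, t))" using st D(3) by (intro member_le_sum) auto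
  also have "\<dots> \<le> (\<Sum>s<m. \<Sum>t<m. D $$ (s, t))"
    using st D(3) by (intro member_le_sum[of s0 _ "\<lambda>s. \<Sum>t<m. D $$ (s, t)"] sum_nonneg) auto
  finally have "0 < scalar_prod (Matrix.vec m (\<lambda>_. 1)) (D *\<^sub>v Matrix.vec m (\<lambda>_. 1))" unfolding sp by simp
  then have "\<exists>x\<in>carrier_vec m. scalar_prod x (D *\<^sub>v x) > 0" by (intro bexI[of _ "Matrix.vec m (\<lambda>_. 1)"]) auto
  then have "\<not> scalar_prod (Matrix.vec m (\<lambda>s. lam s * x s)) (D *\<^sub>v Matrix.vec m (\<lambda>s. lam s * x s)) < 0"
    using ni unfolding indefinite_mat_def by (metis vec_carrier)
  then have "0 \<le> (\<Sum>s<m. \<Sum>t<m. lam s * x s * (D $$ (s, t) * (lam t * x t)))" unfolding sp by simp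
  also have "\<dots> = (\<Sum>s<m. \<Sum>t<m. lam s * lam t * D $$ (s, t) * (x s * x t))"
    by (intro sum.cong refl) (simp add: mult_ac)
  finally show ?thesis .
qed

text \<open>There must be a coupling for the joint law to be considered; a single site cannot be divided in proper fractions.\<close>

lemma msk_sizes_ge_2:
  assumes "m \<ge> 2" "\<forall>s<m. 0 < lam s \<and> lam s < 1" "N \<in> msk_sizes m lam"
  shows "N \<ge> 2"
proof (rule ccontr)
  assume "\<not> N \<ge> 2"
  then have "N = 1" using assms(3) by (auto simp: msk_sizes_def)
  then have "lam 0 \<in> \<nat>" using assms by (auto simp: msk_sizes_def)
  then obtain k :: nat where "lam 0 = real k" by (auto elim: Nats_cases)
  then show False using assms(1,2) by (auto dest!: spec[of _ 0])
qed

text \<open>For these sizes \<open>self\<close> is constantly one, so the centring of \<open>fluct\<close> is exactly \<open>N\<close> times \<open>msk_RS\<close>.\<close>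

lemma msk_free_energy_law:
  fixes D :: "real mat" and lam :: "nat \<Rightarrow> real" and g :: "nat \<Rightarrow> nat \<Rightarrow> 'a \<Rightarrow> real"
  assumes m: "m \<ge> 2" and D: "D \<in> carrier_mat m m" "transpose_mat D = D" "\<forall>s<m. \<forall>t<m. D $$ (s, t) \<ge> 0"
    and ratios: "\<forall>s<m. 0 < lam s \<and> lam s < 1" "(\<Sum>s<m. lam s) = 1"
    and N: "N \<in> msk_sizes m lam"
    and I: "msk_species N m lam I" and g: "msk_disorder N m D I M g"
    and \<beta>: "0 < \<beta>" and q: "msk_fixed_point m D lam \<beta> h q"
  defines "fv \<equiv> \<lambda>s. \<beta>\<^sup>2 * (\<Sum>t<m. D $$ (s, t) * lam t * vec_index q t)"
    and "Dv \<equiv> \<lambda>s t. D $$ (s, t)"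
  shows "\<exists>V sp. species_model m V sp (real N) lam Dv \<beta> h (vec_index q) fv \<and>
    prob_space M \<and> (\<lambda>\<omega>. msk_F N \<beta> h (\<lambda>i j. g i j \<omega>)) \<in> borel_measurable M \<and>
    distr M borel (\<lambda>\<omega>. msk_F N \<beta> h (\<lambda>i j. g i j \<omega>))
      = distr (gauss (species_model.idx V)) borel
         (\<lambda>x. msk_RS m D lam \<beta> h q + species_model.fluct m V sp (real N) lam Dv \<beta> h (vec_index q) fv x / real N)"
proof -
  define V where "V = {1..N}"
  define sp where "sp i = (THE s. s < m \<and> i \<in> I s)" for i
  have N2: "N \<ge> 2" by (rule msk_sizes_ge_2[OF m ratios(1) N])
  have cover: "(\<Union>s<m. I s) = V" and disj: "disjoint_family_on I {..<m}"
    and card: "\<And>s. s < m \<Longrightarrow> real (card (I s)) = lam s * real N"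
    using I by (auto simp: msk_species_def V_def)
  have sp_eq: "sp i = s" if "s < m" "i \<in> I s" for i s
    unfolding sp_def
  proof (rule the_equality)
    show "s' = s" if "s' < m \<and> i \<in> I s'" for s'
      using disj that \<open>s < m\<close> \<open>i \<in> I s\<close> unfolding disjoint_family_on_def by blast
  qed (use that in auto)
  have sp_in: "sp i < m \<and> i \<in> I (sp i)" if "i \<in> V" for i
  proof -
    have "i \<in> (\<Union>s<m. I s)" using that unfolding cover .
    then obtain s where "s < m" "i \<in> I s" by blast
    then show ?thesis using sp_eq by simp
  qed
  have I_eq: "{i \<in> V. sp i = s} = I s" if "s < m" for s
    using sp_in sp_eq[OF that] cover that by blast
  have qc: "q \<in> carrier_vec m" and q01: "\<And>s. s < m \<Longrightarrow> 0 \<le> vec_index q s \<and> vec_index q s \<le> 1"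
    and qfix: "\<And>s. s < m \<Longrightarrow> vec_index q s = tanh_sq_mean h (fv s)"
    using q unfolding msk_fixed_point_iff[OF D(1) \<beta>] fv_def by blast+
  have Dsym: "D $$ (s, t) = D $$ (t, s)" if "s < m" "t < m" for s t
  by (rule symmetric_mat_entry[OF D(1,2) that])
  have model: "species_model m V sp (real N) lam Dv \<beta> h (vec_index q) fv"
  proof (rule species_model.intro)
    show "finite V" by (simp add: V_def)
    show "sp i < m" if "i \<in> V" for i using sp_in[OF that] by simp
    show "1 \<le> real N" using N2 by simp
    show "0 < lam s" if "s < m" for s using that ratios(1) by simp
    show "0 \<le> Dv s t" "Dv s t = Dv t s" if "s < m" "t < m" for s t
      using that D(3) Dsym[OF that] by (simp_all add: Dv_def)
    show "0 < \<beta>" by (rule \<beta>)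
    show "0 \<le> vec_index q s \<and> vec_index q s \<le> 1" if "s < m" for s by (rule q01[OF that])
    show "fv s = \<beta>\<^sup>2 * (\<Sum>t<m. Dv s t * lam t * vec_index q t)" for s by (simp add: fv_def Dv_def)
    show "vec_index q s = (\<integral>\<eta>. (tanh (sqrt (fv s) * \<eta> + h))\<^sup>2 \<partial>std_normal_distribution)" if "s < m" for s
      using qfix[OF that] by (simp only: tanh_sq_mean_def)
    show "real (card {i \<in> V. sp i = s}) \<le> lam s * real N"
      "lam s * real N - 1 \<le> real (card {i \<in> V. sp i = s})" if "s < m" for s
      unfolding I_eq[OF that] card[OF that] by simp_all
  qed
  interpret species_model m V sp "real N" lam Dv \<beta> h "vec_index q" fv by (rule model)
  have M: "prob_space M" using g by (simp add: msk_disorder_def)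
  define P where "P = {(i, j). 1 \<le> i \<and> i < j \<and> j \<le> N}"
  have P: "P = pairs" unfolding pairs_def P_def by (auto simp: V_def)
  have indep: "prob_space.indep_vars M (\<lambda>_. borel) (\<lambda>p. g (fst p) (snd p)) pairs"
    using g unfolding msk_disorder_def P[symmetric] P_def by (simp add: case_prod_unfold)
  define f where "f y = ln (msk_Z N \<beta> h (\<lambda>i j. y (i, j))) / real N" for y :: "nat \<times> nat \<Rightarrow> real"
  have H: "msk_H N \<beta> h G \<sigma> = \<beta> / sqrt (real N) * (\<Sum>(i, j)\<in>pairs. G i j * \<sigma> i * \<sigma> j) + h * (\<Sum>i\<in>V. \<sigma> i)" for G \<sigma>
    unfolding msk_H_def P[symmetric] P_def by (simp only: V_def)
  have Zc: "msk_Z N \<beta> h G = (\<Sum>\<sigma>\<in>confs. exp (msk_H N \<beta> h G \<sigma>))" for G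
    unfolding msk_Z_def confs_def by (simp only: V_def)
  have f_meas: "f \<in> borel_measurable (PiM pairs (\<lambda>_. borel))"
  proof -
    have "(\<lambda>y. msk_H N \<beta> h (\<lambda>i j. y (i, j)) \<sigma>) \<in> borel_measurable (PiM pairs (\<lambda>_. borel))" for \<sigma>
      unfolding H case_prod_unfold
      by (intro borel_measurable_add borel_measurable_times borel_measurable_const borel_measurable_sum) auto
    then show ?thesis unfolding f_def[abs_def] Zc by measurable
  qed
  have Zcong: "msk_Z N \<beta> h G = msk_Z N \<beta> h G'" if "\<And>i j. (i, j) \<in> pairs \<Longrightarrow> G i j = G' i j" for G G'
  proof -
    have "msk_H N \<beta> h G \<sigma> = msk_H N \<beta> h G' \<sigma>" for \<sigma>
    proof -
      have "(\<Sum>(i, j)\<in>pairs. G i j * \<sigma> i * \<sigma> j) = (\<Sum>(i, j)\<in>pairs. G' i j * \<sigma> i * \<sigma> j)"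
        by (intro sum.cong refl) (auto simp: that)
      then show ?thesis unfolding H by simp
    qed
    then show ?thesis by (simp add: msk_Z_def)
  qed
  have F_eq: "msk_F N \<beta> h (\<lambda>i j. g i j \<omega>) = f (\<lambda>p\<in>pairs. g (fst p) (snd p) \<omega>)" for \<omega>
    unfolding msk_F_def f_def by (subst Zcong[of "\<lambda>i j. g i j \<omega>" "\<lambda>i j. (\<lambda>p\<in>pairs. g (fst p) (snd p) \<omega>) (i, j)"]) simp_all
  have law: "distr M borel (g (fst p) (snd p)) = normal_law 0 (Dv (sp (fst p)) (sp (snd p)))" if p: "p \<in> pairs" for p
  proof -
    have ij: "fst p \<in> V" "snd p \<in> V" "fst p < snd p" using p by (auto simp: pairs_def)
    show ?thesis
      using g ij(3) sp_in[OF ij(1)] sp_in[OF ij(2)] unfolding msk_disorder_def Dv_def by blast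
  qed
  have ne: "pairs \<noteq> {}" using N2 unfolding P[symmetric] P_def by force
  have distr_f: "distr M borel (\<lambda>\<omega>. f (\<lambda>p\<in>pairs. g (fst p) (snd p) \<omega>))
      = distr (gauss idx) borel (\<lambda>x. f (\<lambda>p\<in>pairs. sqrt (Dv (sp (fst p)) (sp (snd p))) * x p))"
    by (rule distr_gaussian_array[OF M finite_idx(1) _ ne indep law f_meas]) (auto simp: idx_def)
  have self1: "self s = 1" if "s < m" for s
    using lam[OF that] N2 that by (simp add: self_def I_eq card)
  have sum_mean: "(\<Sum>i\<in>V. ln 2 + lcosh_mean (fv (sp i)) h) = real N * (ln 2 + (\<Sum>s<m. lam s * lcosh_mean (fv s) h))"
  proof -
    have "(\<Sum>i\<in>V. (ln 2 + lcosh_mean (fv (sp i)) h) * 1) = (\<Sum>s<m. (ln 2 + lcosh_mean (fv s) h) * (\<Sum>i\<in>{i \<in> V. sp i = s}. 1))"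
      by (rule sum_by_species)
    also have "\<dots> = (\<Sum>s<m. real N * (ln 2 * lam s + lam s * lcosh_mean (fv s) h))"
      by (intro sum.cong refl) (simp add: I_eq card algebra_simps)
    also have "\<dots> = real N * (ln 2 * (\<Sum>s<m. lam s) + (\<Sum>s<m. lam s * lcosh_mean (fv s) h))"
      unfolding sum_distrib_left[symmetric] sum.distrib ..
    finally show ?thesis by (simp add: ratios(2))
  qed
  have bil1: "bil (\<lambda>s. self s - vec_index q s) (\<lambda>s. self s - vec_index q s) = msk_Q m D lam (Matrix.vec m (\<lambda>_. 1) - q)"
  proof -
    have w: "Matrix.vec m (\<lambda>_. 1) - q \<in> carrier_vec m" using qc by auto
    show ?thesis
      unfolding bil_def msk_Q_eq[OF D(1) w]
      by (intro sum.cong refl) (use qc in \<open>auto simp: self1 Dv_def\<close>)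
  qed
  have lmean: "(\<integral>\<eta>. ln (cosh (msk_field m D lam \<beta> h q s \<eta>)) \<partial>std_normal_distribution) = lcosh_mean (fv s) h" if "s < m" for s
    unfolding msk_field_eq[OF \<beta>] lcosh_mean_def lcosh_def fv_def mat_vec_ratio[OF D(1) qc that] ..
  have RS: "msk_RS m D lam \<beta> h q = ln 2 + (\<Sum>s<m. lam s * lcosh_mean (fv s) h)
      + \<beta>\<^sup>2 / 4 * bil (\<lambda>s. self s - vec_index q s) (\<lambda>s. self s - vec_index q s)"
    unfolding msk_RS_def bil1 by (simp add: lmean)
  have f_gauss: "f (\<lambda>p\<in>pairs. sqrt (Dv (sp (fst p)) (sp (snd p))) * x p) = msk_RS m D lam \<beta> h q + fluct x / real N" for x
  proof -
    have "msk_Z N \<beta> h (\<lambda>i j. (\<lambda>p\<in>pairs. sqrt (Dv (sp (fst p)) (sp (snd p))) * x p) (i, j)) = Z (rot (pi / 2) x)"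
    proof -
      have "msk_Z N \<beta> h (\<lambda>i j. (\<lambda>p\<in>pairs. sqrt (Dv (sp (fst p)) (sp (snd p))) * x p) (i, j))
          = msk_Z N \<beta> h (\<lambda>i j. sqrt (Dv (sp i) (sp j)) * x (i, j))"
        by (rule Zcong) simp
      also have "\<dots> = Z (rot (pi / 2) x)"
        unfolding Zc Z_def H en_one by simp
      finally show ?thesis .
    qed
    then have "f (\<lambda>p\<in>pairs. sqrt (Dv (sp (fst p)) (sp (snd p))) * x p) = ln (Z (rot (pi / 2) x)) / real N"
      by (simp add: f_def)
    then show ?thesis
      unfolding RS fluct_def sum_mean using N2 by (simp add: field_simps)
  qed
  have F_meas: "(\<lambda>\<omega>. msk_F N \<beta> h (\<lambda>i j. g i j \<omega>)) \<in> borel_measurable M"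
  proof -
    interpret M: prob_space M by (rule M)
    have "(\<lambda>\<omega>. \<lambda>p\<in>pairs. g (fst p) (snd p) \<omega>) \<in> measurable M (PiM pairs (\<lambda>_. borel))"
      using indep unfolding M.indep_vars_def by (intro measurable_restrict) auto
    from measurable_compose[OF this f_meas] show ?thesis unfolding F_eq .
  qed
  show ?thesis
    using model M F_meas distr_f unfolding F_eq[symmetric] f_gauss by blast
qed

theorem theorem1p9:
  fixes m :: nat and D :: "real mat" and lam :: "nat \<Rightarrow> real" and \<beta> h :: real
    and I :: "nat \<Rightarrow> nat \<Rightarrow> nat set"
    and M :: "nat \<Rightarrow> 'a measure" and g :: "nat \<Rightarrow> nat \<Rightarrow> nat \<Rightarrow> 'a \<Rightarrow> real"
  assumes "m \<ge> 2"
    and "D \<in> carrier_mat m m" and "transpose_mat D = D" and "invertible_mat D"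
    and "D \<noteq> 0\<^sub>m m m" and "\<forall>s<m. \<forall>t<m. D $$ (s, t) \<ge> 0"
    and "\<forall>s<m. 0 < lam s \<and> lam s < 1" and "(\<Sum>s<m. lam s) = 1"
    and "\<forall>N\<in>msk_sizes m lam. msk_species N m lam (I N)"
    and "\<forall>N\<in>msk_sizes m lam. msk_disorder N m D (I N) (M N) (g N)"
    and "h \<ge> 0" and "0 < \<beta>" and "\<beta> < beta_0 m D lam"
  shows "(\<exists>!q. msk_fixed_point m D lam \<beta> h q) \<and>
    (\<forall>q. msk_fixed_point m D lam \<beta> h q \<longrightarrow>
      (\<exists>K. \<forall>N\<in>msk_sizes m lam.
        \<bar>(\<integral>\<omega>. msk_F N \<beta> h (\<lambda>i j. g N i j \<omega>) \<partial>M N) - msk_RS m D lam \<beta> h q\<bar> \<le> K / real N) \<and>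
      (h > 0 \<longrightarrow>
        0 \<le> msk_b m D lam \<beta> h q \<and>
        (\<forall>r :: nat \<Rightarrow> nat. (\<forall>k. r k \<in> msk_sizes m lam) \<and> filterlim r at_top sequentially \<longrightarrow>
          weak_conv_m
            (\<lambda>k. distr (M (r k)) borel
              (\<lambda>\<omega>. sqrt (real (r k)) *
                 (msk_F (r k) \<beta> h (\<lambda>i j. g (r k) i j \<omega>) - msk_RS m D lam \<beta> h q)))
            (normal_law 0 (msk_b m D lam \<beta> h q)))))"
proof -
  note D = assms(2,3,6) and lam = assms(7,8) and \<beta> = assms(12)
  have m0: "m > 0" using assms(1) by simp
  define \<rho> where "\<rho> = spectral_radius (map_mat complex_of_real (D * mat_diag m lam))"
  \<comment> \<open>The factor \<open>4 \<alpha>\<close> under the square root in \<open>beta_0\<close>.\<close>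
  define K :: real where "K = 4 * (1 + of_bool (indefinite_mat m D))"
  define Dv where "Dv s t = D $$ (s, t)" for s t
  have lam0: "0 < lam s" if "s < m" for s using lam(1) that by simp
  have Dv0: "0 \<le> Dv s t" if "s < m" "t < m" for s t using D(3) that by (simp add: Dv_def)
  have Dsym: "Dv s t = Dv t s" if "s < m" "t < m" for s t
  unfolding Dv_def by (rule symmetric_mat_entry[OF D(1,2) that])
  have \<rho>: "0 < \<rho>" "K * \<beta>\<^sup>2 * \<rho> < 1"
    using high_temperature_condition[OF m0 D(1) \<beta> assms(13)] unfolding \<rho>_def K_def by auto
  have form: "\<bar>wform m lam Dv x\<bar> \<le> \<rho> * (\<Sum>s<m. lam s * (x s)\<^sup>2)" for x
    unfolding \<rho>_def Dv_def by (rule form_le_spectral_radius[OF m0 D(1,2) lam0])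
  have K: "K = 8 \<or> (K = 4 \<and> (\<forall>x. 0 \<le> wform m lam Dv x))"
    using form_nonneg_if_not_indefinite[OF D(1) assms(5) D(3)] unfolding Dv_def
    by (cases "indefinite_mat m D") (auto simp: K_def)
  have small: "4 * \<beta>\<^sup>2 * \<rho> < 1"
  proof -
    have "4 * (\<beta>\<^sup>2 * \<rho>) \<le> K * (\<beta>\<^sup>2 * \<rho>)" using K \<rho>(1) by (intro mult_right_mono) auto
    then show ?thesis using \<rho>(2) by (simp add: mult.assoc)
  qed
  have unique: "\<exists>!q. msk_fixed_point m D lam \<beta> h q"
  proof -
    have "\<exists>q. (\<forall>s<m. 0 \<le> q s \<and> q s \<le> 1 \<and> q s = tanh_sq_mean h (\<beta>\<^sup>2 * (\<Sum>t<m. Dv s t * lam t * q t))) \<and>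
      (\<forall>q'. (\<forall>s<m. 0 \<le> q' s \<and> q' s \<le> 1 \<and> q' s = tanh_sq_mean h (\<beta>\<^sup>2 * (\<Sum>t<m. Dv s t * lam t * q' t))) \<longrightarrow> (\<forall>s<m. q' s = q s))"
      by (rule unique_species_fixed_point[OF lam0 Dv0 Dsym form \<rho>(1) small])
    then obtain q where q: "\<forall>s<m. 0 \<le> q s \<and> q s \<le> 1 \<and> q s = tanh_sq_mean h (\<beta>\<^sup>2 * (\<Sum>t<m. Dv s t * lam t * q t))"
      and uq: "\<And>q'. (\<forall>s<m. 0 \<le> q' s \<and> q' s \<le> 1 \<and> q' s = tanh_sq_mean h (\<beta>\<^sup>2 * (\<Sum>t<m. Dv s t * lam t * q' t))) \<Longrightarrow> (\<forall>s<m. q' s = q s)"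
      by blast
    have sum_vec: "(\<Sum>t<m. D $$ (s, t) * lam t * vec_index (Matrix.vec m q) t) = (\<Sum>t<m. Dv s t * lam t * q t)" for s
      by (intro sum.cong refl) (simp add: Dv_def)
    show ?thesis
    proof (rule ex1I[of _ "Matrix.vec m q"])
      show "msk_fixed_point m D lam \<beta> h (Matrix.vec m q)"
        unfolding msk_fixed_point_iff[OF D(1) \<beta>] sum_vec
      proof (intro conjI allI impI)
        fix s assume s: "s < m"
        have qs: "vec_index (Matrix.vec m q) s = q s" using s by simp
        show "0 \<le> vec_index (Matrix.vec m q) s" "vec_index (Matrix.vec m q) s \<le> 1"
          "vec_index (Matrix.vec m q) s = tanh_sq_mean h (\<beta>\<^sup>2 * (\<Sum>t<m. Dv s t * lam t * q t))"
          unfolding qs using q s by blast+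
      qed simp
      fix q' assume "msk_fixed_point m D lam \<beta> h q'"
      then have c: "q' \<in> carrier_vec m" and fp: "\<forall>s<m. 0 \<le> vec_index q' s \<and> vec_index q' s \<le> 1 \<and>
          vec_index q' s = tanh_sq_mean h (\<beta>\<^sup>2 * (\<Sum>t<m. Dv s t * lam t * vec_index q' t))"
        unfolding msk_fixed_point_iff[OF D(1) \<beta>] Dv_def by blast+
      from c uq[OF fp] show "q' = Matrix.vec m q" by (intro eq_vecI) auto
    qed
  qed
  have main: "(\<exists>K. \<forall>N\<in>msk_sizes m lam.
        \<bar>(\<integral>\<omega>. msk_F N \<beta> h (\<lambda>i j. g N i j \<omega>) \<partial>M N) - msk_RS m D lam \<beta> h q\<bar> \<le> K / real N) \<and>
      (h > 0 \<longrightarrow>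
        0 \<le> msk_b m D lam \<beta> h q \<and>
        (\<forall>r :: nat \<Rightarrow> nat. (\<forall>k. r k \<in> msk_sizes m lam) \<and> filterlim r at_top sequentially \<longrightarrow>
          weak_conv_m
            (\<lambda>k. distr (M (r k)) borel
              (\<lambda>\<omega>. sqrt (real (r k)) *
                 (msk_F (r k) \<beta> h (\<lambda>i j. g (r k) i j \<omega>) - msk_RS m D lam \<beta> h q)))
            (normal_law 0 (msk_b m D lam \<beta> h q))))"
    if q: "msk_fixed_point m D lam \<beta> h q" for q
  proof -
    define fv where "fv s = \<beta>\<^sup>2 * (\<Sum>t<m. Dv s t * lam t * vec_index q t)" for s
    define RS where "RS = msk_RS m D lam \<beta> h q"
    define b where "b = msk_b m D lam \<beta> h q"
    define F where "F N \<omega> = msk_F N \<beta> h (\<lambda>i j. g N i j \<omega>)" for N \<omega>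
    have qc: "q \<in> carrier_vec m" and q01: "\<And>s. s < m \<Longrightarrow> 0 \<le> vec_index q s \<and> vec_index q s \<le> 1"
      and qfix: "\<And>s. s < m \<Longrightarrow> vec_index q s = tanh_sq_mean h (fv s)"
      using q unfolding msk_fixed_point_iff[OF D(1) \<beta>] fv_def Dv_def by blast+
    have "\<forall>N\<in>msk_sizes m lam. \<exists>V sp. species_model m V sp (real N) lam Dv \<beta> h (vec_index q) fv \<and>
      prob_space (M N) \<and> F N \<in> borel_measurable (M N) \<and>
      distr (M N) borel (F N) = distr (gauss (species_model.idx V)) borel
         (\<lambda>x. RS + species_model.fluct m V sp (real N) lam Dv \<beta> h (vec_index q) fv x / real N)"
      using msk_free_energy_law[OF assms(1) D lam _ _ _ \<beta> q] assms(9,10)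
      unfolding F_def[abs_def] RS_def fv_def[abs_def] Dv_def[abs_def] by blast
    then obtain V sp where model: "\<And>N. N \<in> msk_sizes m lam \<Longrightarrow> species_model m (V N) (sp N) (real N) lam Dv \<beta> h (vec_index q) fv"
      and PM: "\<And>N. N \<in> msk_sizes m lam \<Longrightarrow> prob_space (M N)"
      and FM: "\<And>N. N \<in> msk_sizes m lam \<Longrightarrow> F N \<in> borel_measurable (M N)"
      and law: "\<And>N. N \<in> msk_sizes m lam \<Longrightarrow> distr (M N) borel (F N) = distr (gauss (species_model.idx (V N))) borel
         (\<lambda>x. RS + species_model.fluct m (V N) (sp N) (real N) lam Dv \<beta> h (vec_index q) fv x / real N)"
      by metis
    define fl where "fl N = species_model.fluct m (V N) (sp N) (real N) lam Dv \<beta> h (vec_index q) fv" for N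
    define \<mu> where "\<mu> N = gauss (species_model.idx (V N))" for N
    have fl_meas: "fl N \<in> borel_measurable (\<mu> N)" if "N \<in> msk_sizes m lam" for N
      unfolding fl_def \<mu>_def by (rule species_model.fluct_measurable[OF model[OF that]])
    have prob_\<mu>: "prob_space (\<mu> N)" for N unfolding \<mu>_def by (rule prob_gauss)
    have transfer: "(\<integral>\<omega>. f (F N \<omega>) \<partial>M N) = (\<integral>x. f (RS + fl N x / real N) \<partial>\<mu> N)"
      if N: "N \<in> msk_sizes m lam" and f: "f \<in> borel_measurable borel" for N and f :: "real \<Rightarrow> 'b :: {banach, second_countable_topology}"
    proof -
      have "(\<integral>\<omega>. f (F N \<omega>) \<partial>M N) = (\<integral>y. f y \<partial>distr (M N) borel (F N))"
        by (rule integral_distr[OF FM[OF N] f, symmetric])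
      also have "\<dots> = (\<integral>x. f (RS + fl N x / real N) \<partial>\<mu> N)"
        unfolding law[OF N] fl_def[symmetric] \<mu>_def[symmetric]
        using fl_meas[OF N] f by (intro integral_distr) auto
      finally show ?thesis .
    qed
    obtain C where C: "\<And>N. N \<in> msk_sizes m lam \<Longrightarrow> \<bar>\<integral>x. fl N x \<partial>\<mu> N\<bar> \<le> \<beta>\<^sup>2 * C"
      using fluct_uniform_bounds[OF form K \<rho>, of h "vec_index q" fv] model unfolding fl_def \<mu>_def by blast
    have mean: "\<bar>(\<integral>\<omega>. F N \<omega> \<partial>M N) - RS\<bar> \<le> \<beta>\<^sup>2 * C / real N" if N: "N \<in> msk_sizes m lam" for N
    proof -
      interpret \<mu>: prob_space "\<mu> N" by (rule prob_\<mu>)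
      have Npos: "real N > 0" using N by (simp add: msk_sizes_def)
      have int: "integrable (\<mu> N) (fl N)"
        unfolding fl_def \<mu>_def by (rule species_model.fluct_integrable[OF model[OF N]])
      have "(\<integral>\<omega>. F N \<omega> \<partial>M N) = (\<integral>x. RS + fl N x / real N \<partial>\<mu> N)"
        by (rule transfer[OF N, of "\<lambda>x. x"]) simp
      also have "\<dots> = RS + (\<integral>x. fl N x \<partial>\<mu> N) / real N"
        using int by (simp add: \<mu>.prob_space)
      finally have "\<bar>(\<integral>\<omega>. F N \<omega> \<partial>M N) - RS\<bar> = \<bar>\<integral>x. fl N x \<partial>\<mu> N\<bar> / real N"
        using Npos by simp
      then show ?thesis using C[OF N] Npos by (simp add: divide_right_mono)
    qed
    have var: "std_normal.variance (\<lambda>\<eta>. ln (cosh (msk_field m D lam \<beta> h q s \<eta>))) = lcosh_var (fv s) h" if "s < m" for s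
      unfolding msk_field_eq[OF \<beta>] lcosh_var_def lcosh_def[abs_def] fv_def Dv_def mat_vec_ratio[OF D(1) qc that] ..
    have b_eq: "b = (\<Sum>s<m. lam s * lcosh_var (fv s) h)
        - \<beta>\<^sup>2 / 2 * wform m lam Dv (vec_index q)"
      unfolding b_def msk_b_def msk_Q_eq[OF D(1) qc] by (simp add: var Dv_def)
    have b0: "0 \<le> b"
      unfolding b_eq
      by (rule limiting_variance_nonneg[OF form K \<rho> lam0 Dv0 Dsym \<beta> q01])
        (assumption | rule fv_def | rule qfix[unfolded tanh_sq_mean_def])+
    have clt: "weak_conv_m (\<lambda>k. distr (M (r k)) borel (\<lambda>\<omega>. sqrt (real (r k)) * (F (r k) \<omega> - RS))) (normal_law 0 b)"
      if r: "\<And>k. r k \<in> msk_sizes m lam" "filterlim r at_top sequentially" for r :: "nat \<Rightarrow> nat"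
    proof (rule levy_continuity)
      have meas: "(\<lambda>\<omega>. sqrt (real (r k)) * (F (r k) \<omega> - RS)) \<in> borel_measurable (M (r k))" for k
        using FM[OF r(1)] by simp
      show "real_distribution (distr (M (r k)) borel (\<lambda>\<omega>. sqrt (real (r k)) * (F (r k) \<omega> - RS)))" for k
        by (rule prob_space.real_distribution_distr[OF PM[OF r(1)] meas])
      show "real_distribution (normal_law 0 b)"
        unfolding normal_law_def by (rule std_normal.real_distribution_distr) simp
      fix t :: real
      have "char (distr (M (r k)) borel (\<lambda>\<omega>. sqrt (real (r k)) * (F (r k) \<omega> - RS))) t
          = (\<integral>x. iexp (t / sqrt (real (r k)) * fl (r k) x) \<partial>\<mu> (r k))" for k
      proof -
        have Npos: "real (r k) > 0" using r(1)[of k] by (simp add: msk_sizes_def)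
        have "char (distr (M (r k)) borel (\<lambda>\<omega>. sqrt (real (r k)) * (F (r k) \<omega> - RS))) t
            = (\<integral>\<omega>. iexp (t * (sqrt (real (r k)) * (F (r k) \<omega> - RS))) \<partial>M (r k))"
          unfolding char_def by (rule integral_distr[OF meas]) simp
        also have "\<dots> = (\<integral>x. iexp (t * (sqrt (real (r k)) * ((RS + fl (r k) x / real (r k)) - RS))) \<partial>\<mu> (r k))"
          by (rule transfer[OF r(1), of "\<lambda>y. iexp (t * (sqrt (real (r k)) * (y - RS)))"]) simp
        also have "(\<lambda>x. t * (sqrt (real (r k)) * ((RS + fl (r k) x / real (r k)) - RS))) = (\<lambda>x. t / sqrt (real (r k)) * fl (r k) x)"
          using Npos by (intro ext) (simp add: field_simps)
        finally show ?thesis by (simp add: fun_eq_iff)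
      qed
      moreover have "char (normal_law 0 b) t = complex_of_real (exp (- (t\<^sup>2 / 2 * b)))"
      proof -
        have "char (normal_law 0 b) t = (\<integral>x. iexp (t * (0 + sqrt b * x)) \<partial>std_normal_distribution)"
          unfolding char_def normal_law_def by (rule integral_distr) simp_all
        also have "\<dots> = char std_normal_distribution (t * sqrt b)"
          unfolding char_def by (simp add: mult_ac)
        also have "\<dots> = complex_of_real (exp (- ((t * sqrt b)\<^sup>2) / 2))"
          by (simp add: char_std_normal_distribution)
        finally show ?thesis using b0 by (simp add: power_mult_distrib)
      qed
      moreover have "(\<lambda>k. \<integral>x. iexp (t / sqrt (real (r k)) * fl (r k) x) \<partial>\<mu> (r k)) \<longlonglongrightarrow> complex_of_real (exp (- (t\<^sup>2 / 2 * b)))"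
        unfolding b_eq fl_def \<mu>_def
        by (rule fluct_char_limit[OF form K \<rho> model[OF r(1)]])
          (rule filterlim_compose[OF filterlim_real_sequentially r(2)])
      ultimately show "(\<lambda>k. char (distr (M (r k)) borel (\<lambda>\<omega>. sqrt (real (r k)) * (F (r k) \<omega> - RS))) t) \<longlonglongrightarrow> char (normal_law 0 b) t"
        by simp
    qed
    show ?thesis
      using mean b0 clt unfolding F_def RS_def b_def by blast
  qed
  show ?thesis using unique main by blast
qed

end
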